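(* If $\mathbb{E}[x_{0;\infty}(0)^2]<\infty$, then $\{x_{i;\infty}(0)\}_{i\in\mathbb{Z}^d}$ is the unique translation invariant stationary solution with finite second moment; that is, the law of $\{x_{i;\infty}(0)\}_{i\in\mathbb{Z}^d}$ is the unique translation invariant stationary probability measure on $\mathbb{N}^{\mathbb{Z}^d}$ whose one-coordinate marginals have finite second moment.
   Context: $\mathbb{N}=\{0,1,2,\dots\}$. Fix $d\ge 1$, $\lambda>0$ and an interference sequence $\{a_i\}_{i\in\mathbb{Z}^d}$, meaning: $a_i\ge 0$ and $a_i=a_{-i}$ for all $i$, $a_0>0$, $a_i>0$ for at least one $i\ne 0$, and $\{i:a_i>0\}$ is finite. Dynamics. Let $(\mathcal{A}_i,\mathcal{D}_i)_{i\in\mathbb{Z}^d}$ be mutually independent, with $\mathcal{A}_i$ a Poisson point process of intensity $\lambda$ on $\mathbb{R}$ and $\mathcal{D}_i$ a Poisson point process of intensity $1$ on $\mathbb{R}\times[0,1/a_0]$. The state is $\{x_i(t)\}_{i\in\mathbb{Z}^d}\in\mathbb{N}^{\mathbb{Z}^d}$. At each atom of $\mathcal{A}_i$ a customer is added to queue $i$. At each atom $(D,U)$ of $\mathcal{D}_i$ a customer (if any) is removed from queue $i$ if and only if $U\le \frac{x_i(D^-)}{\sum_{j}a_jx_{i-j}(D^-)}$. Thus, given the state at time $t$, the departure rate from queue $i$ is $\frac{x_i(t)}{\sum_{j\in\mathbb{Z}^d}a_jx_{i-j}(t)}$, with $0/0=0$. Almost surely these rules determine a unique process with right-continuous, piecewise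 constant coordinates from any initial condition in $\mathbb{N}^{\mathbb{Z}^d}$ at any starting time. Minimal stationary solution. For $T\ge 0$ and $s\ge -T$, let $\{x_{i;T}(s)\}_{i}$ be the state at time $s$ when the system is started at time $-T$ with all queues empty. Almost surely $x_{i;T}(s)$ is non-decreasing in $T$; set $x_{i;\infty}(s)=\lim_{T\to\infty}x_{i;T}(s)\in\mathbb{N}\cup\{\infty\}$. A probability measure $\pi$ on $\mathbb{N}^{\mathbb{Z}^d}$ is stationary if, whenever $\{x_i(0)\}_i\sim\pi$ independently of everything else, $\{x_i(t)\}_i\sim\pi$ for all $t\ge 0$. It is translation invariant if $(y_i)_{i}\sim\pi$ implies $(y_{i-x})_{i}\sim\pi$ for all $x\in\mathbb{Z}^d$. *)

theory Defs
  imports "HOL-Probability.Probability"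
begin

text \<open>
  The lattice $\mathbb{Z}^d$ is \<^typ>\<open>int ^ 'd\<close> for a finite (hence nonempty) index type
  \<^typ>\<open>'d\<close>, so that $d \ge 1$ is arbitrary.
\<close>

definition interference_sequence :: "(int ^ 'd \<Rightarrow> real) \<Rightarrow> bool" where
  "interference_sequence a \<longleftrightarrow>
     (\<forall>i. 0 \<le> a i) \<and> (\<forall>i. a i = a (- i)) \<and> 0 < a 0 \<and> (\<exists>i. i \<noteq> 0 \<and> 0 < a i) \<and>
     finite {i. 0 < a i}"


section \<open>Poisson point processes\<close>

text \<open>
  The intensities needed here have no atoms, so a point process is taken to be simple: a random
  locally finite set of points.  All randomness is carried by the counts on bounded Borel sets.
  The Poisson weights are written out, rather than taken from \<^const>\<open>poisson_pmf\<close>, because the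
  library facts about the latter exclude rate \<open>0\<close>, i.e. Lebesgue-null sets \<open>B\<close>.
\<close>

definition point_process :: "'w measure \<Rightarrow> 'e::euclidean_space set \<Rightarrow> ('w \<Rightarrow> 'e set) \<Rightarrow> bool" where
  "point_process M S P \<longleftrightarrow>
     (\<forall>\<omega>\<in>space M. P \<omega> \<subseteq> S \<and> (\<forall>B. bounded B \<longrightarrow> finite (P \<omega> \<inter> B))) \<and>
     (\<forall>B\<in>sets borel. bounded B \<longrightarrow> (\<lambda>\<omega>. card (P \<omega> \<inter> B)) \<in> M \<rightarrow>\<^sub>M count_space UNIV)"

definition poisson_process ::
  "'w measure \<Rightarrow> real \<Rightarrow> 'e::euclidean_space set \<Rightarrow> ('w \<Rightarrow> 'e set) \<Rightarrow> bool" where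
  "poisson_process M c S P \<longleftrightarrow>
     point_process M S P \<and>
     (\<forall>B\<in>sets borel. bounded B \<and> B \<subseteq> S \<longrightarrow>
        (\<forall>k. measure M {\<omega> \<in> space M. card (P \<omega> \<inter> B) = k} =
             (c * measure lborel B) ^ k / fact k * exp (- (c * measure lborel B)))) \<and>
     (\<forall>(n::nat) B. (\<forall>k<n. B k \<in> sets borel \<and> bounded (B k) \<and> B k \<subseteq> S) \<and>
        disjoint_family_on B {..<n} \<longrightarrow>
        prob_space.indep_vars M (\<lambda>_. count_space UNIV) (\<lambda>k \<omega>. card (P \<omega> \<inter> B k)) {..<n})"

definition process_events :: "'w measure \<Rightarrow> ('w \<Rightarrow> 'e::euclidean_space set) \<Rightarrow> 'w set set" where
  "process_events M P = sigma_sets (space M)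
     {{\<omega> \<in> space M. card (P \<omega> \<inter> B) = k} | B k. B \<in> sets borel \<and> bounded B}"

text \<open>
  All the processes $\mathcal{A}_i$, $\mathcal{D}_i$ are mutually independent; in particular
  $\mathcal{A}_i$ is independent of $\mathcal{D}_i$ for the same \<open>i\<close>.
\<close>

definition driving_processes ::
  "'w measure \<Rightarrow> real \<Rightarrow> (int ^ 'd \<Rightarrow> real) \<Rightarrow>
   (int ^ 'd \<Rightarrow> 'w \<Rightarrow> real set) \<Rightarrow> (int ^ 'd \<Rightarrow> 'w \<Rightarrow> (real \<times> real) set) \<Rightarrow> bool" where
  "driving_processes M lam a A D \<longleftrightarrow>
     (\<forall>i. poisson_process M lam UNIV (A i)) \<and>
     (\<forall>i. poisson_process M 1 (UNIV \<times> {0..1 / a 0}) (D i)) \<and>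
     prob_space.indep_sets M
       (case_sum (\<lambda>i. process_events M (A i)) (\<lambda>i. process_events M (D i))) UNIV"


section \<open>Dynamics\<close>

text \<open>The convention \<open>0 / 0 = 0\<close> is that of HOL.\<close>

definition departure_rate :: "(int ^ 'd \<Rightarrow> real) \<Rightarrow> (int ^ 'd \<Rightarrow> nat) \<Rightarrow> int ^ 'd \<Rightarrow> real" where
  "departure_rate a y i = real (y i) / (\<Sum>j | 0 < a j. a j * real (y (i - j)))"

definition left_state :: "(real \<Rightarrow> int ^ 'd \<Rightarrow> nat) \<Rightarrow> real \<Rightarrow> int ^ 'd \<Rightarrow> nat" where
  "left_state x t i = Lim (at_left t) (\<lambda>u. x u i)"

text \<open>
  \<open>trajectory a \<alpha> \<delta> s \<xi> x\<close>: on \<open>[s, \<infinity>)\<close>, \<open>x\<close> follows the dynamics driven by the atoms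
  \<open>\<alpha>\<close>, \<open>\<delta>\<close> in \<open>(s, \<infinity>)\<close>, from the state \<open>\<xi>\<close> at time \<open>s\<close>.  Since \<^typ>\<open>nat\<close> carries the discrete
  topology, a coordinate that is right-continuous with left limits is piecewise constant with
  finitely many jumps in every compact time interval.  The third clause fixes the jump at every
  time, so there is no jump away from the atoms; simultaneous atoms at one queue, for which it
  also makes a choice, almost surely do not occur.
\<close>

definition trajectory ::
  "(int ^ 'd \<Rightarrow> real) \<Rightarrow> (int ^ 'd \<Rightarrow> real set) \<Rightarrow> (int ^ 'd \<Rightarrow> (real \<times> real) set) \<Rightarrow>
   real \<Rightarrow> (int ^ 'd \<Rightarrow> nat) \<Rightarrow> (real \<Rightarrow> int ^ 'd \<Rightarrow> nat) \<Rightarrow> bool" where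
  "trajectory a \<alpha> \<delta> s \<xi> x \<longleftrightarrow>
     x s = \<xi> \<and>
     (\<forall>i. (\<forall>t\<ge>s. continuous (at_right t) (\<lambda>u. x u i)) \<and>
          (\<forall>t>s. \<exists>l. ((\<lambda>u. x u i) \<longlongrightarrow> l) (at_left t))) \<and>
     (\<forall>t>s. \<forall>i. x t i =
        left_state x t i
        + (if t \<in> \<alpha> i then 1 else 0)
        - (if 0 < left_state x t i \<and>
              (\<exists>U. (t, U) \<in> \<delta> i \<and> U \<le> departure_rate a (left_state x t) i) then 1 else 0))"

text \<open>
  The state at time \<open>t \<ge> s\<close> of the system started at time \<open>s\<close> in state \<open>\<xi>\<close>.  The trajectory on
  \<open>[s, \<infinity>)\<close> is unique only outside a null set of driving configurations; elsewhere the value is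
  unspecified, possibly in a non-measurable way.  This is why laws and expectations of such states
  are taken below with respect to the completion of the underlying probability measure.
\<close>

definition evolve ::
  "(int ^ 'd \<Rightarrow> real) \<Rightarrow> (int ^ 'd \<Rightarrow> real set) \<Rightarrow> (int ^ 'd \<Rightarrow> (real \<times> real) set) \<Rightarrow>
   real \<Rightarrow> (int ^ 'd \<Rightarrow> nat) \<Rightarrow> real \<Rightarrow> int ^ 'd \<Rightarrow> nat" where
  "evolve a \<alpha> \<delta> s \<xi> t = (THE y. \<exists>x. trajectory a \<alpha> \<delta> s \<xi> x \<and> x t = y)"

definition x_from ::
  "(int ^ 'd \<Rightarrow> real) \<Rightarrow> (int ^ 'd \<Rightarrow> 'w \<Rightarrow> real set) \<Rightarrow> (int ^ 'd \<Rightarrow> 'w \<Rightarrow> (real \<times> real) set) \<Rightarrow>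
   real \<Rightarrow> real \<Rightarrow> 'w \<Rightarrow> int ^ 'd \<Rightarrow> nat" where
  "x_from a A D T s \<omega> = evolve a (\<lambda>i. A i \<omega>) (\<lambda>i. D i \<omega>) (- T) (\<lambda>_. 0) s"

definition x_inf ::
  "(int ^ 'd \<Rightarrow> real) \<Rightarrow> (int ^ 'd \<Rightarrow> 'w \<Rightarrow> real set) \<Rightarrow> (int ^ 'd \<Rightarrow> 'w \<Rightarrow> (real \<times> real) set) \<Rightarrow>
   real \<Rightarrow> 'w \<Rightarrow> int ^ 'd \<Rightarrow> enat" where
  "x_inf a A D s \<omega> i = Lim at_top (\<lambda>T. enat (x_from a A D T s \<omega> i))"


section \<open>Laws on the configuration space\<close>

definition config_space :: "(int ^ 'd \<Rightarrow> nat) measure" where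
  "config_space = PiM UNIV (\<lambda>_. count_space UNIV)"

definition config_prob :: "(int ^ 'd \<Rightarrow> nat) measure \<Rightarrow> bool" where
  "config_prob \<pi> \<longleftrightarrow> prob_space \<pi> \<and> sets \<pi> = sets config_space"

text \<open>
  An initial condition with law \<open>\<pi>\<close> independent of the driving processes is realised as the first
  coordinate on the product of \<open>\<pi>\<close> with the probability space carrying the driving processes.
\<close>

definition stationary ::
  "'w measure \<Rightarrow> (int ^ 'd \<Rightarrow> real) \<Rightarrow>
   (int ^ 'd \<Rightarrow> 'w \<Rightarrow> real set) \<Rightarrow> (int ^ 'd \<Rightarrow> 'w \<Rightarrow> (real \<times> real) set) \<Rightarrow>
   (int ^ 'd \<Rightarrow> nat) measure \<Rightarrow> bool" where
  "stationary M a A D \<pi> \<longleftrightarrow>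
     (\<forall>t\<ge>0. distr (completion (\<pi> \<Otimes>\<^sub>M M)) config_space
        (\<lambda>(\<xi>, \<omega>). evolve a (\<lambda>i. A i \<omega>) (\<lambda>i. D i \<omega>) 0 \<xi> t) = \<pi>)"

definition translation_invariant :: "(int ^ 'd \<Rightarrow> nat) measure \<Rightarrow> bool" where
  "translation_invariant \<pi> \<longleftrightarrow> (\<forall>v. distr \<pi> config_space (\<lambda>y i. y (i - v)) = \<pi>)"

definition finite_second_moment :: "(int ^ 'd \<Rightarrow> nat) measure \<Rightarrow> bool" where
  "finite_second_moment \<pi> \<longleftrightarrow> (\<forall>i. (\<integral>\<^sup>+ y. (of_nat (y i))\<^sup>2 \<partial>\<pi>) < \<infinity>)"

text \<open>
  This is the law of the minimal stationary solution at time \<open>0\<close> when its coordinates are almost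
  surely finite; the value that \<^const>\<open>the_enat\<close> gives to \<open>\<infinity>\<close> is then irrelevant.
\<close>

definition minimal_law ::
  "'w measure \<Rightarrow> (int ^ 'd \<Rightarrow> real) \<Rightarrow>
   (int ^ 'd \<Rightarrow> 'w \<Rightarrow> real set) \<Rightarrow> (int ^ 'd \<Rightarrow> 'w \<Rightarrow> (real \<times> real) set) \<Rightarrow>
   (int ^ 'd \<Rightarrow> nat) measure" where
  "minimal_law M a A D =
     distr (completion M) config_space (\<lambda>\<omega> i. the_enat (x_inf a A D 0 \<omega> i))"

end

theory Submission
  imports Defs
begin

text \<open>
  Almost surely every backward chain of atoms, each able to influence the preceding one, is finite, so
  the dynamics are solved by well-founded recursion along these chains.  The dynamics are monotone in
  the initial state, hence every stationary solution dominates, in the natural coupling, the system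
  started empty, whose law at time \<open>t\<close> increases to the minimal one.  Rate conservation for
  $x_0$ and for $x_0 \sum_j a_j x_j$ shows that a translation invariant stationary law with finite
  second moment has mean \<open>m\<close> with $m\,(1 - \lambda \sum_j a_j) = \lambda a_0$: the denominators of
  the departure rates cancel.  Hence the two coupled solutions have the same mean in the limit, and
  so they coincide.
\<close>

section \<open>The dynamics for a fixed driving configuration\<close>

text \<open>The obstacle is the infinite lattice: infinitely many atoms fall into every time
  interval, so there is no first jump to start an induction from, and \<open>evolve\<close>, defined
  by \<open>THE\<close>, is not visibly measurable. Chains of influence settle both: they carry a
  recursion, and they show that an Euler scheme, which reads only counts of atoms in rectangles, is
  eventually exact at each coordinate. The cancellation: write R for the departure rate.
  Conservation for x_0 gives E R_0 = lam. Conservation for x_0 sum_j a_j x_j gives 2 lam m sum_j a_j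
  - sum_j a_j (E R_0 x_j + E x_0 R_j) + 2 lam a_0 = 0. Translation invariance turns E x_0 R_j into E
  R_0 x_{-j}; the symmetry of a lets x_j be replaced by x_{-j} in the other sum; and R_0 sum_j a_j
  x_{-j} = x_0 pointwise. So the subtracted sum is 2 m. As lam a_0 is nonzero, the resulting
  equation forces the factor of m to be nonzero and determines m. Truncation is avoided because
  rates are at most 1 / a_0: the error over a time step h is h^2 times a function linear in the
  state.\<close>

definition update ::
  "(int ^ 'd \<Rightarrow> real) \<Rightarrow> (int ^ 'd \<Rightarrow> real set) \<Rightarrow> (int ^ 'd \<Rightarrow> (real \<times> real) set) \<Rightarrow>
   (int ^ 'd \<Rightarrow> nat) \<Rightarrow> real \<Rightarrow> int ^ 'd \<Rightarrow> nat" where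
  "update a \<alpha> \<delta> y t i = y i + (if t \<in> \<alpha> i then 1 else 0)
     - (if 0 < y i \<and> (\<exists>U. (t, U) \<in> \<delta> i \<and> U \<le> departure_rate a y i) then 1 else 0)"

definition event_times ::
  "(int ^ 'd \<Rightarrow> real set) \<Rightarrow> (int ^ 'd \<Rightarrow> (real \<times> real) set) \<Rightarrow> int ^ 'd \<Rightarrow> real set" where
  "event_times \<alpha> \<delta> i = \<alpha> i \<union> fst ` \<delta> i"

text \<open>The predecessor comes first in the pair, so well-foundedness says that every backward
  chain of influence inside (s, \<infinity>) stops. As \<open>a 0\<close> is positive, earlier atoms
  of the same queue are predecessors too.\<close>

definition causal ::
  "(int ^ 'd \<Rightarrow> real) \<Rightarrow> (int ^ 'd \<Rightarrow> real set) \<Rightarrow> (int ^ 'd \<Rightarrow> (real \<times> real) set) \<Rightarrow> real \<Rightarrow>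
   (((int ^ 'd) \<times> real) \<times> ((int ^ 'd) \<times> real)) set" where
  "causal a \<alpha> \<delta> s = {((j, u), (i, t)). s < u \<and> u < t \<and> u \<in> event_times \<alpha> \<delta> j \<and>
     t \<in> event_times \<alpha> \<delta> i \<and> 0 < a (i - j)}"

text \<open>The time at which the value of queue \<open>i\<close> just before \<open>t\<close> could
  last have changed; \<open>s\<close> stands for the initial state and keeps the set nonempty. The
  variant \<open>last_event_le\<close> admits an atom at \<open>t\<close> itself, so it describes
  the state at \<open>t\<close> and not its left limit.\<close>

definition last_event ::
  "(int ^ 'd \<Rightarrow> real set) \<Rightarrow> (int ^ 'd \<Rightarrow> (real \<times> real) set) \<Rightarrow> real \<Rightarrow> real \<Rightarrow> int ^ 'd \<Rightarrow> real" where
  "last_event \<alpha> \<delta> s t i = Max (insert s (event_times \<alpha> \<delta> i \<inter> {s<..<t}))"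

definition last_event_le ::
  "(int ^ 'd \<Rightarrow> real set) \<Rightarrow> (int ^ 'd \<Rightarrow> (real \<times> real) set) \<Rightarrow> real \<Rightarrow> real \<Rightarrow> int ^ 'd \<Rightarrow> real" where
  "last_event_le \<alpha> \<delta> s t i = Max (insert s (event_times \<alpha> \<delta> i \<inter> {s<..t}))"

section \<open>A single update: dependence on neighbours and monotonicity\<close>

locale interference =
  fixes a :: "int ^ 'd \<Rightarrow> real"
  assumes interference: "interference_sequence a"
begin

lemma a_nonneg: "0 \<le> a i" and a_sym: "a (- i) = a i" and a_zero: "0 < a 0"
  and finite_support: "finite {i. 0 < a i}"
  using interference unfolding interference_sequence_def by auto

lemma finite_neighbours: "finite {j. 0 < a (i - j)}"
proof -
  have "{j. 0 < a (i - j)} = (\<lambda>k. i - k) ` {k. 0 < a k}"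
    by (auto simp: image_iff intro: exI[of _ "i - _"]) (metis add_diff_cancel_left' diff_add_cancel)
  then show ?thesis using finite_support by simp
qed

lemma departure_rate_cong:
  assumes "\<And>j. 0 < a (i - j) \<Longrightarrow> y j = y' j"
  shows "departure_rate a y i = departure_rate a y' i"
proof -
  have "y i = y' i" using assms[of i] a_zero by simp
  moreover have "y (i - j) = y' (i - j)" if "0 < a j" for j
    using assms[of "i - j"] that by simp
  then have "(\<Sum>j | 0 < a j. a j * real (y (i - j))) = (\<Sum>j | 0 < a j. a j * real (y' (i - j)))"
    by (intro sum.cong) auto
  ultimately show ?thesis unfolding departure_rate_def by simp
qed

lemma update_cong:
  assumes "\<And>j. 0 < a (i - j) \<Longrightarrow> y j = y' j"
  shows "update a \<alpha> \<delta> y t i = update a \<alpha> \<delta> y' t i"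
proof -
  have "y i = y' i" using assms[of i] a_zero by simp
  then show ?thesis unfolding update_def using departure_rate_cong[OF assms] by simp
qed

lemma interference_sum_ge: "a 0 * real (y i) \<le> (\<Sum>j | 0 < a j. a j * real (y (i - j)))"
proof -
  have "a 0 * real (y (i - 0)) \<le> (\<Sum>j | 0 < a j. a j * real (y (i - j)))"
    by (rule member_le_sum) (use finite_support a_zero a_nonneg in auto)
  then show ?thesis by simp
qed

lemma departure_rate_bounds: "0 \<le> departure_rate a y i" "departure_rate a y i \<le> 1 / a 0"
proof -
  let ?s = "\<Sum>j | 0 < a j. a j * real (y (i - j))"
  have s: "a 0 * real (y i) \<le> ?s" by (rule interference_sum_ge)
  have s0: "0 \<le> ?s" by (intro sum_nonneg) (simp add: a_nonneg)
  show "0 \<le> departure_rate a y i" unfolding departure_rate_def using s0 by simp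
  show "departure_rate a y i \<le> 1 / a 0"
  proof (cases "?s = 0")
    case True
    then show ?thesis unfolding departure_rate_def using a_zero by simp
  next
    case False
    then show ?thesis unfolding departure_rate_def using s s0 a_zero
      by (simp add: divide_simps mult.commute)
  qed
qed

text \<open>With equal queues at \<open>i\<close> only the denominators differ, and more customers
  around mean more interference. A nonempty queue at \<open>i\<close> keeps the smaller denominator
  positive.\<close>

lemma departure_rate_antimono:
  assumes "y \<le> y'" "y i = y' i" "0 < y i"
  shows "departure_rate a y' i \<le> departure_rate a y i"
proof -
  let ?s = "\<lambda>y. \<Sum>j | 0 < a j. a j * real (y (i - j))"
  have "0 < a 0 * real (y i)" using assms a_zero by simp
  then have "0 < ?s y" using interference_sum_ge[of y i] by linarith
  moreover have "?s y \<le> ?s y'"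
    using assms(1) by (intro sum_mono mult_left_mono) (auto simp: le_fun_def)
  ultimately show ?thesis unfolding departure_rate_def assms(2)
    by (intro divide_left_mono) auto
qed

text \<open>
  If the queues at \<open>i\<close> agree, the smaller configuration has the larger departure rate; otherwise
  there is room for one departure.
\<close>
lemma update_mono:
  assumes "y \<le> y'"
  shows "update a \<alpha> \<delta> y t i \<le> update a \<alpha> \<delta> y' t i"
proof (cases "y i = y' i \<and> 0 < y i")
  case True
  then have "departure_rate a y' i \<le> departure_rate a y i"
    using departure_rate_antimono[OF assms] by blast
  then have "(\<exists>U. (t, U) \<in> \<delta> i \<and> U \<le> departure_rate a y' i) \<Longrightarrow>
      (\<exists>U. (t, U) \<in> \<delta> i \<and> U \<le> departure_rate a y i)"
    using order_trans by blast
  then show ?thesis using True unfolding update_def by simp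
next
  case False
  moreover have "y i \<le> y' i" using assms by (simp add: le_fun_def)
  ultimately have "y i = 0 \<and> y' i = 0 \<or> y i < y' i" by auto
  then show ?thesis
  proof
    assume "y i < y' i"
    then have "y i + c - d \<le> y' i + c - e" if "e \<le> 1" for c d e :: nat using that by linarith
    then show ?thesis unfolding update_def by simp
  qed (simp add: update_def)
qed

end

text \<open>All that the pathwise theory needs from the randomness. Local finiteness makes
  \<open>last_event\<close> a maximum of a finite set; well-foundedness takes the place of a first
  jump, which an infinite system does not have.\<close>

locale driven = interference a for a :: "int ^ 'd \<Rightarrow> real" +
  fixes \<alpha> :: "int ^ 'd \<Rightarrow> real set" and \<delta> :: "int ^ 'd \<Rightarrow> (real \<times> real) set"
  assumes finite_events: "finite (event_times \<alpha> \<delta> i \<inter> {u..v})"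
    and wf_causal: "wf (causal a \<alpha> \<delta> s)"
begin

abbreviation E where "E \<equiv> event_times \<alpha> \<delta>"
abbreviation traj where "traj \<equiv> trajectory a \<alpha> \<delta>"
abbreviation upd where "upd \<equiv> update a \<alpha> \<delta>"

lemma finite_events': "finite (E i \<inter> {u<..<v})" "finite (E i \<inter> {u<..v})"
proof -
  have "E i \<inter> {u<..<v} \<subseteq> E i \<inter> {u..v}" "E i \<inter> {u<..v} \<subseteq> E i \<inter> {u..v}" by auto
  then show "finite (E i \<inter> {u<..<v})" "finite (E i \<inter> {u<..v})"
    using finite_subset[OF _ finite_events] by blast+
qed

lemma update_no_event: "t \<notin> E i \<Longrightarrow> upd y t i = y i"
proof -
  assume "t \<notin> E i"
  then have "t \<notin> \<alpha> i" "\<nexists>U. (t, U) \<in> \<delta> i"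
    unfolding event_times_def by (auto simp: rev_image_eqI)
  then show ?thesis unfolding update_def by simp
qed

lemma last_event:
  fixes i s t
  assumes "s < t"
  defines "w \<equiv> last_event \<alpha> \<delta> s t i"
  shows "s \<le> w" "w < t" "E i \<inter> {w<..<t} = {}" "w = s \<or> s < w \<and> w \<in> E i"
proof -
  let ?A = "insert s (E i \<inter> {s<..<t})"
  have fin: "finite ?A" using finite_events' by simp
  have w: "w \<in> ?A" unfolding w_def last_event_def by (rule Max_in[OF fin]) simp
  have ge: "u \<le> w" if "u \<in> ?A" for u
    unfolding w_def last_event_def by (rule Max_ge[OF fin that])
  show "s \<le> w" "w < t" "w = s \<or> s < w \<and> w \<in> E i" using w assms(1) by auto
  show "E i \<inter> {w<..<t} = {}"
  proof (rule ccontr)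
    assume "E i \<inter> {w<..<t} \<noteq> {}"
    then obtain u where u: "u \<in> E i" "w < u" "u < t" by auto
    then have "u \<in> ?A" using \<open>s \<le> w\<close> by auto
    then show False using ge u(2) by force
  qed
qed

lemma last_event_le:
  fixes i s t
  assumes "s \<le> t"
  defines "w \<equiv> last_event_le \<alpha> \<delta> s t i"
  shows "s \<le> w" "w \<le> t" "E i \<inter> {w<..t} = {}" "w = s \<or> s < w \<and> w \<in> E i"
proof -
  let ?A = "insert s (E i \<inter> {s<..t})"
  have fin: "finite ?A" using finite_events' by simp
  have w: "w \<in> ?A" unfolding w_def last_event_le_def by (rule Max_in[OF fin]) simp
  have ge: "u \<le> w" if "u \<in> ?A" for u
    unfolding w_def last_event_le_def by (rule Max_ge[OF fin that])
  show "s \<le> w" "w \<le> t" "w = s \<or> s < w \<and> w \<in> E i" using w assms(1) by auto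
  show "E i \<inter> {w<..t} = {}"
  proof (rule ccontr)
    assume "E i \<inter> {w<..t} \<noteq> {}"
    then obtain u where u: "u \<in> E i" "w < u" "u \<le> t" by auto
    then have "u \<in> ?A" using \<open>s \<le> w\<close> by auto
    then show False using ge u(2) by force
  qed
qed

lemma last_event_le_unique:
  assumes "s \<le> w" "w \<le> t" "E i \<inter> {w<..t} = {}" "w = s \<or> w \<in> E i"
  shows "last_event_le \<alpha> \<delta> s t i = w"
  unfolding last_event_le_def
proof (rule Max_eqI)
  show "finite (insert s (E i \<inter> {s<..t}))" using finite_events' by simp
  show "w \<in> insert s (E i \<inter> {s<..t})" using assms by auto
  fix u assume "u \<in> insert s (E i \<inter> {s<..t})"
  then show "u \<le> w" using assms(1,3) by (cases "u \<le> w") auto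
qed

text \<open>Well-founded induction on \<open>causal\<close>: the neighbours of \<open>i\<close>
  enter an atom at (i, t) through their values at \<open>last_event\<close>, and each such time is
  either the start or an atom that is a causal predecessor.\<close>

lemma event_induct [consumes 1, case_names start event]:
  assumes "t = s \<or> s < t \<and> t \<in> E i"
    and start: "\<And>j. P j s"
    and event: "\<And>i t. s < t \<Longrightarrow> t \<in> E i \<Longrightarrow>
      (\<And>j. 0 < a (i - j) \<Longrightarrow> P j (last_event \<alpha> \<delta> s t j)) \<Longrightarrow> P i t"
  shows "P i t"
proof -
  have "s < snd it \<Longrightarrow> snd it \<in> E (fst it) \<Longrightarrow> P (fst it) (snd it)" for it
    using wf_causal[of s]
  proof (induction it rule: wf_induct_rule)
    case (less it)
    obtain i t where it: "it = (i, t)" by (cases it)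
    have st: "s < t" "t \<in> E i" using less.prems it by auto
    have "P i t"
    proof (rule event[OF st])
      fix j assume j: "0 < a (i - j)"
      let ?w = "last_event \<alpha> \<delta> s t j"
      show "P j ?w"
      proof (cases "?w = s")
        case False
        then have "s < ?w" "?w \<in> E j" "?w < t" using last_event[OF st(1), of j] by auto
        then show ?thesis
          using less.IH[of "(j, ?w)"] st j by (simp add: it causal_def)
      qed (use start[of j] in simp)
    qed
    then show ?case by (simp add: it)
  qed
  from this[of "(i, t)"] show ?thesis using assms(1) start[of i] by auto
qed

lemma trajectory_start: "traj s \<xi> x \<Longrightarrow> x s = \<xi>"
  unfolding trajectory_def by blast

lemma trajectory_jump:
  "traj s \<xi> x \<Longrightarrow> s < t \<Longrightarrow> x t i = upd (left_state x t) t i"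
  unfolding trajectory_def update_def by blast

lemma trajectory_left:
  assumes "traj s \<xi> x" "s < t"
  shows "((\<lambda>u. x u i) \<longlongrightarrow> left_state x t i) (at_left t)"
proof -
  obtain l where l: "((\<lambda>u. x u i) \<longlongrightarrow> l) (at_left t)"
    using assms unfolding trajectory_def by blast
  then have "left_state x t i = l"
    unfolding left_state_def by (intro tendsto_Lim) auto
  then show ?thesis using l by simp
qed

text \<open>Away from atoms the jump rule makes the value equal to the left limit, so together with
  right-continuity the coordinate is continuous on the interval. A continuous function from an
  interval to a discrete space is constant.\<close>

lemma trajectory_const:
  assumes x: "traj s \<xi> x" and uv: "s \<le> u" "u \<le> v" and none: "E i \<inter> {u<..v} = {}"
  shows "x v i = x u i"
proof (cases "u = v")
  case False
  then have "u < v" using uv by simp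
  let ?f = "\<lambda>t. x t i"
  have right: "continuous (at_right t) ?f" if "s \<le> t" for t
    using x that unfolding trajectory_def by blast
  have "continuous (at t within {u..v}) ?f" if t: "t \<in> {u..v}" for t
  proof (cases "t = u")
    case True
    have "at t within {u..v} = at_right t"
      using \<open>u < v\<close> True by (simp add: at_within_Icc_at_right)
    then show ?thesis using right[of t] True uv by simp
  next
    case False
    then have st: "s < t" "t \<notin> E i" using t uv none by force+
    then have "?f t = left_state x t i"
      using trajectory_jump[OF x st(1)] update_no_event by simp
    then have "continuous (at_left t) ?f"
      using trajectory_left[OF x st(1), of i] by (simp add: continuous_within)
    then have "continuous (at t) ?f"
      using right[of t] st by (simp add: continuous_at_split)
    then show ?thesis by (rule continuous_at_imp_continuous_at_within)
  qed
  then have "continuous_on {u..v} ?f" by (simp add: continuous_on_eq_continuous_within)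
  then have "connected (?f ` {u..v})" by (intro connected_continuous_image) auto
  \<comment> \<open>Singletons are open in \<open>nat\<close>, so comparison with one value is a
    continuous boolean function, and connectedness makes it constant.\<close>
  moreover have "continuous_on (?f ` {u..v}) (\<lambda>n. n = ?f u)"
    unfolding continuous_on_topological
    by (intro ballI allI impI exI[of _ "{_}"]) (auto simp: discrete_topology_class.open_discrete)
  ultimately obtain c where "\<forall>n\<in>?f ` {u..v}. (n = ?f u) = c" unfolding connected_iff_const by blast
  then have "(?f v = ?f u) = (?f u = ?f u)" using uv by fastforce
  then show ?thesis by simp
qed simp

lemma left_state_eq:
  assumes "\<And>u. w \<le> u \<Longrightarrow> u < t \<Longrightarrow> x u i = c" "w < t"
  shows "left_state x t i = c"
proof -
  have "\<forall>\<^sub>F u in at_left t. x u i = c"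
    using eventually_at_left_real[OF assms(2)] by eventually_elim (use assms(1) in auto)
  then have "((\<lambda>u. x u i) \<longlongrightarrow> c) (at_left t)" by (rule tendsto_eventually)
  then show ?thesis unfolding left_state_def by (intro tendsto_Lim) auto
qed

lemma trajectory_left_state:
  assumes x: "traj s \<xi> x" and "s \<le> w" "w < t" "E i \<inter> {w<..<t} = {}"
  shows "left_state x t i = x w i"
proof (rule left_state_eq[OF _ \<open>w < t\<close>])
  fix u assume u: "w \<le> u" "u < t"
  then have "E i \<inter> {w<..u} = {}" using assms(4) by fastforce
  then show "x u i = x w i" using trajectory_const[OF x assms(2) u(1)] by simp
qed

lemma trajectory_last_event:
  assumes "traj s \<xi> x" "s < t"
  shows "left_state x t i = x (last_event \<alpha> \<delta> s t i) i"
  using trajectory_left_state[OF assms(1)] last_event[OF assms(2)] by blast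

lemma trajectory_last_event_le:
  assumes "traj s \<xi> x" "s \<le> t"
  shows "x t i = x (last_event_le \<alpha> \<delta> s t i) i"
  using trajectory_const[OF assms(1)] last_event_le[OF assms(2)] by blast

text \<open>The case \<open>all\<close> passes from atoms to arbitrary times: the state at
  \<open>t\<close> is the one left by the last atom up to \<open>t\<close>.\<close>

lemma trajectory_induct [consumes 1, case_names start event all]:
  assumes "s \<le> t"
    and "\<And>j. P j s"
    and "\<And>i t. s < t \<Longrightarrow> t \<in> E i \<Longrightarrow>
      (\<And>j. 0 < a (i - j) \<Longrightarrow> P j (last_event \<alpha> \<delta> s t j)) \<Longrightarrow> P i t"
    and "P i (last_event_le \<alpha> \<delta> s t i) \<Longrightarrow> P i t"
  shows "P i t"
proof (rule assms(4), rule event_induct[where s = s and P = P])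
  show "last_event_le \<alpha> \<delta> s t i = s \<or> s < last_event_le \<alpha> \<delta> s t i \<and> last_event_le \<alpha> \<delta> s t i \<in> E i"
    by (rule last_event_le(4)[OF assms(1)])
qed (rule assms(2,3); assumption)+

section \<open>Comparison, uniqueness and continuity of trajectories\<close>

theorem trajectory_mono:
  assumes x: "traj s \<xi> x" and x': "traj s \<xi>' x'" and "\<xi> \<le> \<xi>'" "s \<le> t"
  shows "x t i \<le> x' t i"
  using assms(4)
proof (induction rule: trajectory_induct)
  case (start j)
  then show ?case using assms by (simp add: trajectory_start[OF x] trajectory_start[OF x'] le_fun_def)
next
  case (event i t)
  \<comment> \<open>The induction hypothesis compares the two states at the neighbours of
    \<open>i\<close> only. Setting all other queues to 0 makes the configurations comparable
    everywhere and leaves the update at \<open>i\<close> unchanged.\<close>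
  let ?cut = "\<lambda>y j. if 0 < a (i - j) then y j else 0"
  have "x t i = upd (?cut (left_state x t)) t i"
    unfolding trajectory_jump[OF x event(1)] by (rule update_cong) simp
  also have "\<dots> \<le> upd (?cut (left_state x' t)) t i"
    by (rule update_mono)
      (use event in \<open>simp add: le_fun_def trajectory_last_event[OF x] trajectory_last_event[OF x']\<close>)
  also have "\<dots> = x' t i"
    unfolding trajectory_jump[OF x' event(1)] by (rule update_cong) simp
  finally show ?case .
next
  case all
  then show ?case using trajectory_last_event_le[OF x assms(4)] trajectory_last_event_le[OF x' assms(4)]
    by simp
qed

lemma trajectory_unique:
  assumes "traj s \<xi> x" "traj s \<xi> x'" "s \<le> t"
  shows "x t = x' t"
  using trajectory_mono[OF assms(1,2) order_refl assms(3)]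
    trajectory_mono[OF assms(2,1) order_refl assms(3)] by (auto intro: order_antisym)

text \<open>Each state depends on finitely many coordinates of the initial state.\<close>
theorem trajectory_continuous:
  assumes x: "traj s \<xi> x" and X: "\<And>n. traj s (\<Xi> n) (X n)"
    and lim: "\<And>j. \<forall>\<^sub>F n in F. \<Xi> n j = \<xi> j" and "s \<le> t"
  shows "\<forall>\<^sub>F n in F. X n t i = x t i"
  using \<open>s \<le> t\<close>
proof (induction rule: trajectory_induct)
  case (start j)
  then show ?case using lim[of j] by (simp add: trajectory_start[OF x] trajectory_start[OF X])
next
  case (event i t)
  have "\<forall>\<^sub>F n in F. \<forall>j\<in>{j. 0 < a (i - j)}.
      X n (last_event \<alpha> \<delta> s t j) j = x (last_event \<alpha> \<delta> s t j) j"
    by (rule eventually_ball_finite[OF finite_neighbours]) (use event in auto)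
  then show ?case
  proof eventually_elim
    case (elim n)
    show ?case unfolding trajectory_jump[OF x event(1)] trajectory_jump[OF X event(1)]
      by (rule update_cong)
        (use elim in \<open>simp add: trajectory_last_event[OF x event(1)] trajectory_last_event[OF X event(1)]\<close>)
  qed
next
  case all
  then show ?case by (simp add: trajectory_last_event_le[OF x assms(4)] trajectory_last_event_le[OF X assms(4)])
qed

lemma trajectory_restrict:
  assumes "traj s \<xi> x" "s \<le> t"
  shows "traj t (x t) x"
  using assms unfolding trajectory_def by auto

text \<open>The value of queue \<open>i\<close> right after the atom at (i, t), by recursion on
  \<open>causal\<close>. Sites that do not interfere with \<open>i\<close> get a dummy 0, so that
  every recursive call goes to a causal predecessor.\<close>

definition event_value :: "real \<Rightarrow> (int ^ 'd \<Rightarrow> nat) \<Rightarrow> (int ^ 'd) \<times> real \<Rightarrow> nat" where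
  "event_value s \<xi> = wfrec (causal a \<alpha> \<delta> s) (\<lambda>X (i, t).
     upd (\<lambda>j. if 0 < a (i - j) then
        if last_event \<alpha> \<delta> s t j = s then \<xi> j else X (j, last_event \<alpha> \<delta> s t j) else 0) t i)"

lemma event_value:
  assumes "s < t" "t \<in> E i"
  shows "event_value s \<xi> (i, t) = upd (\<lambda>j. if last_event \<alpha> \<delta> s t j = s then \<xi> j
     else event_value s \<xi> (j, last_event \<alpha> \<delta> s t j)) t i"
proof -
  have dec: "((j, last_event \<alpha> \<delta> s t j), (i, t)) \<in> causal a \<alpha> \<delta> s"
    if "0 < a (i - j)" "last_event \<alpha> \<delta> s t j \<noteq> s" for j
    using last_event[OF assms(1), of j] that assms unfolding causal_def by auto
  define H where "H = (\<lambda>X (i, t). upd (\<lambda>j. if 0 < a (i - j) then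
      if last_event \<alpha> \<delta> s t j = s then \<xi> j else X (j, last_event \<alpha> \<delta> s t j) else 0) t i)"
  have eq: "event_value s \<xi> = wfrec (causal a \<alpha> \<delta> s) H"
    unfolding event_value_def H_def ..
  have "event_value s \<xi> (i, t) = H (cut (event_value s \<xi>) (causal a \<alpha> \<delta> s) (i, t)) (i, t)"
    by (subst (1 2) eq) (rule wfrec[OF wf_causal])
  also have "\<dots> = upd (\<lambda>j. if last_event \<alpha> \<delta> s t j = s then \<xi> j
     else event_value s \<xi> (j, last_event \<alpha> \<delta> s t j)) t i"
    unfolding H_def prod.case
    by (rule update_cong) (simp add: cut_apply[OF dec])
  finally show ?thesis .
qed

theorem trajectory_exists: "\<exists>x. traj s \<xi> x"
proof -
  let ?l = "last_event_le \<alpha> \<delta> s"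
  \<comment> \<open>Each coordinate keeps the value set at its last atom up to \<open>t\<close>, or
    the initial one if there is none. Times before \<open>s\<close>, on which
    \<open>trajectory\<close> is silent, also get the initial state.\<close>
  define x where "x = (\<lambda>t i. if t \<le> s \<or> ?l t i = s then \<xi> i else event_value s \<xi> (i, ?l t i))"
  have const: "x u i = x w i" if "s \<le> w" "w \<le> u" "E i \<inter> {w<..u} = {}" for u w i
  proof -
    have "?l u i = ?l w i"
      using last_event_le[OF that(1), of i] that by (intro last_event_le_unique) fastforce+
    moreover have "?l s i = s" by (intro last_event_le_unique) auto
    ultimately show ?thesis using that unfolding x_def by (cases "w = s") auto
  qed
  have left: "left_state x t i = x (last_event \<alpha> \<delta> s t i) i"
    and left_lim: "((\<lambda>u. x u i) \<longlongrightarrow> x (last_event \<alpha> \<delta> s t i) i) (at_left t)" if "s < t" for t i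
  proof -
    let ?w = "last_event \<alpha> \<delta> s t i"
    have *: "x u i = x ?w i" if "?w \<le> u" "u < t" for u
      using last_event[OF \<open>s < t\<close>, of i] that by (intro const) force+
    then show "left_state x t i = x ?w i" using last_event(2)[OF \<open>s < t\<close>] by (intro left_state_eq)
    have "\<forall>\<^sub>F u in at_left t. x u i = x ?w i"
      using eventually_at_left_real[OF last_event(2)[OF \<open>s < t\<close>, of i]]
      by eventually_elim (rule *, auto)
    then show "((\<lambda>u. x u i) \<longlongrightarrow> x ?w i) (at_left t)" by (rule tendsto_eventually)
  qed
  have right: "continuous (at_right t) (\<lambda>u. x u i)" if "s \<le> t" for t i
  proof -
    \<comment> \<open>The sentinel \<open>t + 1\<close> keeps the set nonempty; \<open>m\<close> is
      then the next atom after \<open>t\<close>, capped at \<open>t + 1\<close>.\<close>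
    have fin: "finite (insert (t + 1) (E i \<inter> {t<..<t+1}))" (is "finite ?A") using finite_events' by simp
    define m where "m = Min ?A"
    have "m \<in> ?A" unfolding m_def by (rule Min_in[OF fin]) simp
    then have "t < m" by auto
    have "E i \<inter> {t<..<m} = {}"
    proof (rule ccontr)
      assume "E i \<inter> {t<..<m} \<noteq> {}"
      then obtain u where u: "u \<in> E i" "t < u" "u < m" by auto
      moreover have "m \<le> t + 1" unfolding m_def by (rule Min_le[OF fin]) simp
      ultimately have "u \<in> ?A" by auto
      then show False using Min_le[OF fin, of u] u unfolding m_def by simp
    qed
    then have "x u i = x t i" if "t < u" "u < m" for u
      using that \<open>s \<le> t\<close> by (intro const) fastforce+
    then have "\<forall>\<^sub>F u in at_right t. x u i = x t i"
      by (intro eventually_mono[OF eventually_at_right_real[OF \<open>t < m\<close>]]) auto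
    then show ?thesis by (simp add: continuous_within tendsto_eventually)
  qed
  have jump: "x t i = upd (left_state x t) t i" if "s < t" for t i
  proof (cases "t \<in> E i")
    case True
    then have "?l t i = t" using that by (intro last_event_le_unique) auto
    then have "x t i = event_value s \<xi> (i, t)" using that unfolding x_def by simp
    also have "\<dots> = upd (left_state x t) t i"
      unfolding event_value[OF that True]
    proof (rule arg_cong[where f = "\<lambda>y. upd y t i"], rule ext)
      fix j
      let ?w = "last_event \<alpha> \<delta> s t j"
      have "?l ?w j = ?w" using last_event[OF that, of j] by (intro last_event_le_unique) auto
      moreover have "x ?w j = (if ?w \<le> s \<or> ?l ?w j = s then \<xi> j else event_value s \<xi> (j, ?l ?w j))"
        unfolding x_def ..
      ultimately show "(if ?w = s then \<xi> j else event_value s \<xi> (j, ?w)) = left_state x t j"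
        using last_event(1,4)[OF that, of j] left[OF that, of j] by auto
    qed
    finally show ?thesis .
  next
    case False
    have "x t i = x (last_event \<alpha> \<delta> s t i) i"
    proof (rule const)
      show "E i \<inter> {last_event \<alpha> \<delta> s t i<..t} = {}"
        using last_event(3)[OF that, of i] False by (auto simp: order_le_less)
    qed (use last_event[OF that, of i] in auto)
    then show ?thesis using left[OF that] update_no_event[OF False] by simp
  qed
  have "x s = \<xi>" unfolding x_def by auto
  then have "traj s \<xi> x"
    using right left_lim jump unfolding trajectory_def update_def by blast
  then show ?thesis by (intro exI[of _ x])
qed

lemma evolve_eq: "traj s \<xi> x \<Longrightarrow> s \<le> t \<Longrightarrow> evolve a \<alpha> \<delta> s \<xi> t = x t"
  unfolding evolve_def by (rule the_equality) (use trajectory_unique in blast)+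

lemma evolve_mono:
  assumes "\<xi> \<le> \<xi>'" "s \<le> t"
  shows "evolve a \<alpha> \<delta> s \<xi> t \<le> evolve a \<alpha> \<delta> s \<xi>' t"
proof -
  obtain x x' where x: "traj s \<xi> x" "traj s \<xi>' x'" using trajectory_exists by blast
  show ?thesis using trajectory_mono[OF x assms] assms(2)
    by (simp add: evolve_eq[OF x(1)] evolve_eq[OF x(2)] le_fun_def)
qed

lemma evolve_evolve:
  assumes "s \<le> t" "t \<le> u"
  shows "evolve a \<alpha> \<delta> t (evolve a \<alpha> \<delta> s \<xi> t) u = evolve a \<alpha> \<delta> s \<xi> u"
proof -
  obtain x where x: "traj s \<xi> x" using trajectory_exists by blast
  show ?thesis
    using evolve_eq[OF trajectory_restrict[OF x assms(1)] assms(2)] evolve_eq[OF x] assms by simp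
qed

lemma evolve_continuous:
  assumes "\<And>j. \<forall>\<^sub>F n in F. \<Xi> n j = \<xi> j" "s \<le> t"
  shows "\<forall>\<^sub>F n in F. evolve a \<alpha> \<delta> s (\<Xi> n) t i = evolve a \<alpha> \<delta> s \<xi> t i"
proof -
  obtain x where x: "traj s \<xi> x" using trajectory_exists by blast
  have "\<forall>n. \<exists>x. traj s (\<Xi> n) x" using trajectory_exists by blast
  then obtain X where X: "\<And>n. traj s (\<Xi> n) (X n)" unfolding choice_iff by blast
  show ?thesis
    using trajectory_continuous[OF x X assms] assms(2) by (simp add: evolve_eq[OF x] evolve_eq[OF X])
qed

end

section \<open>Time discretisation\<close>

text \<open>Left-open cells partition the time after \<open>s\<close> and, like
  \<open>trajectory\<close>, ignore atoms at \<open>s\<close> itself.\<close>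

definition cell :: "real \<Rightarrow> real \<Rightarrow> nat \<Rightarrow> real set" where
  "cell s h k = {s + real k * h<..s + real (Suc k) * h}"

text \<open>
  All departures of a cell are decided by the state at its beginning.  For a fine mesh this is the
  dynamics itself, and it only involves the numbers of atoms in rectangles.
\<close>
primrec euler ::
  "(int ^ 'd \<Rightarrow> real) \<Rightarrow> (int ^ 'd \<Rightarrow> real set) \<Rightarrow> (int ^ 'd \<Rightarrow> (real \<times> real) set) \<Rightarrow>
   real \<Rightarrow> real \<Rightarrow> (int ^ 'd \<Rightarrow> nat) \<Rightarrow> nat \<Rightarrow> int ^ 'd \<Rightarrow> nat" where
  "euler a \<alpha> \<delta> s h \<xi> 0 = \<xi>"
| "euler a \<alpha> \<delta> s h \<xi> (Suc k) = (\<lambda>i. euler a \<alpha> \<delta> s h \<xi> k i + card (\<alpha> i \<inter> cell s h k)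
     - (if 0 < euler a \<alpha> \<delta> s h \<xi> k i \<and>
           (\<exists>t U. (t, U) \<in> \<delta> i \<and> t \<in> cell s h k \<and> U \<le> departure_rate a (euler a \<alpha> \<delta> s h \<xi> k) i)
        then 1 else 0))"

declare euler.simps(2) [simp del]

lemma euler_step_single:
  assumes "u \<in> cell s h k" "event_times \<alpha> \<delta> i \<inter> cell s h k \<subseteq> {u}"
  shows "euler a \<alpha> \<delta> s h \<xi> (Suc k) i = update a \<alpha> \<delta> (euler a \<alpha> \<delta> s h \<xi> k) u i"
proof -
  have "\<alpha> i \<inter> cell s h k = (if u \<in> \<alpha> i then {u} else {})"
    using assms unfolding event_times_def by auto
  moreover have "t = u" if "(t, U) \<in> \<delta> i" "t \<in> cell s h k" for t U
    using assms(2) that rev_image_eqI[OF that(1), of t fst] unfolding event_times_def by auto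
  then have "(\<exists>t U. (t, U) \<in> \<delta> i \<and> t \<in> cell s h k \<and> P U) \<longleftrightarrow> (\<exists>U. (u, U) \<in> \<delta> i \<and> P U)" for P
    using assms(1) by blast
  ultimately show ?thesis unfolding euler.simps update_def by simp
qed

lemma euler_step_none:
  assumes "event_times \<alpha> \<delta> i \<inter> cell s h k = {}"
  shows "euler a \<alpha> \<delta> s h \<xi> (Suc k) i = euler a \<alpha> \<delta> s h \<xi> k i"
proof -
  have "\<alpha> i \<inter> cell s h k = {}" using assms unfolding event_times_def by auto
  moreover have "\<not> (\<exists>t U. (t, U) \<in> \<delta> i \<and> t \<in> cell s h k \<and> U \<le> r)" for r
    using assms rev_image_eqI[of _ "\<delta> i" _ fst] unfolding event_times_def by force
  ultimately show ?thesis unfolding euler.simps by (simp only:) simp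
qed

lemma euler_const:
  assumes "k \<le> k'" "0 \<le> h" "event_times \<alpha> \<delta> i \<inter> {s + real k * h<..s + real k' * h} = {}"
  shows "euler a \<alpha> \<delta> s h \<xi> k' i = euler a \<alpha> \<delta> s h \<xi> k i"
  using assms(1,3)
proof (induction k' rule: dec_induct)
  case (step n)
  have "real k * h \<le> real n * h" "real n * h \<le> real (Suc n) * h"
    using step(1) assms(2) by (auto intro!: mult_right_mono)
  then have "cell s h n \<subseteq> {s + real k * h<..s + real (Suc n) * h}"
    "{s + real k * h<..s + real n * h} \<subseteq> {s + real k * h<..s + real (Suc n) * h}"
    unfolding cell_def by auto
  then have "event_times \<alpha> \<delta> i \<inter> cell s h n = {}"
    "event_times \<alpha> \<delta> i \<inter> {s + real k * h<..s + real n * h} = {}"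
    using step.prems by blast+
  then show ?case using step.IH euler_step_none by metis
qed simp

lemma euler_cong:
  assumes "0 \<le> h"
    and "\<And>i. \<alpha> i \<inter> {s<..s + real n * h} = \<alpha>' i \<inter> {s<..s + real n * h}"
    and "\<And>i. \<delta> i \<inter> {s<..s + real n * h} \<times> UNIV = \<delta>' i \<inter> {s<..s + real n * h} \<times> UNIV"
  shows "euler a \<alpha> \<delta> s h \<xi> n = euler a \<alpha>' \<delta>' s h \<xi> n"
  using assms(2,3)
proof (induction n)
  case (Suc n)
  have "0 \<le> real n * h" "real n * h \<le> real (Suc n) * h" using assms(1) by (auto intro: mult_right_mono)
  then have sub: "cell s h n \<subseteq> {s<..s + real (Suc n) * h}" "{s<..s + real n * h} \<subseteq> {s<..s + real (Suc n) * h}"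
    unfolding cell_def by auto
  have "euler a \<alpha> \<delta> s h \<xi> n = euler a \<alpha>' \<delta>' s h \<xi> n"
    by (rule Suc.IH; use sub(2) Suc.prems in blast)
  moreover have "\<alpha> i \<inter> cell s h n = \<alpha>' i \<inter> cell s h n" for i
    using sub(1) Suc.prems(1)[of i] by blast
  moreover have "(\<exists>t U. (t, U) \<in> \<delta> i \<and> t \<in> cell s h n \<and> P U) \<longleftrightarrow> (\<exists>t U. (t, U) \<in> \<delta>' i \<and> t \<in> cell s h n \<and> P U)" for i P
    using sub(1) Suc.prems(2)[of i] by blast
  ultimately show ?case unfolding euler.simps by simp
qed simp

lemma euler_time_shift:
  "euler a (\<lambda>i. {t. t + v \<in> \<alpha> i}) (\<lambda>i. {(t, U). (t + v, U) \<in> \<delta> i}) s h \<xi> n = euler a \<alpha> \<delta> (s + v) h \<xi> n"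
proof (induction n)
  case (Suc n)
  have shift: "t \<in> cell s h n \<longleftrightarrow> t + v \<in> cell (s + v) h n" for t unfolding cell_def by auto
  have "card ({t. t + v \<in> \<alpha> i} \<inter> cell s h n) = card (\<alpha> i \<inter> cell (s + v) h n)" for i
    by (rule bij_betw_same_card[of "\<lambda>t. t + v"], rule bij_betw_byWitness[where f' = "\<lambda>t. t - v"])
      (auto simp: shift)
  moreover have "(\<exists>t U. (t, U) \<in> {(t, U). (t + v, U) \<in> \<delta> i} \<and> t \<in> cell s h n \<and> P U) \<longleftrightarrow>
      (\<exists>t U. (t, U) \<in> \<delta> i \<and> t \<in> cell (s + v) h n \<and> P U)" for i P
  proof
    assume "\<exists>t U. (t, U) \<in> \<delta> i \<and> t \<in> cell (s + v) h n \<and> P U"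
    then obtain t U where "(t, U) \<in> \<delta> i" "t \<in> cell (s + v) h n" "P U" by blast
    then show "\<exists>t U. (t, U) \<in> {(t, U). (t + v, U) \<in> \<delta> i} \<and> t \<in> cell s h n \<and> P U"
      unfolding shift by (intro exI[of _ "t - v"] exI[of _ U]) simp
  qed (use shift in blast)
  ultimately show ?case unfolding euler.simps Suc.IH by simp
qed simp

lemma departure_rate_space_shift:
  "departure_rate a (\<lambda>i. y (i - z)) i = departure_rate a y (i - z)"
  unfolding departure_rate_def by (simp add: algebra_simps)

lemma euler_space_shift:
  "euler a (\<lambda>i. \<alpha> (i - z)) (\<lambda>i. \<delta> (i - z)) s h (\<lambda>i. \<xi> (i - z)) n = (\<lambda>i. euler a \<alpha> \<delta> s h \<xi> n (i - z))"
  by (induction n) (simp_all add: euler.simps departure_rate_space_shift)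

lemma euler_upper:
  assumes "0 \<le> h" "\<And>n. finite (\<alpha> i \<inter> {s<..s + real n * h})"
  shows "euler a \<alpha> \<delta> s h \<xi> n i \<le> \<xi> i + card (\<alpha> i \<inter> {s<..s + real n * h})"
proof (induction n)
  case (Suc n)
  have "0 \<le> real n * h" "real n * h \<le> real (Suc n) * h" using assms(1) by (auto intro: mult_right_mono)
  then have split: "{s<..s + real (Suc n) * h} = {s<..s + real n * h} \<union> cell s h n"
    "{s<..s + real n * h} \<inter> cell s h n = {}" unfolding cell_def by auto
  have "card (\<alpha> i \<inter> {s<..s + real (Suc n) * h}) = card (\<alpha> i \<inter> {s<..s + real n * h}) + card (\<alpha> i \<inter> cell s h n)"
    unfolding split(1) Int_Un_distrib
    by (rule card_Un_disjoint) (use assms(2)[of n] assms(2)[of "Suc n"] split in \<open>auto simp: Int_Un_distrib\<close>)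
  then show ?case using Suc.IH unfolding euler.simps by simp
qed simp

text \<open>A cell removes at most one customer, and only when it contains a service time.\<close>

lemma euler_lower:
  assumes "0 \<le> h" "\<And>n. finite (fst ` \<delta> i \<inter> {s<..s + real n * h})"
  shows "\<xi> i \<le> euler a \<alpha> \<delta> s h \<xi> n i + card (fst ` \<delta> i \<inter> {s<..s + real n * h})"
proof (induction n)
  case (Suc n)
  have "0 \<le> real n * h" "real n * h \<le> real (Suc n) * h" using assms(1) by (auto intro: mult_right_mono)
  then have split: "{s<..s + real (Suc n) * h} = {s<..s + real n * h} \<union> cell s h n"
    "{s<..s + real n * h} \<inter> cell s h n = {}" unfolding cell_def by auto
  have fin: "finite (fst ` \<delta> i \<inter> cell s h n)"
    using assms(2)[of "Suc n"] unfolding split(1) by (simp add: Int_Un_distrib)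
  have "card (fst ` \<delta> i \<inter> {s<..s + real (Suc n) * h}) =
      card (fst ` \<delta> i \<inter> {s<..s + real n * h}) + card (fst ` \<delta> i \<inter> cell s h n)"
    unfolding split(1) Int_Un_distrib
    by (rule card_Un_disjoint) (use assms(2)[of n] fin split in auto)
  moreover have "(\<exists>t U. (t, U) \<in> \<delta> i \<and> t \<in> cell s h n \<and> P U) \<Longrightarrow> 1 \<le> card (fst ` \<delta> i \<inter> cell s h n)" for P
  proof -
    assume "\<exists>t U. (t, U) \<in> \<delta> i \<and> t \<in> cell s h n \<and> P U"
    then have "fst ` \<delta> i \<inter> cell s h n \<noteq> {}" by force
    then show ?thesis using fin by (simp add: Suc_le_eq card_gt_0_iff)
  qed
  then have "(if 0 < euler a \<alpha> \<delta> s h \<xi> n i \<and>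
           (\<exists>t U. (t, U) \<in> \<delta> i \<and> t \<in> cell s h n \<and> U \<le> departure_rate a (euler a \<alpha> \<delta> s h \<xi> n) i)
        then 1 else 0) \<le> card (fst ` \<delta> i \<inter> cell s h n)" by auto
  ultimately show ?case using Suc.IH unfolding euler.simps by linarith
qed simp

section \<open>Convergence of the discretisation to the dynamics\<close>

context driven
begin

lemma isolated_event: "\<exists>\<epsilon>>0. E i \<inter> {u - \<epsilon><..<u + \<epsilon>} \<subseteq> {u}"
proof -
  obtain d where d: "0 < d" "\<And>v. v \<in> E i \<inter> {u - 1..u + 1} \<Longrightarrow> v \<noteq> u \<Longrightarrow> d \<le> dist u v"
    using finite_set_avoid[OF finite_events[of i "u - 1" "u + 1"], of u] by blast
  have "E i \<inter> {u - min d 1<..<u + min d 1} \<subseteq> {u}"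
  proof
    fix v assume v: "v \<in> E i \<inter> {u - min d 1<..<u + min d 1}"
    then have "v \<in> E i \<inter> {u - 1..u + 1}" "dist u v < d" by (auto simp: dist_real_def)
    then show "v \<in> {u}" using d(2)[of v] by force
  qed
  then show ?thesis using d(1) by (intro exI[of _ "min d 1"]) auto
qed

text \<open>Induction along chains of influence: for an atom at (i, u), the Euler value at the end
  of the cell containing \<open>u\<close> is eventually right. It suffices that the mesh is finer
  than the gap around \<open>u\<close> among the atoms at \<open>i\<close> and finer than the
  distance from \<open>u\<close> to the last earlier atoms of its neighbours. There are finitely
  many neighbours, so one threshold serves them all, though no threshold is uniform in
  space.\<close>

theorem euler_converges:
  assumes x: "traj s \<xi> x" and "s < t"
  shows "\<forall>\<^sub>F m in sequentially. euler a \<alpha> \<delta> s ((t - s) / real m) \<xi> m i = x t i"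
proof -
  define h where "h = (\<lambda>m. (t - s) / real m)"
  \<comment> \<open>The number of cells needed to cover \<open>u\<close>: for u > s, the atom lies
    in the cell of index \<open>k m u - 1\<close>, and at the start the number is 0.\<close>
  define k where "k = (\<lambda>m u. nat \<lceil>(u - s) / h m\<rceil>)"
  let ?eu = "\<lambda>m. euler a \<alpha> \<delta> s (h m) \<xi>"
  have h_pos: "0 < h m" if "0 < m" for m using that \<open>s < t\<close> unfolding h_def by simp
  have "h \<longlonglongrightarrow> 0" unfolding h_def by (rule lim_const_over_n)
  then have h_small: "\<forall>\<^sub>F m in sequentially. h m < \<epsilon>" if "0 < \<epsilon>" for \<epsilon>
    using that by (rule order_tendstoD(2))
  have k_le: "u \<le> s + real (k m u) * h m" and k_gt: "s < u \<Longrightarrow> s + (real (k m u) - 1) * h m < u"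
    if "0 < m" "s \<le> u" for m u
  proof -
    have "0 \<le> (u - s) / h m" using h_pos[OF that(1)] that(2) by simp
    then have k: "real (k m u) = real_of_int \<lceil>(u - s) / h m\<rceil>" unfolding k_def
      by (simp add: of_nat_nat)
    have "(u - s) / h m \<le> real (k m u)" "real (k m u) - 1 < (u - s) / h m"
      unfolding k using ceiling_correct[of "(u - s) / h m"] by linarith+
    then show "u \<le> s + real (k m u) * h m" "s + (real (k m u) - 1) * h m < u"
      using h_pos[OF that(1)] by (auto simp: field_simps)
  qed
  have k_start: "k m s = 0" for m unfolding k_def by simp
  have claim: "\<forall>\<^sub>F m in sequentially. ?eu m (k m u) i = x u i" if "u = s \<or> s < u \<and> u \<in> E i" for u i
    using that
  proof (induction rule: event_induct)
    case (start j)
    then show ?case by (simp add: k_start trajectory_start[OF x])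
  next
    case (event i u)
    let ?w = "last_event \<alpha> \<delta> s u"
    obtain \<epsilon> where \<epsilon>: "0 < \<epsilon>" "E i \<inter> {u - \<epsilon><..<u + \<epsilon>} \<subseteq> {u}" using isolated_event by blast
    have "\<forall>\<^sub>F m in sequentially. \<forall>j\<in>{j. 0 < a (i - j)}.
        ?eu m (k m (?w j)) j = x (?w j) j \<and> h m < u - ?w j"
      by (rule eventually_ball_finite[OF finite_neighbours], intro ballI eventually_conj h_small)
        (use event last_event(2)[OF event(1)] in auto)
    with h_small[OF \<epsilon>(1)] eventually_gt_at_top[of 0] show ?case
    proof eventually_elim
      case (elim m)
      note m = \<open>0 < m\<close> and hm = h_pos[OF \<open>0 < m\<close>]
      have "0 < real (k m u) * h m" using k_le[OF m, of u] event(1) by simp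
      then have "0 < k m u" using hm by (cases "k m u") auto
      then obtain K where K: "k m u = Suc K" by (cases "k m u") auto
      have u: "u \<in> cell s (h m) K" "s + real K * h m < u"
        using k_le[OF m, of u] k_gt[OF m, of u] event(1) unfolding K cell_def by auto
      have "E i \<inter> cell s (h m) K \<subseteq> {u}"
        using \<epsilon>(2) \<open>h m < \<epsilon>\<close> u unfolding cell_def by (force simp: algebra_simps)
      then have "?eu m (k m u) i = upd (?eu m K) u i"
        unfolding K by (rule euler_step_single[OF u(1)])
      also have "\<dots> = upd (left_state x u) u i"
      proof (rule update_cong)
        fix j assume j: "0 < a (i - j)"
        note w = last_event[OF event(1), of j]
        have wj: "?eu m (k m (?w j)) j = x (?w j) j" "h m < u - ?w j" using elim j by auto
        \<comment> \<open>Since the mesh is smaller than \<open>u - ?w j\<close>, the cell of the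
          neighbour's last atom ends no later than the cell of \<open>u\<close> begins. So its
          correct value is in place when the update at \<open>u\<close> is decided.\<close>
        have "k m (?w j) \<le> K"
        proof (cases "?w j = s")
          case False
          then have "s + (real (k m (?w j)) - 1) * h m < ?w j" using w k_gt[OF m, of "?w j"] by simp
          also have "\<dots> < u - h m" using wj by simp
          also have "\<dots> \<le> s + real K * h m" using u(1) unfolding cell_def by (simp add: algebra_simps)
          finally have "(real (k m (?w j)) - 1) * h m < real K * h m" by simp
          then show ?thesis using hm by simp
        qed (simp add: k_start)
        moreover have "E j \<inter> {s + real (k m (?w j)) * h m<..s + real K * h m} = {}"
          using w k_le[OF m, of "?w j"] u(2) by force
        ultimately have "?eu m K j = ?eu m (k m (?w j)) j" using hm by (intro euler_const) auto
        then show "?eu m K j = left_state x u j"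
          using wj trajectory_last_event[OF x event(1), of j] by simp
      qed
      also have "\<dots> = x u i" using trajectory_jump[OF x event(1)] by simp
      finally show ?case .
    qed
  qed
  let ?w = "last_event_le \<alpha> \<delta> s t i"
  note w = last_event_le[OF less_imp_le[OF \<open>s < t\<close>], of i]
  have "\<forall>\<^sub>F m in sequentially. ?eu m (k m ?w) i = x ?w i" by (rule claim[OF w(4)])
  with eventually_gt_at_top[of 0] show ?thesis
  proof eventually_elim
    case (elim m)
    note hm = h_pos[OF \<open>0 < m\<close>]
    have end_t: "s + real m * h m = t" using \<open>0 < m\<close> unfolding h_def by simp
    have "k m ?w \<le> m"
    proof (cases "?w = s")
      case False
      then have "s + (real (k m ?w) - 1) * h m < s + real m * h m"
        using w k_gt[OF \<open>0 < m\<close>, of ?w] end_t by simp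
      then have "real (k m ?w) - 1 < real m" using hm by simp
      then show ?thesis by linarith
    qed (simp add: k_start)
    moreover have "E i \<inter> {s + real (k m ?w) * h m<..s + real m * h m} = {}"
      unfolding end_t using w k_le[OF \<open>0 < m\<close>, of ?w] by force
    ultimately have "?eu m m i = ?eu m (k m ?w) i" using hm by (intro euler_const) auto
    then show ?case using elim(2) trajectory_last_event_le[OF x, of t i] \<open>s < t\<close> unfolding h_def by simp
  qed
qed

lemma evolve_start: "evolve a \<alpha> \<delta> s \<xi> s = \<xi>"
  using trajectory_exists evolve_eq trajectory_start by (metis order_refl)

lemma evolve_euler:
  assumes "s < t"
  shows "\<forall>\<^sub>F m in sequentially. euler a \<alpha> \<delta> s ((t - s) / real m) \<xi> m i = evolve a \<alpha> \<delta> s \<xi> t i"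
proof -
  obtain x where x: "traj s \<xi> x" using trajectory_exists by blast
  show ?thesis using euler_converges[OF x assms] assms by (simp add: evolve_eq[OF x])
qed

lemma evolve_upper:
  assumes "s < t"
  shows "evolve a \<alpha> \<delta> s \<xi> t i \<le> \<xi> i + card (\<alpha> i \<inter> {s<..t})"
proof -
  have fin: "finite (\<alpha> i \<inter> {s<..u})" for u
    by (rule finite_subset[OF _ finite_events'(2)[of i s u]]) (auto simp: event_times_def)
  have "\<forall>\<^sub>F m in sequentially. evolve a \<alpha> \<delta> s \<xi> t i \<le> \<xi> i + card (\<alpha> i \<inter> {s<..t})"
    using evolve_euler[OF assms, of \<xi> i] eventually_gt_at_top[of 0]
  proof eventually_elim
    case (elim m)
    have "s + real m * ((t - s) / real m) = t" using elim(2) by simp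
    then show ?case
      using euler_upper[of "(t - s) / real m" \<alpha> i s a \<delta> \<xi> m] fin elim assms by simp
  qed
  then show ?thesis by simp
qed

lemma evolve_lower:
  assumes "s < t"
  shows "\<xi> i \<le> evolve a \<alpha> \<delta> s \<xi> t i + card (fst ` \<delta> i \<inter> {s<..t})"
proof -
  have fin: "finite (fst ` \<delta> i \<inter> {s<..u})" for u
    by (rule finite_subset[OF _ finite_events'(2)[of i s u]]) (auto simp: event_times_def)
  have "\<forall>\<^sub>F m in sequentially. \<xi> i \<le> evolve a \<alpha> \<delta> s \<xi> t i + card (fst ` \<delta> i \<inter> {s<..t})"
    using evolve_euler[OF assms, of \<xi> i] eventually_gt_at_top[of 0]
  proof eventually_elim
    case (elim m)
    have "s + real m * ((t - s) / real m) = t" using elim(2) by simp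
    then show ?case
      using euler_lower[of "(t - s) / real m" \<delta> i s \<xi> a \<alpha> m] fin elim assms by simp
  qed
  then show ?thesis by simp
qed

text \<open>The basis of the short-time expansion: if all atoms at \<open>i\<close> and its
  neighbours share one time, the update at \<open>i\<close> is decided by the initial state.\<close>

lemma evolve_single_event:
  assumes "s < u" "u \<le> t" and none: "\<And>j. 0 < a (i - j) \<Longrightarrow> E j \<inter> {s<..t} \<subseteq> {u}"
  shows "evolve a \<alpha> \<delta> s \<xi> t i = upd \<xi> u i"
proof -
  obtain x where x: "traj s \<xi> x" using trajectory_exists by blast
  have "x t i = x u i"
    using none[of i] a_zero assms(1,2) by (intro trajectory_const[OF x]) fastforce+
  also have "\<dots> = upd (left_state x u) u i" by (rule trajectory_jump[OF x assms(1)])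
  also have "\<dots> = upd \<xi> u i"
  proof (rule update_cong)
    fix j assume "0 < a (i - j)"
    then have "left_state x u j = x s j"
      using none[of j] assms(1,2) by (intro trajectory_left_state[OF x]) fastforce+
    then show "left_state x u j = \<xi> j" using trajectory_start[OF x] by simp
  qed
  finally show ?thesis using assms(1,2) by (simp add: evolve_eq[OF x])
qed

end

text \<open>Equality of all Euler approximations passes to the limit. This reduces locality and
  symmetry of the infinite dynamics to finite inductions on the number of cells.\<close>

lemma evolve_eqI:
  assumes "driven a \<alpha> \<delta>" "driven a \<alpha>' \<delta>'" "s < t" "t - s = t' - s'"
    and eq: "\<And>m. 0 < m \<Longrightarrow> euler a \<alpha> \<delta> s ((t - s) / real m) \<xi> m i = euler a \<alpha>' \<delta>' s' ((t - s) / real m) \<xi>' m i'"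
  shows "evolve a \<alpha> \<delta> s \<xi> t i = evolve a \<alpha>' \<delta>' s' \<xi>' t' i'"
proof -
  have "s' < t'" using assms(3,4) by simp
  from driven.evolve_euler[OF assms(2) this, of \<xi>' i']
  have limit: "\<forall>\<^sub>F m in sequentially. euler a \<alpha>' \<delta>' s' ((t - s) / real m) \<xi>' m i' = evolve a \<alpha>' \<delta>' s' \<xi>' t' i'"
    using assms(4) by simp
  have "\<forall>\<^sub>F m in sequentially. evolve a \<alpha> \<delta> s \<xi> t i = evolve a \<alpha>' \<delta>' s' \<xi>' t' i'"
    using driven.evolve_euler[OF assms(1,3), of \<xi> i] eventually_gt_at_top[of 0] limit
    by eventually_elim (use eq in simp)
  then show ?thesis by simp
qed

section \<open>Locality in time and covariance under shifts\<close>

lemma evolve_cong_driving: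
  assumes dr: "driven a \<alpha> \<delta>" "driven a \<alpha>' \<delta>'" and "s \<le> t"
    and "\<And>i. \<alpha> i \<inter> {s<..t} = \<alpha>' i \<inter> {s<..t}"
    and "\<And>i. \<delta> i \<inter> {s<..t} \<times> UNIV = \<delta>' i \<inter> {s<..t} \<times> UNIV"
  shows "evolve a \<alpha> \<delta> s \<xi> t = evolve a \<alpha>' \<delta>' s \<xi> t"
proof (cases "s = t")
  case True
  then show ?thesis using driven.evolve_start[OF dr(1)] driven.evolve_start[OF dr(2)] by simp
next
  case False
  show ?thesis
  proof (rule ext, rule evolve_eqI[OF dr])
    fix i and m :: nat assume "0 < m"
    then have "s + real m * ((t - s) / real m) = t" by simp
    then show "euler a \<alpha> \<delta> s ((t - s) / real m) \<xi> m i = euler a \<alpha>' \<delta>' s ((t - s) / real m) \<xi> m i"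
      using assms(3-5) by (subst euler_cong[of _ \<alpha> s m \<alpha>' \<delta> \<delta>']) auto
  qed (use assms(3) False in auto)
qed

lemma evolve_time_shift:
  assumes dr: "driven a \<alpha> \<delta>" "driven a (\<lambda>i. {t. t + v \<in> \<alpha> i}) (\<lambda>i. {(t, U). (t + v, U) \<in> \<delta> i})" and "s \<le> t"
  shows "evolve a (\<lambda>i. {t. t + v \<in> \<alpha> i}) (\<lambda>i. {(t, U). (t + v, U) \<in> \<delta> i}) s \<xi> t = evolve a \<alpha> \<delta> (s + v) \<xi> (t + v)"
proof (cases "s = t")
  case True
  then show ?thesis using driven.evolve_start[OF dr(1)] driven.evolve_start[OF dr(2)] by simp
next
  case False
  show ?thesis
    by (rule ext, rule evolve_eqI[OF dr(2,1)]) (use assms(3) False in \<open>auto simp: euler_time_shift\<close>)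
qed

lemma evolve_space_shift:
  assumes dr: "driven a \<alpha> \<delta>" "driven a (\<lambda>i. \<alpha> (i - z)) (\<lambda>i. \<delta> (i - z))" and "s \<le> t"
  shows "evolve a (\<lambda>i. \<alpha> (i - z)) (\<lambda>i. \<delta> (i - z)) s (\<lambda>i. \<xi> (i - z)) t = (\<lambda>i. evolve a \<alpha> \<delta> s \<xi> t (i - z))"
proof (cases "s = t")
  case True
  then show ?thesis using driven.evolve_start[OF dr(1)] driven.evolve_start[OF dr(2)] by simp
next
  case False
  show ?thesis
    by (rule ext, rule evolve_eqI[OF dr(2,1)]) (use assms(3) False in \<open>auto simp: euler_space_shift\<close>)
qed

section \<open>Point patterns and their laws\<close>

text \<open>A window sees a single process. Local finiteness can then be asked process by process,
  while infinitely many processes together have infinitely many atoms in a time interval.\<close>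

definition windows :: "('i \<times> real \<times> real) set set" where
  "windows = {{p} \<times> B | p B. B \<in> sets borel \<and> bounded B}"

text \<open>
  The windows on one side of time \<open>0\<close> still determine the law of a pattern, and only those are
  compatible with replacing the future of a pattern by that of another one.
\<close>
definition half_windows :: "('i \<times> real \<times> real) set set" where
  "half_windows = {V \<in> windows. (\<forall>(p, t, U)\<in>V. t \<le> 0) \<or> (\<forall>(p, t, U)\<in>V. 0 < t)}"

definition pattern_space :: "real \<Rightarrow> ('i \<times> real \<times> real) set set" where
  "pattern_space b = {g. (\<forall>(p, t, U)\<in>g. 0 \<le> U \<and> U \<le> b) \<and> (\<forall>V\<in>windows. finite (g \<inter> V))}"

text \<open>The usual measurable structure on point configurations, generated by the counting
  maps.\<close>

definition patterns :: "real \<Rightarrow> ('i \<times> real \<times> real) set measure" where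
  "patterns b = sigma (pattern_space b) {{g \<in> pattern_space b. card (g \<inter> V) = k} | V k. V \<in> windows}"

lemma windowsI: "B \<in> sets borel \<Longrightarrow> bounded B \<Longrightarrow> {p} \<times> B \<in> windows"
  unfolding windows_def by blast

lemma windowsE:
  assumes "V \<in> windows"
  obtains p B where "V = {p} \<times> B" "B \<in> sets borel" "bounded B"
  using assms unfolding windows_def by blast

lemma windows_Int_Diff:
  assumes "V \<in> windows" "W \<in> windows"
  shows "V \<inter> W \<in> windows" "V - W \<in> windows"
proof -
  obtain p B q C where V: "V = {p} \<times> B" "B \<in> sets borel" "bounded B"
    and W: "W = {q} \<times> C" "C \<in> sets borel" "bounded C" using assms by (elim windowsE)
  have bd: "bounded (B \<inter> C)" "bounded (B - C)" using V(3) by (auto intro: bounded_subset)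
  show "V \<inter> W \<in> windows" "V - W \<in> windows"
  proof (cases "p = q", goal_cases)
    case 1
    then have "V \<inter> W = {p} \<times> (B \<inter> C)" unfolding V(1) W(1) by auto
    then show ?case using windowsI[of "B \<inter> C" p] V W bd by simp
  next
    case 2
    then have "V \<inter> W = {}" unfolding V(1) W(1) by auto
    then show ?case using windowsI[of "{}"] by simp
  next
    case 3
    show ?case
    proof (cases "p = q")
      case True
      then have "V - W = {p} \<times> (B - C)" unfolding V(1) W(1) by auto
      then show ?thesis using windowsI[of "B - C" p] V W bd by simp
    next
      case False
      then have "V - W = V" unfolding V(1) W(1) by auto
      then show ?thesis using assms by simp
    qed
  qed
qed

lemma half_windows_Int_Diff:
  assumes "V \<in> half_windows" "W \<in> half_windows"
  shows "V \<inter> W \<in> half_windows" "V - W \<in> half_windows"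
  using assms windows_Int_Diff[of V W] unfolding half_windows_def by auto

lemma half_windows_INT:
  assumes "finite \<F>" "\<F> \<noteq> {}" "\<F> \<subseteq> half_windows"
  shows "\<Inter>\<F> \<in> half_windows"
  using assms by (induction \<F> rule: finite_ne_induct) (auto intro: half_windows_Int_Diff)

lemma half_windows_Diff_UN:
  assumes "finite \<F>" "V \<in> half_windows" "\<F> \<subseteq> half_windows"
  shows "V - \<Union>\<F> \<in> half_windows"
  using assms
proof (induction \<F> rule: finite_induct)
  case (insert W \<F>)
  have "V - \<Union>(insert W \<F>) = (V - \<Union>\<F>) - W" by auto
  then show ?case using insert half_windows_Int_Diff(2)[of "V - \<Union>\<F>" W] by auto
qed simp

lemma window_halves:
  assumes "V \<in> windows"
  shows "V \<inter> {(p, t, U). t \<le> 0} \<in> half_windows" "V \<inter> {(p, t, U). 0 < t} \<in> half_windows"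
proof -
  obtain p B where V: "V = {p} \<times> B" "B \<in> sets borel" "bounded B" using assms by (elim windowsE)
  have eq: "V \<inter> {(p, t, U). t \<le> 0} = {p} \<times> (B \<inter> {..0} \<times> UNIV)"
    "V \<inter> {(p, t, U). 0 < t} = {p} \<times> (B \<inter> {0<..} \<times> UNIV)" unfolding V(1) by auto
  have "{..0::real} \<times> (UNIV::real set) \<in> sets borel" "{0::real<..} \<times> (UNIV::real set) \<in> sets borel"
    by (auto intro!: borel_Times)
  then have "V \<inter> {(p, t, U). t \<le> 0} \<in> windows" "V \<inter> {(p, t, U). 0 < t} \<in> windows"
    unfolding eq using V by (auto intro!: windowsI intro: bounded_subset)
  then show "V \<inter> {(p, t, U). t \<le> 0} \<in> half_windows" "V \<inter> {(p, t, U). 0 < t} \<in> half_windows"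
    unfolding half_windows_def by auto
qed

lemma half_windows_subset: "half_windows \<subseteq> windows"
  unfolding half_windows_def by auto

lemma space_patterns [simp]: "space (patterns b) = pattern_space b"
  unfolding patterns_def by (rule space_measure_of) auto

lemma sets_patterns: "sets (patterns b) =
    sigma_sets (pattern_space b) {{g \<in> pattern_space b. card (g \<inter> V) = k} | V k. V \<in> windows}"
  unfolding patterns_def by (rule sets_measure_of) auto

lemma finite_pattern: "g \<in> pattern_space b \<Longrightarrow> V \<in> windows \<Longrightarrow> finite (g \<inter> V)"
  unfolding pattern_space_def by blast

lemma count_eq_sets: "V \<in> windows \<Longrightarrow> {g \<in> pattern_space b. card (g \<inter> V) = k} \<in> sets (patterns b)"
  unfolding sets_patterns by blast

lemma measurable_count:
  assumes "V \<in> windows"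
  shows "(\<lambda>g. card (g \<inter> V)) \<in> patterns b \<rightarrow>\<^sub>M count_space UNIV"
proof (subst measurable_count_space_eq2_countable, intro conjI ballI)
  fix k :: nat
  have "(\<lambda>g. card (g \<inter> V)) -` {k} \<inter> space (patterns b) = {g \<in> pattern_space b. card (g \<inter> V) = k}" by auto
  then show "(\<lambda>g. card (g \<inter> V)) -` {k} \<inter> space (patterns b) \<in> sets (patterns b)"
    using count_eq_sets[OF assms] by simp
qed auto

lemma measurable_patternsI:
  fixes f :: "'a \<Rightarrow> ('i \<times> real \<times> real) set"
  assumes "\<And>x. x \<in> space M \<Longrightarrow> f x \<in> pattern_space b"
    and "\<And>V. V \<in> windows \<Longrightarrow> (\<lambda>x. card (f x \<inter> V)) \<in> M \<rightarrow>\<^sub>M count_space UNIV"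
  shows "f \<in> M \<rightarrow>\<^sub>M patterns b"
  unfolding patterns_def
proof (rule measurable_measure_of)
  fix A :: "('i \<times> real \<times> real) set set"
  assume "A \<in> {{g \<in> pattern_space b. card (g \<inter> V) = k} | V k. V \<in> windows}"
  then obtain V k where V: "V \<in> windows" and A: "A = {g \<in> pattern_space b. card (g \<inter> V) = k}" by blast
  have "f -` A \<inter> space M = (\<lambda>x. card (f x \<inter> V)) -` {k} \<inter> space M" unfolding A using assms(1) by auto
  then show "f -` A \<inter> space M \<in> sets M" using measurable_sets[OF assms(2)[OF V], of "{k}"] by simp
qed (use assms(1) in auto)

lemma count_family_sets:
  assumes Y: "Y \<in> M \<rightarrow>\<^sub>M patterns b" and "\<And>k. k < (n::nat) \<Longrightarrow> V k \<in> windows"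
  shows "{\<omega> \<in> space M. \<forall>k<n. card (Y \<omega> \<inter> V k) = c k} \<in> sets M"
proof -
  have "{\<omega> \<in> space M. \<forall>k\<in>{..<n}. card (Y \<omega> \<inter> V k) = c k} \<in> sets M"
  proof (rule sets.sets_Collect_finite_All)
    fix k assume "k \<in> {..<n}"
    then have "V k \<in> windows" using assms(2) by simp
    from measurable_sets[OF measurable_compose[OF Y measurable_count[OF this]], of "{c k}"]
    have "(\<lambda>\<omega>. card (Y \<omega> \<inter> V k)) -` {c k} \<inter> space M \<in> sets M" by simp
    also have "(\<lambda>\<omega>. card (Y \<omega> \<inter> V k)) -` {c k} \<inter> space M = {\<omega> \<in> space M. card (Y \<omega> \<inter> V k) = c k}"
      by auto
    finally show "{\<omega> \<in> space M. card (Y \<omega> \<inter> V k) = c k} \<in> sets M" .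
  qed simp
  moreover have "{\<omega> \<in> space M. \<forall>k\<in>{..<n}. card (Y \<omega> \<inter> V k) = c k} =
      {\<omega> \<in> space M. \<forall>k<n. card (Y \<omega> \<inter> V k) = c k}" by blast
  ultimately show ?thesis by (simp only:)
qed

text \<open>The pieces are the atoms of the Boolean algebra generated by the family: for each
  nonempty subfamily, the points lying in exactly its members. Nonempty subfamilies keep every piece
  inside a window.\<close>

lemma finite_dissection:
  fixes \<V> :: "('i \<times> real \<times> real) set set"
  assumes "finite \<V>" "\<V> \<subseteq> half_windows"
  obtains n C J where "\<And>k. k < n \<Longrightarrow> C k \<in> half_windows" "disjoint_family_on C {..<n}"
    "\<And>V. V \<in> \<V> \<Longrightarrow> J V \<subseteq> {..<n::nat} \<and> V = (\<Union>k\<in>J V. C k)"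
proof -
  define S where "S = Pow \<V> - {{}}"
  define atom where "atom = (\<lambda>\<sigma>. \<Inter>\<sigma> - \<Union>(\<V> - \<sigma>))"
  have "finite S" unfolding S_def using assms by simp
  then obtain e where e: "bij_betw e {0..<card S} S" using ex_bij_betw_nat_finite by blast
  define n where "n = card S"
  have eS: "e k \<in> S" if "k < n" for k using e that unfolding n_def bij_betw_def by auto
  show thesis
  proof (rule that[of n "\<lambda>k. atom (e k)" "\<lambda>V. {k. k < n \<and> V \<in> e k}"])
    fix k assume "k < n"
    then have "e k \<subseteq> \<V>" "e k \<noteq> {}" using eS unfolding S_def by auto
    then show "atom (e k) \<in> half_windows"
      unfolding atom_def using assms finite_subset[of _ \<V>]
      by (intro half_windows_Diff_UN half_windows_INT) auto
  next
    have "atom \<sigma> \<inter> atom \<tau> = {}" if "\<sigma> \<in> S" "\<tau> \<in> S" "\<sigma> \<noteq> \<tau>" for \<sigma> \<tau>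
      using that unfolding atom_def S_def by blast
    then show "disjoint_family_on (\<lambda>k. atom (e k)) {..<n}"
      unfolding disjoint_family_on_def using eS e unfolding n_def bij_betw_def inj_on_def
      by (metis atLeastLessThan_iff lessThan_iff zero_le)
  next
    fix V assume V: "V \<in> \<V>"
    have "V \<subseteq> (\<Union>k\<in>{k. k < n \<and> V \<in> e k}. atom (e k))"
    proof
      fix x assume x: "x \<in> V"
      let ?\<sigma> = "{W \<in> \<V>. x \<in> W}"
      have "?\<sigma> \<in> S" unfolding S_def using V x by auto
      then have "?\<sigma> \<in> e ` {0..<n}" using e unfolding n_def bij_betw_def by simp
      then obtain k where "k < n" "e k = ?\<sigma>" by auto
      moreover have "x \<in> atom ?\<sigma>" unfolding atom_def by auto
      ultimately show "x \<in> (\<Union>k\<in>{k. k < n \<and> V \<in> e k}. atom (e k))" using V x by auto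
    qed
    moreover have "atom (e k) \<subseteq> V" if "V \<in> e k" for k using that unfolding atom_def by auto
    ultimately show "{k. k < n \<and> V \<in> e k} \<subseteq> {..<n} \<and> V = (\<Union>k\<in>{k. k < n \<and> V \<in> e k}. atom (e k))"
      by auto
  qed
qed

text \<open>Disjoint windows suffice. A dissection into disjoint pieces turns counts in overlapping
  windows into sums of independent data, and the events fixing finitely many counts form a generator
  closed under intersection, on which two probability laws can be compared.\<close>

theorem pattern_law_eqI:
  fixes X :: "'a \<Rightarrow> ('i \<times> real \<times> real) set" and X' :: "'b \<Rightarrow> ('i \<times> real \<times> real) set"
  assumes "prob_space M" "prob_space M'"
    and X: "X \<in> M \<rightarrow>\<^sub>M patterns b" and X': "X' \<in> M' \<rightarrow>\<^sub>M patterns b"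
    and fdd: "\<And>(n::nat) V c. (\<And>k. k < n \<Longrightarrow> V k \<in> half_windows) \<Longrightarrow> disjoint_family_on V {..<n} \<Longrightarrow>
      measure M {\<omega> \<in> space M. \<forall>k<n. card (X \<omega> \<inter> V k) = c k} =
      measure M' {\<omega> \<in> space M'. \<forall>k<n. card (X' \<omega> \<inter> V k) = c k}"
  shows "distr M (patterns b) X = distr M' (patterns b) X'"
proof -
  interpret M: prob_space M by fact
  interpret M': prob_space M' by fact
  have mc: "(\<lambda>\<omega>. card (X \<omega> \<inter> V)) \<in> M \<rightarrow>\<^sub>M count_space UNIV"
    "(\<lambda>\<omega>. card (X' \<omega> \<inter> V)) \<in> M' \<rightarrow>\<^sub>M count_space UNIV" if "V \<in> windows" for V
    using measurable_compose[OF X measurable_count[OF that]] measurable_compose[OF X' measurable_count[OF that]] .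
  have finX: "finite (X \<omega> \<inter> V)" if "\<omega> \<in> space M" "V \<in> windows" for \<omega> V
    using measurable_space[OF X that(1)] that(2) by (auto intro: finite_pattern)
  have finX': "finite (X' \<omega> \<inter> V)" if "\<omega> \<in> space M'" "V \<in> windows" for \<omega> V
    using measurable_space[OF X' that(1)] that(2) by (auto intro: finite_pattern)
  have joint: "measure M {\<omega> \<in> space M. \<forall>V\<in>\<V>. card (X \<omega> \<inter> V) = c V} =
      measure M' {\<omega> \<in> space M'. \<forall>V\<in>\<V>. card (X' \<omega> \<inter> V) = c V}"
    if \<V>: "finite \<V>" "\<V> \<subseteq> half_windows" for \<V> c
  proof -
    obtain n C J where C: "\<And>k. k < n \<Longrightarrow> C k \<in> half_windows" "disjoint_family_on C {..<n}"
      and J: "\<And>V. V \<in> \<V> \<Longrightarrow> J V \<subseteq> {..<n::nat} \<and> V = (\<Union>k\<in>J V. C k)"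
      using finite_dissection[OF \<V>] by metis
    \<comment> \<open>All counts in the family are sums of entries of this vector. Lists of naturals
      form a countable type, so its law is determined by its point masses, which are the assumed
      probabilities.\<close>
    define vec where "vec = (\<lambda>g. map (\<lambda>k. card (g \<inter> C k)) [0..<n])"
    define T where "T = {l::nat list. \<forall>V\<in>\<V>. (\<Sum>k\<in>J V. l ! k) = c V}"
    have card_V: "card (g \<inter> V) = (\<Sum>k\<in>J V. vec g ! k)"
      if "V \<in> \<V>" "\<And>k. k < n \<Longrightarrow> finite (g \<inter> C k)" for g V
    proof -
      have "g \<inter> V = (\<Union>k\<in>J V. g \<inter> C k)" using J[OF that(1)] by blast
      then have "card (g \<inter> V) = card (\<Union>k\<in>J V. g \<inter> C k)" by simp
      also have "\<dots> = (\<Sum>k\<in>J V. card (g \<inter> C k))"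
      proof (rule card_UN_disjoint)
        show "finite (J V)" using J[OF that(1)] finite_subset[of "J V" "{..<n}"] by simp
        show "\<forall>k\<in>J V. finite (g \<inter> C k)" using J[OF that(1)] that(2) by auto
        have "C k \<inter> C j = {}" if "k \<in> J V" "j \<in> J V" "k \<noteq> j" for k j
          using C(2) J[OF \<open>V \<in> \<V>\<close>] that unfolding disjoint_family_on_def by (auto simp: subset_iff)
        then show "\<forall>k\<in>J V. \<forall>j\<in>J V. k \<noteq> j \<longrightarrow> (g \<inter> C k) \<inter> (g \<inter> C j) = {}" by blast
      qed
      also have "\<dots> = (\<Sum>k\<in>J V. vec g ! k)"
        using J[OF that(1)] unfolding vec_def by (intro sum.cong) auto
      finally show ?thesis .
    qed
    have event: "{\<omega> \<in> space M. \<forall>V\<in>\<V>. card (X \<omega> \<inter> V) = c V} = (\<lambda>\<omega>. vec (X \<omega>)) -` T \<inter> space M"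
      "{\<omega> \<in> space M'. \<forall>V\<in>\<V>. card (X' \<omega> \<inter> V) = c V} = (\<lambda>\<omega>. vec (X' \<omega>)) -` T \<inter> space M'"
    proof -
      have w: "C k \<in> windows" if "k < n" for k using C(1)[OF that] half_windows_subset by blast
      have "card (X \<omega> \<inter> V) = (\<Sum>k\<in>J V. vec (X \<omega>) ! k)" if "\<omega> \<in> space M" "V \<in> \<V>" for \<omega> V
        using that by (intro card_V finX w)
      moreover have "card (X' \<omega> \<inter> V) = (\<Sum>k\<in>J V. vec (X' \<omega>) ! k)" if "\<omega> \<in> space M'" "V \<in> \<V>" for \<omega> V
        using that by (intro card_V finX' w)
      ultimately show "{\<omega> \<in> space M. \<forall>V\<in>\<V>. card (X \<omega> \<inter> V) = c V} = (\<lambda>\<omega>. vec (X \<omega>)) -` T \<inter> space M"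
        "{\<omega> \<in> space M'. \<forall>V\<in>\<V>. card (X' \<omega> \<inter> V) = c V} = (\<lambda>\<omega>. vec (X' \<omega>)) -` T \<inter> space M'"
        unfolding T_def by auto
    qed
    have vec_eq: "vec g = l \<longleftrightarrow> length l = n \<and> (\<forall>k<n. card (g \<inter> C k) = l ! k)" for g l
      unfolding vec_def by (auto simp: list_eq_iff_nth_eq)
    have vec_pre: "(\<lambda>\<omega>. vec (X \<omega>)) -` {l} \<inter> space M =
        (if length l = n then {\<omega> \<in> space M. \<forall>k<n. card (X \<omega> \<inter> C k) = l ! k} else {})" 
      "(\<lambda>\<omega>. vec (X' \<omega>)) -` {l} \<inter> space M' =
        (if length l = n then {\<omega> \<in> space M'. \<forall>k<n. card (X' \<omega> \<inter> C k) = l ! k} else {})" for l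
      using vec_eq by auto
    have ms: "{\<omega> \<in> space M. \<forall>k<n. card (X \<omega> \<inter> C k) = l ! k} \<in> sets M"
      "{\<omega> \<in> space M'. \<forall>k<n. card (X' \<omega> \<inter> C k) = l ! k} \<in> sets M'" for l
    proof -
      have w: "C k \<in> windows" if "k < n" for k using C(1)[OF that] half_windows_subset by blast
      show "{\<omega> \<in> space M. \<forall>k<n. card (X \<omega> \<inter> C k) = l ! k} \<in> sets M"
        by (rule count_family_sets[OF X w])
      show "{\<omega> \<in> space M'. \<forall>k<n. card (X' \<omega> \<inter> C k) = l ! k} \<in> sets M'"
        by (rule count_family_sets[OF X' w])
    qed
    have mv: "(\<lambda>\<omega>. vec (X \<omega>)) \<in> M \<rightarrow>\<^sub>M count_space UNIV" "(\<lambda>\<omega>. vec (X' \<omega>)) \<in> M' \<rightarrow>\<^sub>M count_space UNIV"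
      by (intro measurable_count_space_eq2_countable[THEN iffD2] conjI ballI; simp add: vec_pre ms)+
    have "distr M (count_space UNIV) (\<lambda>\<omega>. vec (X \<omega>)) = distr M' (count_space UNIV) (\<lambda>\<omega>. vec (X' \<omega>))"
    proof (rule measure_eqI_countable[where A = UNIV])
      fix l
      show "emeasure (distr M (count_space UNIV) (\<lambda>\<omega>. vec (X \<omega>))) {l} =
          emeasure (distr M' (count_space UNIV) (\<lambda>\<omega>. vec (X' \<omega>))) {l}"
        using fdd[OF C, of "\<lambda>k. l ! k"] mv
        by (simp add: emeasure_distr vec_pre M.emeasure_eq_measure M'.emeasure_eq_measure)
    qed auto
    then have "measure (distr M (count_space UNIV) (\<lambda>\<omega>. vec (X \<omega>))) T =
        measure (distr M' (count_space UNIV) (\<lambda>\<omega>. vec (X' \<omega>))) T" by simp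
    then show ?thesis using mv by (simp add: measure_distr event)
  qed
  \<comment> \<open>A finite set \<open>F\<close> of demands (window, count). Intersecting two such
    events amounts to uniting the demands.\<close>
  define ev where "ev = (\<lambda>F. {g :: ('i \<times> real \<times> real) set. g \<in> pattern_space b \<and>
    (\<forall>(V, k)\<in>F. card (g \<inter> V) = (k::nat))})"
  define G where "G = {ev F | F. finite F \<and> F \<subseteq> half_windows \<times> (UNIV :: nat set)}"
  have ev_sets: "ev F \<in> sets (patterns b)" if "finite F" "F \<subseteq> half_windows \<times> UNIV" for F
  proof -
    have "{g \<in> space (patterns b). \<forall>Vk\<in>F. card (g \<inter> fst Vk) = snd Vk} \<in> sets (patterns b)"
      using that half_windows_subset
      by (intro sets.sets_Collect_finite_All) (auto intro!: count_eq_sets)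
    then show ?thesis unfolding ev_def by (simp add: split_beta)
  qed
  have gen: "sets (patterns b) = sigma_sets (pattern_space b) G"
  proof
    show "sigma_sets (pattern_space b) G \<subseteq> sets (patterns b)"
      using ev_sets sets.sigma_sets_subset[of G "patterns b"] unfolding G_def by auto
    show "sets (patterns b) \<subseteq> sigma_sets (pattern_space b) G"
      unfolding sets_patterns
    proof (rule sigma_sets_mono, rule subsetI)
      fix A :: "('i \<times> real \<times> real) set set"
      assume "A \<in> {{g \<in> pattern_space b. card (g \<inter> V) = k} | V k. V \<in> windows}"
      then obtain V k where V: "V \<in> windows" and A: "A = {g \<in> pattern_space b. card (g \<inter> V) = k}" by blast
      let ?N = "V \<inter> {(p, t, U). t \<le> 0}" and ?P = "V \<inter> {(p, t, U). 0 < t}"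
      have "card (g \<inter> V) = card (g \<inter> ?N) + card (g \<inter> ?P)" if "g \<in> pattern_space b" for g
      proof -
        have "g \<inter> V = (g \<inter> ?N) \<union> (g \<inter> ?P)" by auto
        moreover have "card ((g \<inter> ?N) \<union> (g \<inter> ?P)) = card (g \<inter> ?N) + card (g \<inter> ?P)"
          using finite_pattern[OF that V] by (intro card_Un_disjoint) (auto intro: finite_subset[of _ "g \<inter> V"])
        ultimately show ?thesis by simp
      qed
      \<comment> \<open>A count \<open>k\<close> in the full window splits into \<open>j\<close>
        atoms up to time 0 and \<open>k - j\<close> after it; hence half windows generate the same
        sets.\<close>
      then have "A = (\<Union>j\<in>{..k}. ev {(?N, j), (?P, k - j)})"
        unfolding A ev_def by (auto intro: bexI[of _ "card (_ \<inter> ?N)"])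
      moreover have "ev {(?N, j), (?P, k - j)} \<in> sigma_sets (pattern_space b) G" for j
        using window_halves[OF V] unfolding G_def by (intro sigma_sets.Basic) auto
      ultimately show "A \<in> sigma_sets (pattern_space b) G"
        by (auto intro!: sigma_sets_UNION)
    qed
  qed
  show ?thesis
  proof (rule measure_eqI_generator_eq[where \<Omega> = "pattern_space b" and E = G and A = "\<lambda>_. ev {}"])
    show "Int_stable G"
    proof (rule Int_stableI)
      fix A B assume "A \<in> G" "B \<in> G"
      then obtain F F' where F: "A = ev F" "finite F" "F \<subseteq> half_windows \<times> UNIV"
        "B = ev F'" "finite F'" "F' \<subseteq> half_windows \<times> UNIV" unfolding G_def by auto
      have "A \<inter> B = ev (F \<union> F')" unfolding F ev_def ball_Un
        by (intro set_eqI) (simp only: Int_iff mem_Collect_eq conj_assoc, argo)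
      then show "A \<inter> B \<in> G" using F unfolding G_def by blast
    qed
    show "G \<subseteq> Pow (pattern_space b)" unfolding G_def ev_def by auto
    fix A assume "A \<in> G"
    then obtain F where F: "A = ev F" "finite F" "F \<subseteq> half_windows \<times> UNIV" unfolding G_def by auto
    have pre: "X -` A \<inter> space M = {\<omega> \<in> space M. \<forall>(V, k)\<in>F. card (X \<omega> \<inter> V) = k}"
      "X' -` A \<inter> space M' = {\<omega> \<in> space M'. \<forall>(V, k)\<in>F. card (X' \<omega> \<inter> V) = k}"
      unfolding F ev_def using measurable_space[OF X] measurable_space[OF X'] by auto
    have "measure M (X -` A \<inter> space M) = measure M' (X' -` A \<inter> space M')"
    \<comment> \<open>If \<open>F\<close> demands two different counts of one window, the event is
      empty under both laws; otherwise the demands are a function of the window and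
      \<open>joint\<close> applies.\<close>
    proof (cases "single_valued F")
      case True
      define c where "c = (\<lambda>V. SOME k. (V, k) \<in> F)"
      have c: "c V = k" if "(V, k) \<in> F" for V k
        unfolding c_def using that someI[of "\<lambda>k. (V, k) \<in> F" k] True by (auto dest: single_valuedD)
      have "finite (fst ` F)" "fst ` F \<subseteq> half_windows" using F by auto
      note joint[OF this, of c]
      moreover have "(\<forall>V\<in>fst ` F. card (g \<inter> V) = c V) \<longleftrightarrow> (\<forall>(V, k)\<in>F. card (g \<inter> V) = k)" for g
        using c by fastforce
      ultimately show ?thesis unfolding pre by simp
    next
      case False
      then obtain V k k' where "(V, k) \<in> F" "(V, k') \<in> F" "k \<noteq> k'" unfolding single_valued_def by blast
      note F_k = this
      have "\<not> (\<forall>(V, k)\<in>F. card (g \<inter> V) = k)" for g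
      proof
        assume all: "\<forall>(V, k)\<in>F. card (g \<inter> V) = k"
        show False using bspec[OF all F_k(1)] bspec[OF all F_k(2)] F_k(3) by simp
      qed
      then have "X -` A \<inter> space M = {}" "X' -` A \<inter> space M' = {}" unfolding pre by simp_all
      then show ?thesis by simp
    qed
    then show "emeasure (distr M (patterns b) X) A = emeasure (distr M' (patterns b) X') A"
      using ev_sets[OF F(2,3)] F(1)
      by (simp add: emeasure_distr[OF X] emeasure_distr[OF X'] M.emeasure_eq_measure M'.emeasure_eq_measure)
  next
    show "range (\<lambda>_. ev {}) \<subseteq> G" unfolding G_def by blast
    show "(\<Union>n::nat. ev {}) = pattern_space b" unfolding ev_def by auto
    show "emeasure (distr M (patterns b) X) (ev {}) \<noteq> \<infinity>" for n :: nat
      using M.prob_space_distr[OF X] by (simp add: finite_measure.emeasure_finite prob_space.finite_measure)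
  qed (simp_all add: gen)
qed

section \<open>The law of the driving processes\<close>

text \<open>For \<open>\<theta> = 0\<close> this is the unit mass at 0, so null windows are
  covered.\<close>

definition poisson_weight :: "real \<Rightarrow> nat \<Rightarrow> real" where
  "poisson_weight \<theta> k = \<theta> ^ k / fact k * exp (- \<theta>)"

lemma poisson_process_count:
  assumes "poisson_process M c S P"
  shows "\<omega> \<in> space M \<Longrightarrow> P \<omega> \<subseteq> S"
    and "\<omega> \<in> space M \<Longrightarrow> bounded B \<Longrightarrow> finite (P \<omega> \<inter> B)"
    and "B \<in> sets borel \<Longrightarrow> bounded B \<Longrightarrow> (\<lambda>\<omega>. card (P \<omega> \<inter> B)) \<in> M \<rightarrow>\<^sub>M count_space UNIV"
  using assms by (simp_all add: poisson_process_def point_process_def)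

lemma poisson_process_prob:
  assumes "poisson_process M c S P" "B \<in> sets borel" "bounded B" "B \<subseteq> S"
  shows "measure M {\<omega> \<in> space M. card (P \<omega> \<inter> B) = k} = poisson_weight (c * measure lborel B) k"
  using assms by (simp add: poisson_process_def poisson_weight_def)

lemma poisson_process_indep:
  fixes n :: nat
  assumes "poisson_process M c S P" "\<And>k. B k \<in> sets borel" "\<And>k. bounded (B k)" "\<And>k. B k \<subseteq> S"
    "disjoint_family_on B {..<n}"
  shows "prob_space.indep_vars M (\<lambda>_. count_space UNIV) (\<lambda>k \<omega>. card (P \<omega> \<inter> B k)) {..<n}"
proof -
  have "\<forall>(n::nat) B. (\<forall>k<n. B k \<in> sets borel \<and> bounded (B k) \<and> B k \<subseteq> S) \<and> disjoint_family_on B {..<n} \<longrightarrow>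
      prob_space.indep_vars M (\<lambda>_. count_space UNIV) (\<lambda>k \<omega>. card (P \<omega> \<inter> B k)) {..<n}"
    using assms(1) unfolding poisson_process_def by (elim conjE)
  from this[THEN spec, of n, THEN spec, of B] show ?thesis using assms(2-5) by simp
qed

lemma (in prob_space) poisson_process_fdd:
  fixes P :: "'a \<Rightarrow> 'e::euclidean_space set" and B :: "nat \<Rightarrow> 'e set"
  assumes P: "poisson_process M c S P" and S: "S \<in> sets borel" and K: "finite K"
    and B: "\<And>k. k \<in> K \<Longrightarrow> B k \<in> sets borel" "\<And>k. k \<in> K \<Longrightarrow> bounded (B k)" "disjoint_family_on B K"
  shows "prob {\<omega> \<in> space M. \<forall>k\<in>K. card (P \<omega> \<inter> B k) = n k} =
    (\<Prod>k\<in>K. poisson_weight (c * measure lborel (B k \<inter> S)) (n k))"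
proof (cases "K = {}")
  case True
  then show ?thesis by (simp add: prob_space)
next
  case False
  \<comment> \<open>Points never leave \<open>S\<close>, so intersecting with \<open>S\<close>
    changes no count. Empty sets fill the indices outside \<open>K\<close>, because the independence
    clause speaks of an initial segment of the naturals.\<close>
  define B' where "B' = (\<lambda>k. if k \<in> K then B k \<inter> S else {})"
  obtain m where m: "K \<subseteq> {..<m}" using K finite_nat_iff_bounded by blast
  have sub: "P \<omega> \<subseteq> S" if "\<omega> \<in> space M" for \<omega>
    by (rule poisson_process_count(1)[OF P that])
  have B': "B' k \<in> sets borel" "bounded (B' k)" "B' k \<subseteq> S" for k
  proof -
    show "B' k \<in> sets borel" using sets.Int[OF B(1) S, of k] unfolding B'_def by simp
    show "bounded (B' k)" using bounded_subset[OF B(2), of k "B k \<inter> S"] unfolding B'_def by simp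
    show "B' k \<subseteq> S" unfolding B'_def by simp
  qed
  have "disjoint_family_on B' {..<m}"
    using B(3) unfolding B'_def disjoint_family_on_def by auto
  then have "indep_vars (\<lambda>_. count_space UNIV) (\<lambda>k \<omega>. card (P \<omega> \<inter> B' k)) {..<m}"
    by (rule poisson_process_indep[OF P B'])
  then have "indep_vars (\<lambda>_. count_space UNIV) (\<lambda>k \<omega>. card (P \<omega> \<inter> B' k)) K"
    by (rule indep_vars_subset[OF _ m])
  then have "prob (\<Inter>k\<in>K. (\<lambda>\<omega>. card (P \<omega> \<inter> B' k)) -` {n k} \<inter> space M) =
      (\<Prod>k\<in>K. prob ((\<lambda>\<omega>. card (P \<omega> \<inter> B' k)) -` {n k} \<inter> space M))"
    by (rule indep_varsD[OF _ False K order_refl]) auto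
  also have "(\<Inter>k\<in>K. (\<lambda>\<omega>. card (P \<omega> \<inter> B' k)) -` {n k} \<inter> space M) =
      {\<omega> \<in> space M. \<forall>k\<in>K. card (P \<omega> \<inter> B k) = n k}"
  proof -
    have "P \<omega> \<inter> B' k = P \<omega> \<inter> B k" if "\<omega> \<in> space M" "k \<in> K" for \<omega> k
      using sub[OF that(1)] that(2) unfolding B'_def by auto
    then show ?thesis using False by auto
  qed
  also have "(\<Prod>k\<in>K. prob ((\<lambda>\<omega>. card (P \<omega> \<inter> B' k)) -` {n k} \<inter> space M)) =
      (\<Prod>k\<in>K. poisson_weight (c * measure lborel (B k \<inter> S)) (n k))"
  proof (rule prod.cong[OF refl])
    fix k assume k: "k \<in> K"
    have "(\<lambda>\<omega>. card (P \<omega> \<inter> B' k)) -` {n k} \<inter> space M = {\<omega> \<in> space M. card (P \<omega> \<inter> B' k) = n k}" by auto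
    moreover have "measure M {\<omega> \<in> space M. card (P \<omega> \<inter> B' k) = n k} =
        poisson_weight (c * measure lborel (B' k)) (n k)"
      by (rule poisson_process_prob[OF P B'])
    ultimately show "prob ((\<lambda>\<omega>. card (P \<omega> \<inter> B' k)) -` {n k} \<inter> space M) =
        poisson_weight (c * measure lborel (B k \<inter> S)) (n k)" using k unfolding B'_def by simp
  qed
  finally show ?thesis .
qed

text \<open>
  All processes are merged into one pattern, indexed by \<^term>\<open>Inl\<close> for arrivals and \<^term>\<open>Inr\<close> for
  services; an arrival carries the dummy mark \<open>0\<close>.
\<close>
type_synonym 'd process = "(int, 'd) vec + (int, 'd) vec"
type_synonym 'd pattern = "('d process \<times> real \<times> real) set"

definition arrivals :: "'d pattern \<Rightarrow> int ^ 'd \<Rightarrow> real set" where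
  "arrivals g i = {t. (Inl i, t, 0) \<in> g}"

definition services :: "'d pattern \<Rightarrow> int ^ 'd \<Rightarrow> (real \<times> real) set" where
  "services g i = {(t, U). (Inr i, t, U) \<in> g}"

definition shift_pattern :: "real \<Rightarrow> ('i \<times> real \<times> real) set \<Rightarrow> ('i \<times> real \<times> real) set" where
  "shift_pattern v g = {(p, t, U). (p, t + v, U) \<in> g}"

definition translate_pattern ::
  "int ^ 'd \<Rightarrow> 'd pattern \<Rightarrow> 'd pattern" where
  "translate_pattern z g = {(p, t, U). (map_sum (\<lambda>i. i - z) (\<lambda>i. i - z) p, t, U) \<in> g}"

text \<open>Time 0 belongs to the past, in line with \<open>trajectory\<close>, which from time 0 on
  reads only atoms in (0, \<infinity>).\<close>

definition splice_at_zero ::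
  "('i \<times> real \<times> real) set \<Rightarrow> ('i \<times> real \<times> real) set \<Rightarrow> ('i \<times> real \<times> real) set" where
  "splice_at_zero g g' = {(p, t, U). if t \<le> 0 then (p, t, U) \<in> g else (p, t, U) \<in> g'}"

section \<open>The driving processes as one random pattern\<close>

locale network = interference a + prob_space M
  for a :: "int ^ 'd \<Rightarrow> real" and M :: "'w measure" +
  fixes lam :: real
    and A :: "int ^ 'd \<Rightarrow> 'w \<Rightarrow> real set"
    and D :: "int ^ 'd \<Rightarrow> 'w \<Rightarrow> (real \<times> real) set"
  assumes lam_pos: "0 < lam" and driving: "driving_processes M lam a A D"
begin

definition top_mark :: real where "top_mark = 1 / a 0"
abbreviation pats :: "'d pattern measure" where
  "pats \<equiv> patterns top_mark"

definition drive :: "'w \<Rightarrow> 'd pattern" where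
  "drive \<omega> = {(p, t, U). case p of Inl i \<Rightarrow> t \<in> A i \<omega> \<and> U = 0 | Inr i \<Rightarrow> (t, U) \<in> D i \<omega>}"

text \<open>A window meets one process only, so on it one of the two terms vanishes and the other is
  the mean count. Arrivals live on the axis of mark 0, whence a one-dimensional measure for
  them.\<close>

definition intensity :: "'d pattern \<Rightarrow> real" where
  "intensity V = lam * measure lborel {t. \<exists>i. (Inl i, t, 0) \<in> V} +
     measure lborel {(t, U). 0 \<le> U \<and> U \<le> top_mark \<and> (\<exists>i. (Inr i, t, U) \<in> V)}"

lemma arrivals_poisson: "poisson_process M lam UNIV (A i)"
  and services_poisson: "poisson_process M 1 (UNIV \<times> {0..top_mark}) (D i)"
  and processes_indep: "indep_sets
       (case_sum (\<lambda>i. process_events M (A i)) (\<lambda>i. process_events M (D i))) UNIV"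
  using driving unfolding driving_processes_def top_mark_def by blast+

lemma top_mark_pos: "0 < top_mark"
  unfolding top_mark_def using a_zero by simp

lemma arrivals_drive [simp]: "arrivals (drive \<omega>) = (\<lambda>i. A i \<omega>)"
  and services_drive [simp]: "services (drive \<omega>) = (\<lambda>i. D i \<omega>)"
  unfolding arrivals_def services_def drive_def by auto

lemma card_drive_Inl: "card (drive \<omega> \<inter> {Inl i} \<times> B) = card (A i \<omega> \<inter> {t. (t, 0) \<in> B})"
proof -
  have "drive \<omega> \<inter> {Inl i} \<times> B = (\<lambda>t. (Inl i, t, 0)) ` (A i \<omega> \<inter> {t. (t, 0) \<in> B})"
    unfolding drive_def by auto
  then show ?thesis by (simp add: card_image inj_on_def)
qed

lemma card_drive_Inr: "card (drive \<omega> \<inter> {Inr i} \<times> B) = card (D i \<omega> \<inter> B)"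
proof -
  have "drive \<omega> \<inter> {Inr i} \<times> B = Pair (Inr i) ` (D i \<omega> \<inter> B)"
    unfolding drive_def by auto
  then show ?thesis by (simp add: card_image inj_on_def)
qed

lemma axis_section:
  assumes "B \<in> sets borel" "bounded B"
  shows "{t::real. (t, 0::real) \<in> B} \<in> sets borel" "bounded {t::real. (t, 0::real) \<in> B}"
proof -
  have "(\<lambda>t::real. (t, 0::real)) \<in> borel \<rightarrow>\<^sub>M borel" by measurable
  from measurable_sets[OF this assms(1)] show "{t. (t, 0) \<in> B} \<in> sets borel" by (simp add: vimage_def)
  have "{t. (t, 0) \<in> B} \<subseteq> fst ` B" by force
  then show "bounded {t. (t, 0) \<in> B}" using assms(2) bounded_fst bounded_subset by blast
qed

lemma strip_sets: "(UNIV :: real set) \<times> {0..top_mark} \<in> sets borel"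
  by (intro borel_Times) auto

lemma intensity_window:
  "intensity ({Inl i} \<times> B) = lam * measure lborel {t. (t, 0) \<in> B}"
  "intensity ({Inr i} \<times> B) = measure lborel (B \<inter> UNIV \<times> {0..top_mark})"
proof -
  let ?L = "{Inl i} \<times> B :: 'd pattern" and ?R = "{Inr i} \<times> B :: 'd pattern"
  have "{t. \<exists>j. (Inl j, t, 0) \<in> ?L} = {t. (t, 0) \<in> B}"
    "{(t, U). 0 \<le> U \<and> U \<le> top_mark \<and> (\<exists>j. (Inr j, t, U) \<in> ?L)} = {}"
    by blast+
  then show "intensity ?L = lam * measure lborel {t. (t, 0) \<in> B}"
    unfolding intensity_def by (simp only:) simp
  have "{t. \<exists>j. (Inl j, t, 0) \<in> ?R} = {}"
    "{(t, U). 0 \<le> U \<and> U \<le> top_mark \<and> (\<exists>j. (Inr j, t, U) \<in> ?R)} = B \<inter> UNIV \<times> {0..top_mark}"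
    by auto
  then show "intensity ?R = measure lborel (B \<inter> UNIV \<times> {0..top_mark})"
    unfolding intensity_def by (simp only:) simp
qed

lemma drive_space:
  assumes "\<omega> \<in> space M"
  shows "drive \<omega> \<in> pattern_space top_mark"
proof -
  have A: "finite (A i \<omega> \<inter> B)" if "bounded B" for i B
    by (rule poisson_process_count(2)[OF arrivals_poisson assms that])
  have D: "finite (D i \<omega> \<inter> B)" if "bounded B" for i B
    by (rule poisson_process_count(2)[OF services_poisson assms that])
  have D': "D i \<omega> \<subseteq> UNIV \<times> {0..top_mark}" for i
    by (rule poisson_process_count(1)[OF services_poisson assms])
  have "finite (drive \<omega> \<inter> V)" if win: "V \<in> windows" for V
  proof -
    obtain p B where V: "V = {p} \<times> B" and B: "B \<in> sets borel" "bounded B" using win by (elim windowsE)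
    show ?thesis
    proof (cases p)
      case (Inl i)
      have "drive \<omega> \<inter> V \<subseteq> (\<lambda>t. (Inl i, t, 0)) ` (A i \<omega> \<inter> {t. (t, 0) \<in> B})"
        unfolding drive_def V Inl by auto
      then show ?thesis using A[OF axis_section(2)[OF B]] finite_subset by blast
    next
      case (Inr i)
      have "drive \<omega> \<inter> V \<subseteq> Pair (Inr i) ` (D i \<omega> \<inter> B)" unfolding drive_def V Inr by auto
      then show ?thesis using D[OF B(2)] finite_subset by blast
    qed
  qed
  moreover have "0 \<le> U \<and> U \<le> top_mark" if "(p, t, U) \<in> drive \<omega>" for p t U
  proof (cases p)
    case (Inr i)
    then have "(t, U) \<in> D i \<omega>" using that unfolding drive_def by simp
    then show ?thesis using D'[of i] by auto
  qed (use that top_mark_pos in \<open>simp add: drive_def\<close>)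
  ultimately show ?thesis unfolding pattern_space_def by blast
qed

lemma drive_count_measurable:
  assumes "V \<in> windows"
  shows "(\<lambda>\<omega>. card (drive \<omega> \<inter> V)) \<in> M \<rightarrow>\<^sub>M count_space UNIV"
proof -
  obtain p B where V: "V = {p} \<times> B" and B: "B \<in> sets borel" "bounded B" using assms by (elim windowsE)
  show ?thesis
  proof (cases p)
    case (Inl i)
    show ?thesis unfolding V Inl card_drive_Inl
      by (rule poisson_process_count(3)[OF arrivals_poisson axis_section[OF B]])
  next
    case (Inr i)
    show ?thesis unfolding V Inr card_drive_Inr
      by (rule poisson_process_count(3)[OF services_poisson B])
  qed
qed

lemma drive_measurable: "drive \<in> M \<rightarrow>\<^sub>M pats"
  by (rule measurable_patternsI) (auto intro: drive_space drive_count_measurable)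

definition events_of :: "'d process \<Rightarrow> 'w set set" where
  "events_of = case_sum (\<lambda>i. process_events M (A i)) (\<lambda>i. process_events M (D i))"

lemma events_of_sigma: "sets (sigma (space M) (events_of p)) = events_of p"
  "space (sigma (space M) (events_of p)) = space M"
proof -
  have "\<exists>G. G \<subseteq> Pow (space M) \<and> events_of p = sigma_sets (space M) G"
    unfolding events_of_def process_events_def by (cases p; simp; rule exI, rule conjI[OF _ refl], blast)
  then obtain G where G: "G \<subseteq> Pow (space M)" "events_of p = sigma_sets (space M) G" by blast
  have "sigma_algebra (space M) (events_of p)" unfolding G(2) by (rule sigma_algebra_sigma_sets[OF G(1)])
  then show "sets (sigma (space M) (events_of p)) = events_of p"
    "space (sigma (space M) (events_of p)) = space M"
    by (auto simp: sigma_algebra.sets_measure_of_eq sigma_algebra.space_measure_of_eq)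
qed

lemma count_event:
  assumes "B \<in> sets borel" "bounded B"
  shows "{\<omega> \<in> space M. card (drive \<omega> \<inter> {p} \<times> B) = k} \<in> events_of p"
proof (cases p)
  case (Inl i)
  show ?thesis using axis_section[OF assms]
    unfolding Inl card_drive_Inl events_of_def process_events_def sum.case by blast
next
  case (Inr i)
  show ?thesis using assms
    unfolding Inr card_drive_Inr events_of_def process_events_def sum.case by blast
qed

lemma indep_events_of:
  assumes "finite P" "\<And>p. p \<in> P \<Longrightarrow> F p \<in> events_of p"
  shows "prob {\<omega> \<in> space M. \<forall>p\<in>P. \<omega> \<in> F p} = (\<Prod>p\<in>P. prob (F p))"
proof (cases "P = {}")
  case False
  have "F p \<subseteq> space M" if "p \<in> P" for p
    using sets.sets_into_space[of "F p" "sigma (space M) (events_of p)"] assms(2)[OF that]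
    by (simp add: events_of_sigma)
  then have "{\<omega> \<in> space M. \<forall>p\<in>P. \<omega> \<in> F p} = (\<Inter>p\<in>P. F p)" using False by auto
  then show ?thesis
    using indep_setsD[OF processes_indep _ False assms(1), of F] assms(2) unfolding events_of_def by simp
qed (simp add: prob_space)

text \<open>The windows are grouped by process. Within a group the counts are independent because
  the windows are disjoint; across groups independence is that of the processes.\<close>

theorem drive_fdd:
  fixes V :: "nat \<Rightarrow> _"
  assumes K: "finite K" and V: "\<And>k. k \<in> K \<Longrightarrow> V k \<in> windows" and disj: "disjoint_family_on V K"
  shows "prob {\<omega> \<in> space M. \<forall>k\<in>K. card (drive \<omega> \<inter> V k) = n k} =
    (\<Prod>k\<in>K. poisson_weight (intensity (V k)) (n k))"
proof -
  have "\<forall>k\<in>K. \<exists>p B. V k = {p} \<times> B \<and> B \<in> sets borel \<and> bounded B" using V windowsE by metis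
  then obtain p B where VB: "\<And>k. k \<in> K \<Longrightarrow> V k = {p k} \<times> B k"
    and B: "\<And>k. k \<in> K \<Longrightarrow> B k \<in> sets borel" "\<And>k. k \<in> K \<Longrightarrow> bounded (B k)"
    by metis
  define F where "F = (\<lambda>q. {\<omega> \<in> space M. \<forall>k\<in>{k \<in> K. p k = q}. card (drive \<omega> \<inter> {q} \<times> B k) = n k})"
  have F: "F q \<in> events_of q" for q
  proof -
    have "{\<omega> \<in> space (sigma (space M) (events_of q)). \<forall>k\<in>{k \<in> K. p k = q}. card (drive \<omega> \<inter> {q} \<times> B k) = n k}
        \<in> sets (sigma (space M) (events_of q))"
      by (rule sets.sets_Collect_finite_All) (use K B count_event in \<open>auto simp: events_of_sigma\<close>)
    then show ?thesis unfolding F_def by (simp add: events_of_sigma)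
  qed
  have disj_q: "disjoint_family_on B {k \<in> K. p k = q}" for q
    using disj VB unfolding disjoint_family_on_def by fastforce
  have prob_F: "prob (F q) = (\<Prod>k\<in>{k \<in> K. p k = q}. poisson_weight (intensity (V k)) (n k))" for q
  proof (cases q)
    case (Inl i)
    have "prob (F q) = prob {\<omega> \<in> space M. \<forall>k\<in>{k \<in> K. p k = q}. card (A i \<omega> \<inter> {t. (t, 0) \<in> B k}) = n k}"
      unfolding F_def unfolding Inl card_drive_Inl ..
    also have "\<dots> = (\<Prod>k\<in>{k \<in> K. p k = q}. poisson_weight (lam * measure lborel ({t. (t, 0) \<in> B k} \<inter> UNIV)) (n k))"
      using K disj_q[of q] B axis_section
      by (intro poisson_process_fdd[OF arrivals_poisson]) (auto simp: disjoint_family_on_def)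
    finally show ?thesis by (auto simp: VB Inl intensity_window intro!: prod.cong)
  next
    case (Inr i)
    have "prob (F q) = prob {\<omega> \<in> space M. \<forall>k\<in>{k \<in> K. p k = q}. card (D i \<omega> \<inter> B k) = n k}"
      unfolding F_def unfolding Inr card_drive_Inr ..
    also have "\<dots> = (\<Prod>k\<in>{k \<in> K. p k = q}. poisson_weight (1 * measure lborel (B k \<inter> UNIV \<times> {0..top_mark})) (n k))"
      using K disj_q[of q] B by (intro poisson_process_fdd[OF services_poisson strip_sets]) auto
    finally show ?thesis by (auto simp: VB Inr intensity_window intro!: prod.cong)
  qed
  have "{\<omega> \<in> space M. \<forall>k\<in>K. card (drive \<omega> \<inter> V k) = n k} = {\<omega> \<in> space M. \<forall>q\<in>p ` K. \<omega> \<in> F q}"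
    unfolding F_def by (auto simp: VB)
  then have "prob {\<omega> \<in> space M. \<forall>k\<in>K. card (drive \<omega> \<inter> V k) = n k} = (\<Prod>q\<in>p ` K. prob (F q))"
    using indep_events_of[of "p ` K" F] K F by simp
  also have "\<dots> = (\<Prod>k\<in>K. poisson_weight (intensity (V k)) (n k))"
    unfolding prob_F by (rule prod.image_gen[OF K, symmetric])
  finally show ?thesis .
qed

lemma drive_fdd_lessThan:
  fixes n :: nat
  assumes "\<And>k. k < n \<Longrightarrow> V k \<in> windows" "disjoint_family_on V {..<n}"
  shows "prob {\<omega> \<in> space M. \<forall>k<n. card (drive \<omega> \<inter> V k) = c k} =
    (\<Prod>k\<in>{..<n}. poisson_weight (intensity (V k)) (c k))"
proof -
  have "{\<omega> \<in> space M. \<forall>k<n. card (drive \<omega> \<inter> V k) = c k} =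
    {\<omega> \<in> space M. \<forall>k\<in>{..<n}. card (drive \<omega> \<inter> V k) = c k}" by blast
  then show ?thesis using drive_fdd[of "{..<n}" V c] assms by simp
qed

section \<open>Invariance of the driving law under time shift, translation and splicing\<close>

lemma preimage_pattern_measurable:
  assumes "inj \<phi>" and win: "\<And>V. V \<in> windows \<Longrightarrow> \<phi> ` V \<in> windows"
    and mark: "\<And>x. snd (snd (\<phi> x)) = snd (snd x)"
  shows "(\<lambda>g. \<phi> -` g) \<in> pats \<rightarrow>\<^sub>M pats"
    and "\<And>g V. card (\<phi> -` g \<inter> V) = card (g \<inter> \<phi> ` V)"
proof -
  have img: "\<phi> ` (\<phi> -` g \<inter> V) = g \<inter> \<phi> ` V" for g V by auto
  show card: "card (\<phi> -` g \<inter> V) = card (g \<inter> \<phi> ` V)" for g V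
    using card_image[of \<phi> "\<phi> -` g \<inter> V"] assms(1) img by (metis inj_on_subset subset_UNIV)
  show "(\<lambda>g. \<phi> -` g) \<in> pats \<rightarrow>\<^sub>M pats"
  proof (rule measurable_patternsI)
    fix g assume "g \<in> space pats"
    then have g: "g \<in> pattern_space top_mark" by simp
    have "finite (\<phi> -` g \<inter> V)" if "V \<in> windows" for V
      using finite_pattern[OF g win[OF that]] img[of g V] assms(1)
      by (metis finite_imageD inj_on_subset subset_UNIV)
    moreover have "0 \<le> U \<and> U \<le> top_mark" if "(p, t, U) \<in> \<phi> -` g" for p t U
      using g that mark[of "(p, t, U)"] unfolding pattern_space_def by (cases "\<phi> (p, t, U)") auto
    ultimately show "\<phi> -` g \<in> pattern_space top_mark" unfolding pattern_space_def by blast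
  qed (use measurable_count[OF win] card in simp)
qed

text \<open>Counts of the transformed pattern in \<open>V\<close> are counts of the original in the
  image of \<open>V\<close>. An injective map keeps windows disjoint, so equal intensities give
  equal finite-dimensional laws.\<close>

lemma preimage_pattern_law:
  assumes "inj \<phi>" and win: "\<And>V. V \<in> windows \<Longrightarrow> \<phi> ` V \<in> windows"
    and mark: "\<And>x. snd (snd (\<phi> x)) = snd (snd x)"
    and int: "\<And>V. V \<in> windows \<Longrightarrow> intensity (\<phi> ` V) = intensity V"
  shows "distr M pats (\<lambda>\<omega>. \<phi> -` drive \<omega>) = distr M pats drive"
proof (rule pattern_law_eqI[OF prob_space_axioms prob_space_axioms])
  show "(\<lambda>\<omega>. \<phi> -` drive \<omega>) \<in> M \<rightarrow>\<^sub>M pats"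
    by (rule measurable_compose[OF drive_measurable preimage_pattern_measurable(1)[OF assms(1-3)]])
  fix n :: nat and V :: "nat \<Rightarrow> 'd pattern" and c
  assume V: "\<And>k. k < n \<Longrightarrow> V k \<in> half_windows" and d: "disjoint_family_on V {..<n}"
  then have V': "V k \<in> windows" if "k < n" for k using that half_windows_subset by blast
  have "disjoint_family_on (\<lambda>k. \<phi> ` V k) {..<n}"
    using d assms(1) unfolding disjoint_family_on_def by (auto simp: image_Int[symmetric])
  then have "prob {\<omega> \<in> space M. \<forall>k<n. card (drive \<omega> \<inter> \<phi> ` V k) = c k} =
      (\<Prod>k\<in>{..<n}. poisson_weight (intensity (\<phi> ` V k)) (c k))"
    using V' win by (intro drive_fdd_lessThan) auto
  also have "\<dots> = (\<Prod>k\<in>{..<n}. poisson_weight (intensity (V k)) (c k))"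
    using V' int by (intro prod.cong) auto
  also have "\<dots> = prob {\<omega> \<in> space M. \<forall>k<n. card (drive \<omega> \<inter> V k) = c k}"
    using V' d by (intro drive_fdd_lessThan[symmetric]) auto
  finally show "prob {\<omega> \<in> space M. \<forall>k<n. card (\<phi> -` drive \<omega> \<inter> V k) = c k} =
      prob {\<omega> \<in> space M. \<forall>k<n. card (drive \<omega> \<inter> V k) = c k}"
    by (simp only: preimage_pattern_measurable(2)[OF assms(1-3)])
qed (rule drive_measurable)

definition time_map :: "real \<Rightarrow> ('i \<times> real \<times> real) \<Rightarrow> 'i \<times> real \<times> real" where
  "time_map v = (\<lambda>(p, t, U). (p, t + v, U))"

definition space_map ::
  "int ^ 'd \<Rightarrow> ('d process \<times> real \<times> real) \<Rightarrow> 'd process \<times> real \<times> real" where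
  "space_map z = (\<lambda>(p, t, U). (map_sum (\<lambda>i. i - z) (\<lambda>i. i - z) p, t, U))"

lemma shift_pattern_eq: "shift_pattern v g = time_map v -` g"
  unfolding shift_pattern_def time_map_def by auto

lemma translate_pattern_eq: "translate_pattern z g = space_map z -` g"
  unfolding translate_pattern_def space_map_def by auto

lemma shifted_borel:
  assumes "B \<in> sets borel" "bounded B"
  shows "(\<lambda>(t::real, U::real). (t + v, U)) ` B \<in> sets borel" "bounded ((\<lambda>(t::real, U::real). (t + v, U)) ` B)"
    "measure lborel ((\<lambda>(t::real, U::real). (t + v, U)) ` B) = measure lborel B"
proof -
  have plus: "(\<lambda>(t::real, U::real). (t + v, U)) = (+) (v, 0)" by (simp add: fun_eq_iff add.commute)
  have eq: "(+) (v, 0) ` B = (+) (- v, 0) -` B \<inter> space borel"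
  proof (intro set_eqI iffI)
    fix x :: "real \<times> real" assume x: "x \<in> (+) (- v, 0) -` B \<inter> space borel"
    have "x = (v, 0) + ((- v, 0) + x)" by (cases x) simp
    then show "x \<in> (+) (v, 0) ` B" using x by (intro image_eqI[of x _ "(- v, 0) + x"]) auto
  qed auto
  show b: "(\<lambda>(t, U). (t + v, U)) ` B \<in> sets borel"
    unfolding plus eq by (rule measurable_sets[OF _ assms(1)]) measurable
  show "bounded ((\<lambda>(t, U). (t + v, U)) ` B)"
    unfolding plus using bounded_translation[OF assms(2)] .
  have "emeasure lborel ((+) (v, 0) ` B) = emeasure (distr lborel borel ((+) (v, 0))) ((+) (v, 0) ` B)"
    by (simp add: lborel_distr_plus)
  also have "\<dots> = emeasure lborel ((+) (v, 0) -` ((+) (v, 0) ` B) \<inter> space lborel)"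
    using b unfolding plus by (intro emeasure_distr) auto
  also have "(+) (v, 0) -` ((+) (v, 0) ` B) \<inter> space lborel = B" by (auto simp: image_iff)
  finally show "measure lborel ((\<lambda>(t, U). (t + v, U)) ` B) = measure lborel B"
    unfolding plus measure_def by simp
qed

lemma time_map_props:
  shows "inj (time_map v :: 'd process \<times> real \<times> real \<Rightarrow> _)"
    and "V \<in> windows \<Longrightarrow> time_map v ` V \<in> windows"
    and "snd (snd (time_map v x)) = snd (snd x)"
    and "V \<in> windows \<Longrightarrow> intensity (time_map v ` V) = intensity V"
proof -
  show "inj (time_map v :: 'd process \<times> real \<times> real \<Rightarrow> _)"
    unfolding time_map_def by (auto simp: inj_on_def)
  show "snd (snd (time_map v x)) = snd (snd x)" unfolding time_map_def by (simp add: split_beta)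
  assume "V \<in> windows"
  then obtain p B where V: "V = {p} \<times> B" and B: "B \<in> sets borel" "bounded B" by (elim windowsE)
  have img: "time_map v ` V = {p} \<times> ((\<lambda>(t, U). (t + v, U)) ` B)"
    unfolding V time_map_def by force
  show "time_map v ` V \<in> windows" unfolding img using shifted_borel[OF B] by (intro windowsI)
  show "intensity (time_map v ` V) = intensity V"
  proof (cases p)
    case (Inl i)
    let ?T = "{t. (t, 0) \<in> B}"
    have eq: "{t. (t, 0) \<in> (\<lambda>(t, U). (t + v, U)) ` B} = (+) v ` ?T"
      by (auto simp: image_iff add.commute intro: rev_bexI)
    have "emeasure lborel ((+) v ` ?T) = emeasure (distr lborel borel ((+) v)) ((+) v ` ?T)"
      by (simp add: lborel_distr_plus)
    also have "\<dots> = emeasure lborel ((+) v -` ((+) v ` ?T) \<inter> space lborel)"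
    proof (rule emeasure_distr)
      show "(+) v ` ?T \<in> sets borel" using axis_section(1)[OF shifted_borel(1,2)[OF B, of v]] unfolding eq .
    qed measurable
    also have "(+) v -` ((+) v ` ?T) \<inter> space lborel = ?T" by (auto simp: image_iff)
    finally show ?thesis unfolding img unfolding V Inl intensity_window eq measure_def by simp
  next
    case (Inr i)
    have eq: "(\<lambda>(t, U). (t + v, U)) ` B \<inter> UNIV \<times> {0..top_mark} =
        (\<lambda>(t, U). (t + v, U)) ` (B \<inter> UNIV \<times> {0..top_mark})" by auto
    show ?thesis unfolding img unfolding V Inr intensity_window eq
      by (rule shifted_borel(3)) (use B strip_sets in \<open>auto intro: bounded_subset\<close>)
  qed
qed

lemma space_map_props:
  shows "inj (space_map z)"
    and "V \<in> windows \<Longrightarrow> space_map z ` V \<in> windows"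
    and "snd (snd (space_map z x)) = snd (snd x)"
    and "V \<in> windows \<Longrightarrow> intensity (space_map z ` V) = intensity V"
proof -
  have "inj (map_sum (\<lambda>i. i - z) (\<lambda>i. i - z))" by (rule sum.inj_map) (auto simp: inj_on_def)
  then show "inj (space_map z)"
    unfolding space_map_def by (auto simp: inj_on_def)
  show "snd (snd (space_map z x)) = snd (snd x)" unfolding space_map_def by (simp add: split_beta)
  assume "V \<in> windows"
  then obtain p B where V: "V = {p} \<times> B" and B: "B \<in> sets borel" "bounded B" by (elim windowsE)
  have img: "space_map z ` V = {map_sum (\<lambda>i. i - z) (\<lambda>i. i - z) p} \<times> B"
    unfolding V space_map_def by force
  show "space_map z ` V \<in> windows" unfolding img using B by (intro windowsI)
  show "intensity (space_map z ` V) = intensity V"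
    unfolding img unfolding V by (cases p) (simp_all only: map_sum.simps intensity_window)
qed

lemma shift_measurable: "shift_pattern v \<in> pats \<rightarrow>\<^sub>M pats"
  using preimage_pattern_measurable(1)[OF time_map_props(1-3)[where v = v]] unfolding shift_pattern_eq[abs_def] .

lemma shift_law: "distr M pats (\<lambda>\<omega>. shift_pattern v (drive \<omega>)) = distr M pats drive"
  using preimage_pattern_law[OF time_map_props[where v = v]] unfolding shift_pattern_eq .

lemma translate_measurable: "translate_pattern z \<in> pats \<rightarrow>\<^sub>M pats"
  using preimage_pattern_measurable(1)[OF space_map_props(1-3)[where z = z]] unfolding translate_pattern_eq[abs_def] .

lemma translate_law: "distr M pats (\<lambda>\<omega>. translate_pattern z (drive \<omega>)) = distr M pats drive"
  using preimage_pattern_law[OF space_map_props[where z = z]] unfolding translate_pattern_eq .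

lemma splice_halves:
  "splice_at_zero g g' \<inter> V = (g \<inter> (V \<inter> {(p, t, U). t \<le> 0})) \<union> (g' \<inter> (V \<inter> {(p, t, U). 0 < t}))"
  unfolding splice_at_zero_def by auto

lemma splice_measurable: "(\<lambda>(g, g'). splice_at_zero g g') \<in> pats \<Otimes>\<^sub>M pats \<rightarrow>\<^sub>M pats"
proof (rule measurable_patternsI)
  fix x assume "x \<in> space (pats \<Otimes>\<^sub>M pats)"
  then have x: "fst x \<in> pattern_space top_mark" "snd x \<in> pattern_space top_mark"
    by (auto simp: space_pair_measure)
  have "finite (splice_at_zero (fst x) (snd x) \<inter> V)" if "V \<in> windows" for V
    unfolding splice_halves using x window_halves[OF that] half_windows_subset
    by (blast intro: finite_pattern)
  moreover have "0 \<le> U \<and> U \<le> top_mark" if "(p, t, U) \<in> splice_at_zero (fst x) (snd x)" for p t U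
    using that x unfolding splice_at_zero_def pattern_space_def by (auto split: if_splits)
  ultimately show "(case x of (g, g') \<Rightarrow> splice_at_zero g g') \<in> pattern_space top_mark"
    unfolding pattern_space_def by (auto simp: split_beta)
next
  fix V :: "'d pattern" assume V: "V \<in> windows"
  let ?N = "V \<inter> {(p, t, U). t \<le> 0}" and ?P = "V \<inter> {(p, t, U). 0 < t}"
  have w: "?N \<in> windows" "?P \<in> windows" using window_halves[OF V] half_windows_subset by auto
  have "(\<lambda>x. card (fst x \<inter> ?N) + card (snd x \<inter> ?P)) \<in> pats \<Otimes>\<^sub>M pats \<rightarrow>\<^sub>M count_space UNIV"
    using measurable_compose[OF measurable_fst measurable_count[OF w(1)]]
      measurable_compose[OF measurable_snd measurable_count[OF w(2)]] by measurable
  moreover have "card ((case x of (g, g') \<Rightarrow> splice_at_zero g g') \<inter> V) = card (fst x \<inter> ?N) + card (snd x \<inter> ?P)"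
    if "x \<in> space (pats \<Otimes>\<^sub>M pats)" for x
  proof -
    have "fst x \<in> pattern_space top_mark" "snd x \<in> pattern_space top_mark"
      using that by (auto simp: space_pair_measure)
    then have "finite (fst x \<inter> ?N)" "finite (snd x \<inter> ?P)" using w by (auto intro!: finite_pattern)
    then show ?thesis unfolding split_beta splice_halves by (intro card_Un_disjoint) auto
  qed
  ultimately show "(\<lambda>x. card ((case x of (g, g') \<Rightarrow> splice_at_zero g g') \<inter> V)) \<in> pats \<Otimes>\<^sub>M pats \<rightarrow>\<^sub>M count_space UNIV"
    by (subst measurable_cong) auto
qed

text \<open>This is how the independence of the atoms before and after time \<open>0\<close> is used.\<close>
theorem splice_law:
  "distr (M \<Otimes>\<^sub>M M) pats (\<lambda>(\<omega>, \<omega>'). splice_at_zero (drive \<omega>) (drive \<omega>')) = distr M pats drive"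
proof -
  interpret MM: pair_prob_space M M ..
  have sp: "(\<lambda>(\<omega>, \<omega>'). splice_at_zero (drive \<omega>) (drive \<omega>')) \<in> M \<Otimes>\<^sub>M M \<rightarrow>\<^sub>M pats"
  proof -
    have "(\<lambda>x. (drive (fst x), drive (snd x))) \<in> M \<Otimes>\<^sub>M M \<rightarrow>\<^sub>M pats \<Otimes>\<^sub>M pats"
      using drive_measurable by measurable
    from measurable_compose[OF this splice_measurable] show ?thesis by (simp add: split_beta')
  qed
  show ?thesis
  proof (rule pattern_law_eqI[OF MM.prob_space_axioms prob_space_axioms sp drive_measurable])
    fix n :: nat and V :: "nat \<Rightarrow> 'd pattern" and c
    assume V: "\<And>k. k < n \<Longrightarrow> V k \<in> half_windows" and d: "disjoint_family_on V {..<n}"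
    have V': "V k \<in> windows" if "k < n" for k using V[OF that] half_windows_subset by blast
    \<comment> \<open>Each half window is wholly past or wholly future; an empty one is counted as
      past. The past windows then read only the first pattern and the others only the
      second.\<close>
    define K where "K = {k. k < n \<and> V k \<subseteq> {(p, t, U). t \<le> 0}}"
    define L where "L = {..<n} - K"
    have KL: "finite K" "finite L" "K \<inter> L = {}" "K \<union> L = {..<n}" unfolding K_def L_def by auto
    have past: "card (splice_at_zero g g' \<inter> V k) = card (g \<inter> V k)" if "k \<in> K" for g g' k
      using that unfolding K_def splice_at_zero_def by (intro arg_cong[where f = card]) auto
    have future: "card (splice_at_zero g g' \<inter> V k) = card (g' \<inter> V k)" if "k \<in> L" for g g' k
    proof -
      have "k < n" "\<not> V k \<subseteq> {(p, t, U). t \<le> 0}" using that unfolding K_def L_def by auto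
      then have "\<forall>(p, t, U)\<in>V k. 0 < t" using V[of k] unfolding half_windows_def by auto
      then show ?thesis unfolding splice_at_zero_def by (intro arg_cong[where f = card]) force
    qed
    let ?E = "\<lambda>K. {\<omega> \<in> space M. \<forall>k\<in>K. card (drive \<omega> \<inter> V k) = c k}"
    have E_sets: "?E J \<in> sets M" if "J \<subseteq> {..<n}" for J
    proof (rule sets.sets_Collect_finite_All)
      show "finite J" using that finite_subset by blast
      fix k assume "k \<in> J"
      then have "V k \<in> windows" using V' that by auto
      from measurable_sets[OF drive_count_measurable[OF this], of "{c k}"]
      have "(\<lambda>\<omega>. card (drive \<omega> \<inter> V k)) -` {c k} \<inter> space M \<in> sets M" by simp
      also have "(\<lambda>\<omega>. card (drive \<omega> \<inter> V k)) -` {c k} \<inter> space M = {\<omega> \<in> space M. card (drive \<omega> \<inter> V k) = c k}" by auto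
      finally show "{\<omega> \<in> space M. card (drive \<omega> \<inter> V k) = c k} \<in> sets M" .
    qed
    have fdd: "prob (?E J) = (\<Prod>k\<in>J. poisson_weight (intensity (V k)) (c k))" if "J \<subseteq> {..<n}" for J
      using that V' disjoint_family_on_mono[OF that d] finite_subset[OF that] by (intro drive_fdd) auto
    have "{x \<in> space (M \<Otimes>\<^sub>M M). \<forall>k<n. card ((case x of (\<omega>, \<omega>') \<Rightarrow> splice_at_zero (drive \<omega>) (drive \<omega>')) \<inter> V k) = c k}
        = ?E K \<times> ?E L"
    proof -
      have "(\<forall>k<n. card (splice_at_zero g g' \<inter> V k) = c k) \<longleftrightarrow>
          (\<forall>k\<in>K. card (g \<inter> V k) = c k) \<and> (\<forall>k\<in>L. card (g' \<inter> V k) = c k)" for g g'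
      proof -
        have "(\<forall>k<n. card (splice_at_zero g g' \<inter> V k) = c k) \<longleftrightarrow> (\<forall>k\<in>K \<union> L. card (splice_at_zero g g' \<inter> V k) = c k)"
          unfolding KL(4) by blast
        then show ?thesis using past future by (simp add: ball_Un)
      qed
      note split = this
      show ?thesis
      proof (rule set_eqI)
        fix x :: "'w \<times> 'w"
        obtain \<omega> \<omega>' where x: "x = (\<omega>, \<omega>')" by (cases x)
        show "x \<in> {x \<in> space (M \<Otimes>\<^sub>M M). \<forall>k<n. card ((case x of (\<omega>, \<omega>') \<Rightarrow> splice_at_zero (drive \<omega>) (drive \<omega>')) \<inter> V k) = c k}
            \<longleftrightarrow> x \<in> ?E K \<times> ?E L"
          unfolding x space_pair_measure mem_Collect_eq prod.case split mem_Sigma_iff by blast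
      qed
    qed
    then have "measure (M \<Otimes>\<^sub>M M) {x \<in> space (M \<Otimes>\<^sub>M M). \<forall>k<n. card ((case x of (\<omega>, \<omega>') \<Rightarrow> splice_at_zero (drive \<omega>) (drive \<omega>')) \<inter> V k) = c k}
        = prob (?E K) * prob (?E L)"
    proof -
      have "K \<subseteq> {..<n}" "L \<subseteq> {..<n}" using KL(4) by auto
      from emeasure_pair_measure_Times[OF E_sets[OF this(1)] E_sets[OF this(2)]] \<open>_ = ?E K \<times> ?E L\<close>
      show ?thesis by (simp only: measure_def enn2real_mult)
    qed
    also have "\<dots> = (\<Prod>k\<in>K \<union> L. poisson_weight (intensity (V k)) (c k))"
    proof -
      have "K \<subseteq> {..<n}" "L \<subseteq> {..<n}" using KL(4) by auto
      then show ?thesis unfolding prod.union_disjoint[OF KL(1-3)] by (simp only: fdd)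
    qed
    also have "\<dots> = prob {\<omega> \<in> space M. \<forall>k<n. card (drive \<omega> \<inter> V k) = c k}"
      unfolding KL(4) using V' d by (intro drive_fdd_lessThan[symmetric]) auto
    finally show "measure (M \<Otimes>\<^sub>M M) {x \<in> space (M \<Otimes>\<^sub>M M). \<forall>k<n. card ((case x of (\<omega>, \<omega>') \<Rightarrow> splice_at_zero (drive \<omega>) (drive \<omega>')) \<inter> V k) = c k}
        = prob {\<omega> \<in> space M. \<forall>k<n. card (drive \<omega> \<inter> V k) = c k}" .
  qed
qed

end

section \<open>Almost sure well-definedness and measurability\<close>

text \<open>Replacing (n + k)! by k! leaves \<open>\<theta> ^ n\<close> times a full exponential
  series. The geometric form of the bound lets tails of several processes be multiplied by adding
  exponents.\<close>

lemma (in prob_space) poisson_tail: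
  fixes N :: "'a \<Rightarrow> nat"
  assumes N: "N \<in> M \<rightarrow>\<^sub>M count_space UNIV" and "0 \<le> \<theta>"
    and law: "\<And>k. prob {\<omega> \<in> space M. N \<omega> = k} = poisson_weight \<theta> k"
  shows "prob {\<omega> \<in> space M. n \<le> N \<omega>} \<le> \<theta> ^ n"
proof -
  define F where "F = (\<lambda>k. {\<omega> \<in> space M. N \<omega> = n + k})"
  have F: "range F \<subseteq> sets M"
  proof
    fix X assume "X \<in> range F"
    then obtain k where "X = N -` {n + k} \<inter> space M" unfolding F_def by auto
    then show "X \<in> sets M" using measurable_sets[OF N] by simp
  qed
  have "disjoint_family F" unfolding F_def disjoint_family_on_def by auto
  then have sums: "(\<lambda>k. prob (F k)) sums prob (\<Union>k. F k)" by (rule finite_measure_UNION[OF F])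
  have "(\<Union>k. F k) = {\<omega> \<in> space M. n \<le> N \<omega>}"
    unfolding F_def by (auto simp: le_iff_add)
  with sums have sums': "(\<lambda>k. poisson_weight \<theta> (n + k)) sums prob {\<omega> \<in> space M. n \<le> N \<omega>}"
    unfolding F_def law by simp
  have "(\<lambda>k. \<theta> ^ k /\<^sub>R fact k) sums exp \<theta>" by (rule exp_converges)
  then have "(\<lambda>k. (\<theta> ^ n * exp (- \<theta>)) * (\<theta> ^ k /\<^sub>R fact k)) sums ((\<theta> ^ n * exp (- \<theta>)) * exp \<theta>)"
    by (rule sums_mult)
  moreover have "poisson_weight \<theta> (n + k) \<le> (\<theta> ^ n * exp (- \<theta>)) * (\<theta> ^ k /\<^sub>R fact k)" for k
  proof -
    have "(fact k :: real) \<le> fact (n + k)" by (rule fact_mono) simp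
    then have "\<theta> ^ (n + k) / fact (n + k) \<le> \<theta> ^ (n + k) / fact k"
      using \<open>0 \<le> \<theta>\<close> by (intro divide_left_mono) auto
    then have "\<theta> ^ (n + k) / fact (n + k) * exp (- \<theta>) \<le> \<theta> ^ (n + k) / fact k * exp (- \<theta>)"
      by (rule mult_right_mono) simp
    then show ?thesis unfolding poisson_weight_def by (simp add: power_add field_simps)
  qed
  ultimately have "prob {\<omega> \<in> space M. n \<le> N \<omega>} \<le> (\<theta> ^ n * exp (- \<theta>)) * exp \<theta>"
    by (intro sums_le[OF _ sums'])
  then show ?thesis by (simp add: mult.assoc mult_exp_exp)
qed

section \<open>Chains of influence inside one time slab\<close>

context network
begin

definition site :: "'d process \<Rightarrow> int ^ 'd" where
  "site = case_sum id id"

definition parents :: "'d process \<Rightarrow> 'd process set" where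
  "parents p = {q. 0 < a (site p - site q)}"

primrec paths :: "nat \<Rightarrow> 'd process \<Rightarrow> 'd process list set" where
  "paths 0 p = {[p]}"
| "paths (Suc n) p = (\<Union>q\<in>parents p. Cons p ` paths n q)"

text \<open>The factor 2 arises because each neighbouring site contributes an arrival and a service
  process.\<close>

definition branching :: nat where
  "branching = 2 * card {i. 0 < a i}"

text \<open>Chosen so that \<open>branching\<close> times the bound
  \<open>(lam + top_mark) * mesh\<close> on the mean count of a slab equals 1/2.\<close>

definition mesh :: real where
  "mesh = 1 / (2 * real branching * (lam + top_mark))"

definition slab :: "'d process \<Rightarrow> int \<Rightarrow> 'd pattern" where
  "slab p k = {p} \<times> ({of_int k * mesh<..of_int (k + 1) * mesh} \<times> {0..top_mark})"

text \<open>A weakening of "the slab contains a chain of atoms along \<open>ps\<close>": it forgets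
  the time order and only asks that each process has as many atoms as it has occurrences in
  \<open>ps\<close>. These demands concern distinct, hence independent, processes.\<close>

definition chain_event ::
  "'d pattern \<Rightarrow> int \<Rightarrow> 'd process list \<Rightarrow> bool" where
  "chain_event g k ps \<longleftrightarrow> (\<forall>q\<in>set ps. count_list ps q \<le> card (g \<inter> slab q k))"

text \<open>
  In a time slab of width \<^term>\<open>mesh\<close> the expected number of chains of atoms, each a possible
  cause of the preceding one, decays geometrically with their length; so backward explorations stop.
\<close>
definition good :: "'d pattern set" where
  "good = {g \<in> pattern_space top_mark. \<forall>k p. \<exists>n. \<forall>ps\<in>paths n p. \<not> chain_event g k ps}"

lemma finite_parents: "finite (parents p)" and card_parents: "card (parents p) \<le> branching"
proof -
  let ?N = "{j. 0 < a (site p - j)}"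
  have eq: "parents p = Inl ` ?N \<union> Inr ` ?N"
    unfolding parents_def site_def by (auto simp: image_iff split: sum.splits) (metis sum.exhaust old.sum.simps(5,6) id_apply)+
  have fin: "finite ?N" by (rule finite_neighbours)
  then show "finite (parents p)" unfolding eq by simp
  have "card ?N \<le> card {i. 0 < a i}"
  proof (rule card_inj_on_le[OF _ _ finite_support])
    show "inj_on (\<lambda>j. site p - j) ?N" by (auto simp: inj_on_def)
  qed auto
  moreover have "card (parents p) \<le> card (Inl ` ?N :: 'd process set) + card (Inr ` ?N :: 'd process set)"
    unfolding eq by (rule card_Un_le)
  ultimately show "card (parents p) \<le> branching"
    using card_image_le[OF fin, of "Inl :: _ \<Rightarrow> 'd process"]
      card_image_le[OF fin, of "Inr :: _ \<Rightarrow> 'd process"]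
    unfolding branching_def by linarith
qed

lemma branching_pos: "0 < branching"
  unfolding branching_def using finite_support a_zero by (auto simp: card_gt_0_iff)

lemma rate_pos: "0 < lam + top_mark"
  using lam_pos top_mark_pos by simp

lemma mesh_pos: "0 < mesh"
  unfolding mesh_def using branching_pos rate_pos by simp

lemma paths_props: "finite (paths n p)" "card (paths n p) \<le> branching ^ n" "ps \<in> paths n p \<Longrightarrow> length ps = Suc n"
proof (induction n arbitrary: p ps)
  case (Suc n)
  { case 1 show ?case using Suc finite_parents by simp }
  { case 2
    have "card (paths (Suc n) p) \<le> (\<Sum>q\<in>parents p. card (Cons p ` paths n q))"
      unfolding paths.simps by (rule card_UN_le[OF finite_parents])
    also have "\<dots> \<le> (\<Sum>q\<in>parents p. branching ^ n)"
      using Suc by (intro sum_mono) (meson card_image_le order_trans)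
    also have "\<dots> \<le> branching * branching ^ n" using card_parents by simp
    finally show ?case by simp }
  { case 3 then show ?case using Suc by auto }
qed auto

lemma path_map: "(\<And>m. f (Suc m) \<in> parents (f m)) \<Longrightarrow> map f [0..<Suc n] \<in> paths n (f 0)"
proof (induction n arbitrary: f)
  case (Suc n)
  have "map (\<lambda>m. f (Suc m)) [0..<Suc n] \<in> paths n (f (Suc 0))" by (rule Suc.IH) (rule Suc.prems)
  moreover have "map f [0..<Suc (Suc n)] = f 0 # map (\<lambda>m. f (Suc m)) [0..<Suc n]"
    by (simp only: upt_conv_Cons[of 0 "Suc (Suc n)"] map_Suc_upt[symmetric] list.map map_map comp_def)
  ultimately show ?case using Suc.prems[of 0] by (auto simp del: upt_Suc)
qed simp

lemma slab_window: "slab p k \<in> windows"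
  unfolding slab_def
proof (rule windowsI)
  show "{of_int k * mesh<..of_int (k + 1) * mesh} \<times> {0..top_mark} \<in> sets borel"
    by (intro borel_Times) auto
  show "bounded ({of_int k * mesh<..of_int (k + 1) * mesh} \<times> {0..top_mark})"
    by (intro bounded_Times) auto
qed

lemma intensity_rectangle:
  assumes "u \<le> v" "0 \<le> r" "r \<le> top_mark"
  shows "intensity ({Inl i} \<times> ({u<..v} \<times> {0..r})) = lam * (v - u)"
    "intensity ({Inr i} \<times> ({u<..v} \<times> {0..r})) = (v - u) * r"
proof -
  have "{t. (t, 0) \<in> {u<..v} \<times> {0..r}} = {u<..v}" using assms by auto
  then show "intensity ({Inl i} \<times> ({u<..v} \<times> {0..r})) = lam * (v - u)"
    unfolding intensity_window using assms by simp
  have "{u<..v} \<times> {0..r} \<inter> UNIV \<times> {0..top_mark} = {u<..v} \<times> {0..r}" using assms by auto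
  moreover have "measure lborel ({u<..v} \<times> {0..r}) = (v - u) * r"
  proof -
    have "emeasure (lborel \<Otimes>\<^sub>M lborel) ({u<..v} \<times> {0..r}) = emeasure lborel {u<..v} * emeasure lborel {0..r}"
      by (rule lborel.emeasure_pair_measure_Times) auto
    then show ?thesis using assms
      unfolding lborel_prod measure_def by (simp add: ennreal_mult[symmetric])
  qed
  ultimately show "intensity ({Inr i} \<times> ({u<..v} \<times> {0..r})) = (v - u) * r"
    unfolding intensity_window by simp
qed

lemma intensity_slab: "0 \<le> intensity (slab p k)" "intensity (slab p k) \<le> (lam + top_mark) * mesh"
proof -
  have "of_int (k + 1) * mesh - of_int k * mesh = mesh" by (simp add: algebra_simps)
  moreover have "of_int k * mesh \<le> of_int (k + 1) * mesh" using mesh_pos by (simp add: algebra_simps)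
  ultimately have "intensity (slab p k) = (case p of Inl _ \<Rightarrow> lam * mesh | Inr _ \<Rightarrow> mesh * top_mark)"
    unfolding slab_def using top_mark_pos intensity_rectangle[of "of_int k * mesh" "of_int (k + 1) * mesh" top_mark]
    by (cases p) auto
  then show "0 \<le> intensity (slab p k)" "intensity (slab p k) \<le> (lam + top_mark) * mesh"
    using mesh_pos lam_pos top_mark_pos by (auto split: sum.splits simp: algebra_simps)
qed

lemma window_count_law:
  assumes "V \<in> windows"
  shows "prob {\<omega> \<in> space M. card (drive \<omega> \<inter> V) = k} = poisson_weight (intensity V) k"
  using drive_fdd[of "{0}" "\<lambda>_. V" "\<lambda>_. k"] assms by (simp add: disjoint_family_on_def)

lemma tail_event:
  assumes B: "B \<in> sets borel" "bounded B"
  shows "{\<omega> \<in> space M. n \<le> card (drive \<omega> \<inter> {p} \<times> B)} \<in> events_of p"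
proof -
  have "(\<lambda>\<omega>. card (drive \<omega> \<inter> {p} \<times> B)) \<in> sigma (space M) (events_of p) \<rightarrow>\<^sub>M count_space UNIV"
  proof (subst measurable_count_space_eq2_countable, intro conjI ballI)
    fix n
    have "(\<lambda>\<omega>. card (drive \<omega> \<inter> {p} \<times> B)) -` {n} \<inter> space (sigma (space M) (events_of p)) =
        {\<omega> \<in> space M. card (drive \<omega> \<inter> {p} \<times> B) = n}"
      by (auto simp: events_of_sigma)
    then show "(\<lambda>\<omega>. card (drive \<omega> \<inter> {p} \<times> B)) -` {n} \<inter> space (sigma (space M) (events_of p))
        \<in> sets (sigma (space M) (events_of p))" using count_event[OF B, of p n] by (simp add: events_of_sigma)
  qed auto
  from measurable_sets[OF this, of "{n..}"]
  have "(\<lambda>\<omega>. card (drive \<omega> \<inter> {p} \<times> B)) -` {n..} \<inter> space M \<in> events_of p"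
    by (simp add: events_of_sigma)
  also have "(\<lambda>\<omega>. card (drive \<omega> \<inter> {p} \<times> B)) -` {n..} \<inter> space M =
      {\<omega> \<in> space M. n \<le> card (drive \<omega> \<inter> {p} \<times> B)}" by auto
  finally show ?thesis .
qed

text \<open>Independence gives a product over the distinct processes of the path; each factor is a
  Poisson tail whose exponent is a multiplicity, and the multiplicities add up to the
  length.\<close>

lemma prob_chain_event:
  "prob {\<omega> \<in> space M. chain_event (drive \<omega>) k ps} \<le> ((lam + top_mark) * mesh) ^ length ps"
proof -
  let ?r = "(lam + top_mark) * mesh"
  let ?F = "\<lambda>q. {\<omega> \<in> space M. count_list ps q \<le> card (drive \<omega> \<inter> slab q k)}"
  have F: "?F q \<in> events_of q" for q
    unfolding slab_def by (rule tail_event) (auto intro!: borel_Times bounded_Times)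
  have "{\<omega> \<in> space M. chain_event (drive \<omega>) k ps} = {\<omega> \<in> space M. \<forall>q\<in>set ps. \<omega> \<in> ?F q}"
    unfolding chain_event_def by blast
  then have "prob {\<omega> \<in> space M. chain_event (drive \<omega>) k ps} = (\<Prod>q\<in>set ps. prob (?F q))"
    using indep_events_of[of "set ps" ?F] F by simp
  also have "\<dots> \<le> (\<Prod>q\<in>set ps. ?r ^ count_list ps q)"
  proof (intro prod_mono conjI measure_nonneg)
    fix q
    have "prob (?F q) \<le> intensity (slab q k) ^ count_list ps q"
      by (rule poisson_tail[OF drive_count_measurable[OF slab_window] intensity_slab(1) window_count_law[OF slab_window]])
    also have "\<dots> \<le> ?r ^ count_list ps q" by (rule power_mono[OF intensity_slab(2,1)])
    finally show "prob (?F q) \<le> ?r ^ count_list ps q" .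
  qed
  also have "\<dots> = ?r ^ (\<Sum>q\<in>set ps. count_list ps q)" by (rule power_sum[symmetric])
  also have "(\<Sum>q\<in>set ps. count_list ps q) = length ps" by (rule sum_count_set) auto
  finally show ?thesis .
qed

lemma chain_event_sets: "{g \<in> pattern_space top_mark. chain_event g k ps} \<in> sets pats"
proof -
  have "{g \<in> space pats. \<forall>q\<in>set ps. count_list ps q \<le> card (g \<inter> slab q k)} \<in> sets pats"
  proof (rule sets.sets_Collect_finite_All)
    fix q
    from measurable_sets[OF measurable_count[OF slab_window[of q k]], of "{count_list ps q..}" top_mark]
    have "(\<lambda>g. card (g \<inter> slab q k)) -` {count_list ps q..} \<inter> space pats \<in> sets pats" by simp
    also have "(\<lambda>g. card (g \<inter> slab q k)) -` {count_list ps q..} \<inter> space pats =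
        {g \<in> space pats. count_list ps q \<le> card (g \<inter> slab q k)}" by auto
    finally show "{g \<in> space pats. count_list ps q \<le> card (g \<inter> slab q k)} \<in> sets pats" .
  qed simp
  then show ?thesis unfolding chain_event_def by simp
qed

lemma good_sets: "good \<in> sets pats"
proof -
  have "{g \<in> space pats. \<forall>k p. \<exists>n. \<forall>ps\<in>paths n p. \<not> chain_event g k ps} \<in> sets pats"
    by (intro sets.sets_Collect_countable_All sets.sets_Collect_countable_Ex
        sets.sets_Collect_finite_All sets.sets_Collect_neg paths_props)
      (use chain_event_sets in simp)
  then show ?thesis unfolding good_def by simp
qed

text \<open>A union bound: at most \<open>branching ^ n\<close> paths, each of probability at most
  \<open>?r ^ Suc n\<close>, give \<open>?r / 2 ^ n\<close> by the choice of \<open>mesh\<close>. So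
  for one slab and one starting process, paths of every length occur with probability 0, and there
  are countably many such pairs.\<close>

theorem AE_good: "AE \<omega> in M. drive \<omega> \<in> good"
proof -
  let ?r = "(lam + top_mark) * mesh"
  let ?C = "\<lambda>k n p. {\<omega> \<in> space M. \<exists>ps\<in>paths n p. chain_event (drive \<omega>) k ps}"
  have C1: "{\<omega> \<in> space M. chain_event (drive \<omega>) k ps} \<in> sets M" for k ps
  proof -
    have "drive -` {g \<in> pattern_space top_mark. chain_event g k ps} \<inter> space M \<in> sets M"
      by (rule measurable_sets[OF drive_measurable chain_event_sets])
    also have "drive -` {g \<in> pattern_space top_mark. chain_event g k ps} \<inter> space M =
        {\<omega> \<in> space M. chain_event (drive \<omega>) k ps}" using drive_space by auto
    finally show ?thesis .
  qed
  have C: "?C k n p \<in> sets M" for k n p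
    by (intro sets.sets_Collect_finite_Ex C1 paths_props)
  have br: "real branching * ?r = 1 / 2"
    unfolding mesh_def using branching_pos rate_pos by simp
  have bound: "prob (?C k n p) \<le> ?r * (1 / 2) ^ n" for k n p
  proof -
    have "?C k n p = (\<Union>ps\<in>paths n p. {\<omega> \<in> space M. chain_event (drive \<omega>) k ps})" by auto
    then have "prob (?C k n p) \<le> (\<Sum>ps\<in>paths n p. prob {\<omega> \<in> space M. chain_event (drive \<omega>) k ps})"
      using C1 by (simp add: finite_measure_subadditive_finite[OF paths_props(1)] image_subset_iff)
    also have "\<dots> \<le> (\<Sum>ps\<in>paths n p. ?r ^ Suc n)"
    proof (rule sum_mono)
      fix ps assume "ps \<in> paths n p"
      then show "prob {\<omega> \<in> space M. chain_event (drive \<omega>) k ps} \<le> ?r ^ Suc n"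
        using prob_chain_event[of k ps] by (simp only: paths_props(3))
    qed
    also have "\<dots> = real (card (paths n p)) * ?r ^ Suc n" by simp
    also have "\<dots> \<le> real (branching ^ n) * ?r ^ Suc n"
      using mesh_pos rate_pos by (intro mult_right_mono) (auto simp: paths_props simp del: of_nat_power)
    also have "\<dots> = ?r * (real branching * ?r) ^ n" by (simp add: power_mult_distrib)
    finally show ?thesis unfolding br .
  qed
  have "AE \<omega> in M. \<exists>n. \<forall>ps\<in>paths n p. \<not> chain_event (drive \<omega>) k ps" for k p
  proof (rule AE_I)
    let ?B = "\<Inter>n. ?C k n p"
    show "?B \<in> sets M" using C by (intro sets.countable_INT) auto
    show "{\<omega> \<in> space M. \<not> (\<exists>n. \<forall>ps\<in>paths n p. \<not> chain_event (drive \<omega>) k ps)} \<subseteq> ?B" by auto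
    have "prob ?B \<le> ?r * (1 / 2) ^ n" for n
      using finite_measure_mono[of ?B "?C k n p"] C[of n p k] bound[of n p k] by fastforce
    moreover have "(\<lambda>n. ?r * (1 / 2) ^ n) \<longlonglongrightarrow> ?r * 0"
      by (intro tendsto_mult tendsto_const LIMSEQ_power_zero) simp
    ultimately have "prob ?B \<le> 0" by (intro LIMSEQ_le_const[where X = "\<lambda>n. ?r * (1 / 2) ^ n"]) auto
    then show "emeasure M ?B = 0" using measure_nonneg[of M ?B] unfolding emeasure_eq_measure by (simp add: order_antisym)
  qed
  then have "AE \<omega> in M. \<forall>k p. \<exists>n. \<forall>ps\<in>paths n p. \<not> chain_event (drive \<omega>) k ps"
    unfolding AE_all_countable by blast
  then show ?thesis using AE_space by eventually_elim (simp add: good_def drive_space)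
qed

lemma pattern_events_finite:
  fixes g :: "'d pattern"
  assumes g: "g \<in> pattern_space top_mark"
  shows "finite (event_times (arrivals g) (services g) i \<inter> {u..v})"
proof -
  let ?W = "\<lambda>p :: 'd process. {p} \<times> ({u..v} \<times> {0..top_mark})"
  have W: "?W p \<in> windows" for p :: "'d process"
    by (intro windowsI borel_Times bounded_Times) auto
  have mark: "0 \<le> U \<and> U \<le> top_mark" if "(p, t, U) \<in> g" for p t U
    using g that unfolding pattern_space_def by blast
  have "event_times (arrivals g) (services g) i \<inter> {u..v} \<subseteq>
      (\<lambda>x. fst (snd x)) ` (g \<inter> ?W (Inl i)) \<union> (\<lambda>x. fst (snd x)) ` (g \<inter> ?W (Inr i))"
  proof
    fix t assume t: "t \<in> event_times (arrivals g) (services g) i \<inter> {u..v}"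
    then consider "(Inl i, t, 0) \<in> g" | U where "(Inr i, t, U) \<in> g"
      unfolding event_times_def arrivals_def services_def by auto
    then show "t \<in> (\<lambda>x. fst (snd x)) ` (g \<inter> ?W (Inl i)) \<union> (\<lambda>x. fst (snd x)) ` (g \<inter> ?W (Inr i))"
    proof cases
      case 1
      then show ?thesis using t mark[OF 1] by (intro UnI1 image_eqI[of _ _ "(Inl i, t, 0)"]) auto
    next
      case 2
      then show ?thesis using t mark[OF 2] by (intro UnI2 image_eqI[of _ _ "(Inr i, t, U)"]) auto
    qed
  qed
  moreover have "finite ((\<lambda>x. fst (snd x)) ` (g \<inter> ?W (Inl i)) \<union> (\<lambda>x. fst (snd x)) ` (g \<inter> ?W (Inr i)))"
    using finite_pattern[OF g W] by simp
  ultimately show ?thesis by (rule finite_subset)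
qed

text \<open>The times of an infinite backward chain decrease and are bounded below by
  \<open>s\<close>, so they converge. From some index on they lie in one slab, which then carries a
  chain event along arbitrarily long paths, contrary to \<open>good\<close>.\<close>

theorem good_driven:
  fixes g :: "'d pattern"
  assumes "g \<in> good"
  shows "driven a (arrivals g) (services g)"
proof unfold_locales
  have g: "g \<in> pattern_space top_mark" using assms unfolding good_def by simp
  show "finite (event_times (arrivals g) (services g) i \<inter> {u..v})" for i u v
    by (rule pattern_events_finite[OF g])
  show "wf (causal a (arrivals g) (services g) s)" for s
    unfolding wf_iff_no_infinite_down_chain
  proof
    assume "\<exists>f. \<forall>n. (f (Suc n), f n) \<in> causal a (arrivals g) (services g) s"
    then obtain f where f: "\<And>n. (f (Suc n), f n) \<in> causal a (arrivals g) (services g) s" by blast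
    define i where "i = (\<lambda>n. fst (f n))"
    define t where "t = (\<lambda>n. snd (f n))"
    have step: "s < t (Suc n)" "t (Suc n) < t n" "0 < a (i n - i (Suc n))"
      and ev: "t n \<in> event_times (arrivals g) (services g) (i n)" for n
      using f[of n] unfolding causal_def i_def t_def by (auto simp: split_beta)
    have "\<exists>p U. site p = i n \<and> (p, t n, U) \<in> g" for n
    proof -
      consider "(Inl (i n), t n, 0) \<in> g" | U where "(Inr (i n), t n, U) \<in> g"
        using ev[of n] unfolding event_times_def arrivals_def services_def by auto
      then show ?thesis by cases (auto simp: site_def intro: exI[of _ "Inl (i n)"] exI[of _ "Inr (i n)"])
    qed
    then obtain p U where p: "\<And>n. site (p n) = i n" and pg: "\<And>n. (p n, t n, U n) \<in> g" by metis
    have dec: "strict_mono (\<lambda>n. - t n)" using step(2) by (simp add: strict_mono_Suc_iff)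
    have "decseq t" using step(2) by (intro decseq_SucI) (simp add: less_imp_le)
    moreover have "s \<le> t n" for n using step(1,2)[of n] by simp
    ultimately obtain l where l: "t \<longlonglongrightarrow> l" "\<And>n. l \<le> t n" using decseq_convergent[of t s] by metis
    \<comment> \<open>The times stay strictly above their limit, so the left-open slab containing
      the right neighbourhood of \<open>l\<close> catches the tail of the chain, even when
      \<open>l\<close> is an endpoint.\<close>
    have l_less: "l < t n" for n using l(2)[of "Suc n"] step(2)[of n] by simp
    define k where "k = \<lfloor>l / mesh\<rfloor>"
    have k: "of_int k * mesh \<le> l" "l < of_int (k + 1) * mesh"
      using floor_divide_lower[OF mesh_pos, of l] floor_divide_upper[OF mesh_pos, of l]
      unfolding k_def by (auto simp: algebra_simps)
    have "\<forall>\<^sub>F n in sequentially. t n < of_int (k + 1) * mesh" by (rule order_tendstoD(2)[OF l(1) k(2)])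
    then obtain N where N: "\<And>n. N \<le> n \<Longrightarrow> t n < of_int (k + 1) * mesh"
      unfolding eventually_sequentially by blast
    obtain n where n: "\<And>ps. ps \<in> paths n (p N) \<Longrightarrow> \<not> chain_event g k ps"
      using assms unfolding good_def by blast
    let ?ps = "map (\<lambda>m. p (N + m)) [0..<Suc n]"
    have "?ps \<in> paths n (p (N + 0))"
      by (rule path_map) (use step(3) in \<open>simp add: parents_def p\<close>)
    then have "\<not> chain_event g k ?ps" using n by simp
    moreover have "chain_event g k ?ps"
      unfolding chain_event_def
    proof
      fix q
      let ?I = "{m. m < Suc n \<and> p (N + m) = q}"
      have "count_list ?ps q = card {m. m < length ?ps \<and> q = ?ps ! m}"
        unfolding count_list_eq_length_filter length_filter_conv_card ..
      also have "{m. m < length ?ps \<and> q = ?ps ! m} = ?I"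
        by (auto simp del: upt_Suc)
      also have "card ?I \<le> card (g \<inter> slab q k)"
      \<comment> \<open>Times strictly decrease along the chain, so repeated visits to a process use
        different atoms.\<close>
      proof (rule card_inj_on_le)
        show "inj_on (\<lambda>m. (p (N + m), t (N + m), U (N + m))) ?I"
          using strict_mono_eq[OF dec] by (auto simp: inj_on_def)
        show "(\<lambda>m. (p (N + m), t (N + m), U (N + m))) ` ?I \<subseteq> g \<inter> slab q k"
        proof (rule image_subsetI)
          fix m assume "m \<in> ?I"
          moreover have "0 \<le> U (N + m) \<and> U (N + m) \<le> top_mark"
            using g pg[of "N + m"] unfolding pattern_space_def by blast
          ultimately show "(p (N + m), t (N + m), U (N + m)) \<in> g \<inter> slab q k"
            using pg[of "N + m"] N[of "N + m"] l_less[of "N + m"] k(1) unfolding slab_def by auto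
        qed
        show "finite (g \<inter> slab q k)" by (rule finite_pattern[OF g slab_window])
      qed
      finally show "count_list ?ps q \<le> card (g \<inter> slab q k)" .
    qed
    ultimately show False by contradiction
  qed
qed

text \<open>A version of \<open>evolve\<close> with a fixed default off the good patterns, where
  \<open>THE\<close> might give anything. It differs from \<open>evolve\<close> only on a null set
  and, unlike it, can be shown measurable.\<close>

definition flow ::
  "real \<Rightarrow> real \<Rightarrow> (int ^ 'd \<Rightarrow> nat) \<Rightarrow> 'd pattern \<Rightarrow> int ^ 'd \<Rightarrow> nat" where
  "flow s t \<xi> g = (if g \<in> good then evolve a (arrivals g) (services g) s \<xi> t else (\<lambda>_. 0))"

section \<open>Measurability of the flow in the initial state and the pattern\<close>

lemma arrivals_count_measurable:
  assumes "B \<in> sets borel" "bounded B"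
  shows "(\<lambda>g. card (arrivals g i \<inter> B)) \<in> pats \<rightarrow>\<^sub>M count_space UNIV"
proof -
  have "{Inl i :: 'd process} \<times> (B \<times> {0}) \<in> windows"
    using assms by (intro windowsI borel_Times bounded_Times) auto
  moreover have "card (arrivals g i \<inter> B) = card (g \<inter> {Inl i} \<times> (B \<times> {0}))" for g
  proof -
    have "g \<inter> {Inl i} \<times> (B \<times> {0}) = (\<lambda>t. (Inl i, t, 0)) ` (arrivals g i \<inter> B)"
      unfolding arrivals_def by auto
    then show ?thesis by (simp add: card_image inj_on_def)
  qed
  ultimately show ?thesis using measurable_count[of "{Inl i} \<times> (B \<times> {0})"] by simp
qed

text \<open>The threshold \<open>r\<close> will be a departure rate and so vary with the state,
  while measurability is known only for counts in fixed rectangles. Rational thresholds bridge this;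
  no atom is lost in the limit since finitely many marks lie over \<open>C\<close>.\<close>

lemma service_event_iff:
  fixes g :: "'d pattern"
  assumes g: "g \<in> pattern_space top_mark" and C: "C \<in> sets borel" "bounded C"
  shows "(\<exists>t U. (t, U) \<in> services g i \<and> t \<in> C \<and> U \<le> r) \<longleftrightarrow>
    (\<forall>q::rat. r < of_rat q \<longrightarrow> 0 < card (g \<inter> {Inr i} \<times> (C \<times> {0..of_rat q})))"
proof -
  have W: "{Inr i :: 'd process} \<times> (C \<times> {0..b}) \<in> windows" for b
    using C by (intro windowsI borel_Times bounded_Times) auto
  note fin = finite_pattern[OF g W]
  have mark: "0 \<le> U \<and> U \<le> top_mark" if "(p, t, U) \<in> g" for p t U
    using g that unfolding pattern_space_def by blast
  show ?thesis
  proof safe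
    fix t U q assume tU: "(t, U) \<in> services g i" "t \<in> C" "U \<le> r" "r < real_of_rat q"
    then have "(Inr i, t, U) \<in> g \<inter> {Inr i} \<times> (C \<times> {0..of_rat q})"
      using mark[of "Inr i" t U] unfolding services_def by auto
    then show "0 < card (g \<inter> {Inr i} \<times> (C \<times> {0..of_rat q}))"
      using fin by (auto simp: card_gt_0_iff)
  next
    assume pos: "\<forall>q. r < real_of_rat q \<longrightarrow> 0 < card (g \<inter> {Inr i} \<times> (C \<times> {0..of_rat q}))"
    show "\<exists>t U. (t, U) \<in> services g i \<and> t \<in> C \<and> U \<le> r"
    proof (rule ccontr)
      assume none: "\<nexists>t U. (t, U) \<in> services g i \<and> t \<in> C \<and> U \<le> r"
      \<comment> \<open>If all marks over \<open>C\<close> exceed \<open>r\<close>, so does the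
        least of them; \<open>r + 1\<close> covers the case of no atom. A rational strictly between
        \<open>r\<close> and this minimum contradicts \<open>pos\<close>.\<close>
      let ?F = "insert (r + 1) ((\<lambda>x. snd (snd x)) ` (g \<inter> {Inr i} \<times> (C \<times> {0..top_mark})))"
      have finF: "finite ?F" using fin by simp
      have "r < U" if "U \<in> ?F" for U
        using that none unfolding services_def by force
      then have "r < Min ?F" using Min_in[OF finF] by blast
      then obtain q where q: "r < real_of_rat q" "real_of_rat q < Min ?F" using of_rat_dense by blast
      then have "g \<inter> {Inr i} \<times> (C \<times> {0..of_rat q}) \<noteq> {}" using pos by force
      then obtain t U where tU: "(Inr i, t, U) \<in> g" "t \<in> C" "U \<le> of_rat q" by auto
      then have "U \<in> ?F" using mark[of "Inr i" t U] by (auto intro!: image_eqI[of _ _ "(Inr i, t, U)"])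
      then have "Min ?F \<le> U" by (rule Min_le[OF finF])
      then show False using q tU by simp
    qed
  qed
qed

lemma cell_borel: "cell s h k \<in> sets borel" "bounded (cell s h k)"
  unfolding cell_def by auto

lemma euler_measurable:
  "(\<lambda>x. euler a (arrivals (snd x)) (services (snd x)) s h (fst x) k i) \<in> config_space \<Otimes>\<^sub>M pats \<rightarrow>\<^sub>M count_space UNIV"
proof (induction k arbitrary: i)
  case 0
  have "(\<lambda>\<xi>. \<xi> i) \<in> config_space \<rightarrow>\<^sub>M count_space UNIV"
    unfolding config_space_def by (rule measurable_component_singleton) simp
  then show ?case by simp
next
  case (Suc k)
  let ?S = "config_space \<Otimes>\<^sub>M pats"
  let ?y = "\<lambda>x. euler a (arrivals (snd x)) (services (snd x)) s h (fst x) k"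
  note [measurable] = Suc.IH
  have [measurable]: "(\<lambda>x. card (arrivals (snd x) i \<inter> cell s h k)) \<in> ?S \<rightarrow>\<^sub>M count_space UNIV"
    by (rule measurable_compose[OF measurable_snd arrivals_count_measurable[OF cell_borel]])
  have rate [measurable]: "(\<lambda>x. departure_rate a (?y x) i) \<in> borel_measurable ?S"
    unfolding departure_rate_def by measurable
  have cnt [measurable]: "(\<lambda>x. card (snd x \<inter> {Inr i} \<times> (cell s h k \<times> {0..of_rat q}))) \<in> ?S \<rightarrow>\<^sub>M count_space UNIV" for q
    by (rule measurable_compose[OF measurable_snd measurable_count])
      (intro windowsI borel_Times bounded_Times cell_borel; simp)
  define Q where "Q = (\<lambda>x. \<forall>q::rat. departure_rate a (?y x) i < of_rat q \<longrightarrow>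
      0 < card (snd x \<inter> {Inr i} \<times> (cell s h k \<times> {0..of_rat q})))"
  have [measurable]: "Measurable.pred ?S Q" unfolding Q_def by measurable
  have "(\<lambda>x. ?y x i + card (arrivals (snd x) i \<inter> cell s h k) - (if 0 < ?y x i \<and> Q x then 1 else 0))
      \<in> ?S \<rightarrow>\<^sub>M count_space UNIV" by measurable
  moreover have "euler a (arrivals (snd x)) (services (snd x)) s h (fst x) (Suc k) i =
      ?y x i + card (arrivals (snd x) i \<inter> cell s h k) - (if 0 < ?y x i \<and> Q x then 1 else 0)"
    if "x \<in> space ?S" for x
  proof -
    have "snd x \<in> pattern_space top_mark" using that by (auto simp: space_pair_measure)
    from service_event_iff[OF this cell_borel] show ?thesis unfolding euler.simps Q_def by simp
  qed
  ultimately show ?case by (subst measurable_cong) auto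
qed

lemma measurable_config_iff:
  "f \<in> N \<rightarrow>\<^sub>M config_space \<longleftrightarrow> (\<forall>i. (\<lambda>x. f x i) \<in> N \<rightarrow>\<^sub>M count_space UNIV)"
proof
  assume f: "f \<in> N \<rightarrow>\<^sub>M config_space"
  show "\<forall>i. (\<lambda>x. f x i) \<in> N \<rightarrow>\<^sub>M count_space UNIV"
    using measurable_compose[OF f[unfolded config_space_def] measurable_component_singleton] by simp
next
  assume "\<forall>i. (\<lambda>x. f x i) \<in> N \<rightarrow>\<^sub>M count_space UNIV"
  then show "f \<in> N \<rightarrow>\<^sub>M config_space"
    unfolding config_space_def by (intro measurable_PiM_single') auto
qed

text \<open>At each coordinate the flow is the eventually constant limit of the Euler scheme, so its
  level sets are countable combinations of level sets of the scheme.\<close>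

theorem flow_measurable:
  assumes "s \<le> t"
  shows "(\<lambda>(\<xi>, g). flow s t \<xi> g) \<in> config_space \<Otimes>\<^sub>M pats \<rightarrow>\<^sub>M config_space"
  unfolding measurable_config_iff
proof
  fix i
  let ?S = "config_space \<Otimes>\<^sub>M pats"
  have good_S: "{x \<in> space ?S. snd x \<in> good} \<in> sets ?S"
  proof -
    have "snd -` good \<inter> space ?S \<in> sets ?S" by (rule measurable_sets[OF measurable_snd good_sets])
    also have "snd -` good \<inter> space ?S = {x \<in> space ?S. snd x \<in> good}" by auto
    finally show ?thesis .
  qed
  show "(\<lambda>x. (case x of (\<xi>, g) \<Rightarrow> flow s t \<xi> g) i) \<in> ?S \<rightarrow>\<^sub>M count_space UNIV"
  proof (cases "s = t")
    case True
    have "(case x of (\<xi>, g) \<Rightarrow> flow s t \<xi> g) i = (if snd x \<in> good then fst x i else 0)" for x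
      using driven.evolve_start[OF good_driven[of "snd x"]] True unfolding flow_def
      by (simp add: split_beta)
    moreover have "(\<lambda>x. if snd x \<in> good then fst x i else 0) \<in> ?S \<rightarrow>\<^sub>M count_space UNIV"
    proof (rule measurable_If[OF _ _ good_S])
      show "(\<lambda>x. fst x i) \<in> ?S \<rightarrow>\<^sub>M count_space UNIV"
        using euler_measurable[of s 1 0 i] by simp
    qed simp
    ultimately show ?thesis by simp
  next
    case False
    then have "s < t" using assms by simp
    let ?eu = "\<lambda>x m. euler a (arrivals (snd x)) (services (snd x)) s ((t - s) / real m) (fst x) m i"
    define L where "L = (\<lambda>x n. \<exists>N. \<forall>m\<ge>N. ?eu x m = (n::nat))"
    have L_sets: "{x \<in> space ?S. L x n} \<in> sets ?S" for n
    proof -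
      have "{x \<in> space ?S. ?eu x m = n} \<in> sets ?S" for m
      proof -
        have "(\<lambda>x. ?eu x m) -` {n} \<inter> space ?S \<in> sets ?S"
          by (rule measurable_sets[OF euler_measurable]) simp
        also have "(\<lambda>x. ?eu x m) -` {n} \<inter> space ?S = {x \<in> space ?S. ?eu x m = n}" by auto
        finally show ?thesis .
      qed
      then show ?thesis unfolding L_def
        by (intro sets.sets_Collect_countable_Ex sets.sets_Collect_countable_All sets.sets_Collect_imp)
          auto
    qed
    have L: "L x n \<longleftrightarrow> (case x of (\<xi>, g) \<Rightarrow> flow s t \<xi> g) i = n" if g: "snd x \<in> good" for x n
    proof -
      obtain N where N: "\<And>m. N \<le> m \<Longrightarrow> ?eu x m = evolve a (arrivals (snd x)) (services (snd x)) s (fst x) t i"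
        using driven.evolve_euler[OF good_driven[OF g] \<open>s < t\<close>, of "fst x" i]
        unfolding eventually_sequentially by blast
      have "L x n \<longleftrightarrow> evolve a (arrivals (snd x)) (services (snd x)) s (fst x) t i = n"
      proof
        assume "L x n"
        then obtain N' where "\<And>m. N' \<le> m \<Longrightarrow> ?eu x m = n" unfolding L_def by blast
        from this[of "max N N'"] N[of "max N N'"] show "evolve a (arrivals (snd x)) (services (snd x)) s (fst x) t i = n"
          by simp
      qed (use N in \<open>auto simp: L_def\<close>)
      then show ?thesis using g unfolding flow_def by (simp add: split_beta)
    qed
    show ?thesis
    proof (subst measurable_count_space_eq2_countable, intro conjI ballI)
      fix n :: nat
      \<comment> \<open>Off the good patterns the flow is 0, which adds their complement to the
        level set of \<open>n = 0\<close>.\<close>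
      have "(\<lambda>x. (case x of (\<xi>, g) \<Rightarrow> flow s t \<xi> g) i) -` {n} \<inter> space ?S =
          ({x \<in> space ?S. snd x \<in> good} \<inter> {x \<in> space ?S. L x n}) \<union>
          (if n = 0 then space ?S - {x \<in> space ?S. snd x \<in> good} else {})"
        using L by (auto simp: flow_def split: if_splits)
      then show "(\<lambda>x. (case x of (\<xi>, g) \<Rightarrow> flow s t \<xi> g) i) -` {n} \<inter> space ?S \<in> sets ?S"
        using good_S L_sets[of n] by auto
    qed auto
  qed
qed

end

section \<open>Moments of Poisson counts\<close>

lemma (in prob_space) nn_integral_count:
  fixes N :: "'a \<Rightarrow> nat"
  assumes N: "N \<in> M \<rightarrow>\<^sub>M count_space UNIV"
    and law: "\<And>k. prob {\<omega> \<in> space M. N \<omega> = k} = w k"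
    and f: "\<And>k. 0 \<le> f k" and S: "(\<lambda>k. f k * w k) sums S"
  shows "has_bochner_integral M (\<lambda>\<omega>. f (N \<omega>)) (S :: real)"
proof (rule has_bochner_integral_nn_integral)
  let ?A = "\<lambda>k. {\<omega> \<in> space M. N \<omega> = k}"
  have A: "?A k \<in> sets M" for k
  proof -
    have "?A k = N -` {k} \<inter> space M" by auto
    then show ?thesis using measurable_sets[OF N, of "{k}"] by simp
  qed
  have w: "0 \<le> w k" for k using measure_nonneg[of M "?A k"] unfolding law .
  show "(\<lambda>\<omega>. f (N \<omega>)) \<in> borel_measurable M" using N by measurable
  show "AE \<omega> in M. 0 \<le> f (N \<omega>)" using f by simp
  show "0 \<le> S" by (rule sums_le[OF _ sums_zero S]) (rule mult_nonneg_nonneg[OF f w])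
  have "(\<integral>\<^sup>+ \<omega>. ennreal (f (N \<omega>)) \<partial>M) = (\<integral>\<^sup>+ \<omega>. (\<Sum>k. ennreal (f k) * indicator (?A k) \<omega>) \<partial>M)"
  proof (rule nn_integral_cong)
    fix \<omega> assume "\<omega> \<in> space M"
    then have "(\<Sum>k. ennreal (f k) * indicator (?A k) \<omega>) = (\<Sum>k. if k = N \<omega> then ennreal (f (N \<omega>)) else 0)"
      by (intro suminf_cong) (auto simp: indicator_def)
    also have "\<dots> = ennreal (f (N \<omega>))" by (subst suminf_finite[of "{N \<omega>}"]) auto
    finally show "ennreal (f (N \<omega>)) = (\<Sum>k. ennreal (f k) * indicator (?A k) \<omega>)" ..
  qed
  also have "\<dots> = (\<Sum>k. \<integral>\<^sup>+ \<omega>. ennreal (f k) * indicator (?A k) \<omega> \<partial>M)"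
    using A by (intro nn_integral_suminf) auto
  also have "\<dots> = (\<Sum>k. ennreal (f k * w k))"
  proof (rule suminf_cong)
    fix k
    have "(\<integral>\<^sup>+ \<omega>. ennreal (f k) * indicator (?A k) \<omega> \<partial>M) = ennreal (f k) * emeasure M (?A k)"
      by (rule nn_integral_cmult_indicator[OF A])
    then show "(\<integral>\<^sup>+ \<omega>. ennreal (f k) * indicator (?A k) \<omega> \<partial>M) = ennreal (f k * w k)"
      unfolding emeasure_eq_measure law by (simp only: ennreal_mult[OF f w])
  qed
  also have "\<dots> = ennreal S"
  proof -
    have "(\<Sum>k. ennreal (f k * w k)) = ennreal (\<Sum>k. f k * w k)"
      by (rule suminf_ennreal2[OF _ sums_summable[OF S]]) (rule mult_nonneg_nonneg[OF f w])
    then show ?thesis by (simp only: sums_unique[OF S, symmetric])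
  qed
  finally show "(\<integral>\<^sup>+ \<omega>. ennreal (f (N \<omega>)) \<partial>M) = ennreal S" .
qed

lemma poisson_weight_sums: "poisson_weight \<theta> sums 1"
proof -
  have "(\<lambda>k. exp (- \<theta>) * (\<theta> ^ k /\<^sub>R fact k)) sums (exp (- \<theta>) * exp \<theta>)"
    by (rule sums_mult[OF exp_converges])
  then show ?thesis unfolding poisson_weight_def[abs_def] by (simp add: exp_minus field_simps)
qed

lemma poisson_weight_Suc: "real (Suc k) * poisson_weight \<theta> (Suc k) = \<theta> * poisson_weight \<theta> k"
  unfolding poisson_weight_def by (simp add: field_simps del: of_nat_Suc)

text \<open>The identity \<open>poisson_weight_Suc\<close> shifts the series by one index. The
  second moment is taken in factorial form because this is \<open>\<theta>\<^sup>2\<close>, of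
  second order in a short time, while the plain second moment is of first order.\<close>

lemma (in prob_space) poisson_moments:
  fixes N :: "'a \<Rightarrow> nat"
  assumes N: "N \<in> M \<rightarrow>\<^sub>M count_space UNIV"
    and law: "\<And>k. prob {\<omega> \<in> space M. N \<omega> = k} = poisson_weight \<theta> k"
  shows "has_bochner_integral M (\<lambda>\<omega>. real (N \<omega>)) \<theta>"
    and "has_bochner_integral M (\<lambda>\<omega>. real (N \<omega>) * (real (N \<omega>) - 1)) (\<theta>\<^sup>2)"
proof -
  have s0: "(\<lambda>k. \<theta> * poisson_weight \<theta> k) sums \<theta>" using sums_mult[OF poisson_weight_sums, of \<theta>] by simp
  then have "(\<lambda>k. real (Suc k) * poisson_weight \<theta> (Suc k)) sums \<theta>" by (simp only: poisson_weight_Suc)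
  then have s1: "(\<lambda>k. real k * poisson_weight \<theta> k) sums \<theta>"
    by (subst (asm) sums_Suc_iff) simp
  show "has_bochner_integral M (\<lambda>\<omega>. real (N \<omega>)) \<theta>"
    by (rule nn_integral_count[OF N law _ s1]) simp
  have "(\<lambda>k. \<theta> * (real k * poisson_weight \<theta> k)) sums (\<theta> * \<theta>)" by (rule sums_mult[OF s1])
  moreover have "\<theta> * (real k * poisson_weight \<theta> k) =
      real (Suc k) * (real (Suc k) - 1) * poisson_weight \<theta> (Suc k)" for k
  proof -
    have "\<theta> * (real k * poisson_weight \<theta> k) = real k * (\<theta> * poisson_weight \<theta> k)" by simp
    also have "\<dots> = real k * (real (Suc k) * poisson_weight \<theta> (Suc k))" by (simp only: poisson_weight_Suc)
    finally show ?thesis by (simp add: mult_ac)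
  qed
  ultimately have "(\<lambda>k. real (Suc k) * (real (Suc k) - 1) * poisson_weight \<theta> (Suc k)) sums (\<theta>\<^sup>2)"
    by (simp only: power2_eq_square)
  then have s2: "(\<lambda>k. real k * (real k - 1) * poisson_weight \<theta> k) sums (\<theta>\<^sup>2)"
    by (subst (asm) sums_Suc_iff) simp
  have "0 \<le> real k * (real k - 1)" for k by (cases k) auto
  then show "has_bochner_integral M (\<lambda>\<omega>. real (N \<omega>) * (real (N \<omega>) - 1)) (\<theta>\<^sup>2)"
    by (rule nn_integral_count[OF N law _ s2])
qed

section \<open>Short time increments\<close>

context network
begin

text \<open>Two steps of interference from the origin: the pair functional involves the queues at
  the support of \<open>a\<close>, and their departure rates involve the neighbours of that
  support.\<close>

definition near :: "(int ^ 'd) set" where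
  "near = (\<Union>i\<in>{i. 0 < a i}. {j. 0 < a (i - j)})"

definition near_processes :: "'d process set" where
  "near_processes = Inl ` near \<union> Inr ` near"

definition rect :: "real \<Rightarrow> 'd process \<Rightarrow> 'd pattern" where
  "rect h p = {p} \<times> ({0<..h} \<times> {0..top_mark})"

definition count :: "real \<Rightarrow> 'd process \<Rightarrow> 'w \<Rightarrow> nat" where
  "count h p \<omega> = card (drive \<omega> \<inter> rect h p)"

text \<open>With \<open>r\<close> a departure rate, these are the service atoms accepted if the rate
  is frozen during (0, h].\<close>

definition thinned :: "real \<Rightarrow> real \<Rightarrow> int ^ 'd \<Rightarrow> 'w \<Rightarrow> nat" where
  "thinned h r i \<omega> = card (drive \<omega> \<inter> {Inr i} \<times> ({0<..h} \<times> {0..r}))"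

definition total :: "real \<Rightarrow> 'w \<Rightarrow> nat" where
  "total h \<omega> = (\<Sum>p\<in>near_processes. count h p \<omega>)"

text \<open>With at most one nearby atom the first-order formulas are exact. With two or more, every
  quantity involved is bounded by the number of atoms or its square, so this single variable
  controls all discrepancies.\<close>

definition error :: "real \<Rightarrow> 'w \<Rightarrow> real" where
  "error h \<omega> = (if 2 \<le> total h \<omega> then (real (total h \<omega>))\<^sup>2 else 0)"

lemma near_finite: "finite near" "finite near_processes"
  unfolding near_processes_def near_def using finite_support finite_neighbours by auto

lemma near_self: "0 < a i \<Longrightarrow> i \<in> near"
  unfolding near_def using a_zero by (auto intro!: exI[of _ i])

lemma rect_window: "rect h p \<in> windows"
  unfolding rect_def by (intro windowsI borel_Times bounded_Times) auto

lemma thin_window: "{p} \<times> ({0<..h} \<times> {0..r::real}) \<in> windows"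
  by (intro windowsI borel_Times bounded_Times) auto

lemma count_measurable [measurable]: "count h p \<in> M \<rightarrow>\<^sub>M count_space UNIV"
  unfolding count_def[abs_def] by (rule drive_count_measurable[OF rect_window])

lemma total_measurable [measurable]: "total h \<in> M \<rightarrow>\<^sub>M count_space UNIV"
  unfolding total_def[abs_def] by measurable

lemma error_measurable [measurable]: "error h \<in> borel_measurable M"
  unfolding error_def[abs_def] by measurable

lemma thinned_measurable [measurable]: "thinned h r i \<in> M \<rightarrow>\<^sub>M count_space UNIV"
  unfolding thinned_def[abs_def] by (rule drive_count_measurable[OF thin_window])

lemma intensity_rect:
  assumes "0 < h"
  shows "intensity (rect h (Inl i)) = lam * h" "0 \<le> intensity (rect h p)"
    "intensity (rect h p) \<le> (lam + top_mark) * h"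
proof -
  have r: "intensity (rect h (Inl i)) = lam * h" "intensity (rect h (Inr i)) = h * top_mark" for i
    unfolding rect_def using intensity_rectangle[of 0 h top_mark] assms top_mark_pos by auto
  show "intensity (rect h (Inl i)) = lam * h" by (rule r)
  show "0 \<le> intensity (rect h p)" "intensity (rect h p) \<le> (lam + top_mark) * h"
    using r assms top_mark_pos lam_pos by (cases p; simp add: algebra_simps)+
qed

lemma count_moments:
  "has_bochner_integral M (\<lambda>\<omega>. real (count h p \<omega>)) (intensity (rect h p))"
  "has_bochner_integral M (\<lambda>\<omega>. real (count h p \<omega>) * (real (count h p \<omega>) - 1)) ((intensity (rect h p))\<^sup>2)"
  unfolding count_def
  by (rule poisson_moments[OF drive_count_measurable[OF rect_window] window_count_law[OF rect_window]])+

lemma thinned_mean: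
  assumes "0 < h" "0 \<le> r" "r \<le> top_mark"
  shows "has_bochner_integral M (\<lambda>\<omega>. real (thinned h r i \<omega>)) (h * r)"
proof -
  have "has_bochner_integral M (\<lambda>\<omega>. real (thinned h r i \<omega>)) (intensity ({Inr i} \<times> ({0<..h} \<times> {0..r})))"
    unfolding thinned_def
    by (rule poisson_moments(1)[OF drive_count_measurable[OF thin_window] window_count_law[OF thin_window]])
  then show ?thesis using intensity_rectangle(2)[of 0 h r i] assms by simp
qed

lemma prob_two_counts:
  assumes "0 < h" "p \<noteq> q"
  shows "prob {\<omega> \<in> space M. 1 \<le> count h p \<omega> \<and> 1 \<le> count h q \<omega>} \<le> ((lam + top_mark) * h)\<^sup>2"
proof -
  let ?F = "\<lambda>p. {\<omega> \<in> space M. 1 \<le> count h p \<omega>}"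
  have F: "?F p \<in> events_of p" for p
    unfolding count_def rect_def by (rule tail_event) (auto intro!: borel_Times bounded_Times)
  have b: "prob (?F p) \<le> (lam + top_mark) * h" for p
  proof -
    have "prob (?F p) \<le> intensity (rect h p) ^ 1"
      unfolding count_def
      by (rule poisson_tail[OF drive_count_measurable[OF rect_window] intensity_rect(2)[OF assms(1)] window_count_law[OF rect_window]])
    then show ?thesis using intensity_rect(3)[OF assms(1), of p] by simp
  qed
  have "{\<omega> \<in> space M. 1 \<le> count h p \<omega> \<and> 1 \<le> count h q \<omega>} = {\<omega> \<in> space M. \<forall>p\<in>{p, q}. \<omega> \<in> ?F p}"
    by auto
  then have "prob {\<omega> \<in> space M. 1 \<le> count h p \<omega> \<and> 1 \<le> count h q \<omega>} = prob (?F p) * prob (?F q)"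
    using indep_events_of[of "{p, q}" ?F] F assms(2) by simp
  also have "\<dots> \<le> ((lam + top_mark) * h) * ((lam + top_mark) * h)"
    using b assms(1) rate_pos by (intro mult_mono) (auto intro: less_imp_le)
  finally show ?thesis by (simp add: power2_eq_square)
qed

text \<open>In \<open>error_mean\<close>, one factor \<open>m\<close> comes from Cauchy-Schwarz, one
  from summing over the processes, and \<open>2 + m\<close> from bounding the mean of the variable
  \<open>Y\<close> there.\<close>

definition error_constant :: real where
  "error_constant = (let m = real (card near_processes) in m * (m * (2 + m)) * (lam + top_mark)\<^sup>2)"

text \<open>Two atoms in (0, h] come either from one process, which the second factorial moment
  measures, or from two independent processes. Either way the cost is of order
  \<open>h\<^sup>2\<close>.\<close>

theorem error_mean:
  assumes "0 < h"
  shows "integrable M (error h)" "expectation (error h) \<le> error_constant * h\<^sup>2"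
proof -
  let ?P = near_processes
  let ?m = "real (card ?P)"
  let ?t = "((lam + top_mark) * h)\<^sup>2"
  let ?I = "\<lambda>p q. {\<omega> \<in> space M. 1 \<le> count h p \<omega> \<and> 1 \<le> count h q \<omega>}"
  \<comment> \<open>Built to dominate the squared count c of process \<open>p\<close> when there are
    at least two atoms in total: if c is at least 2, then c^2 is at most 2 c (c - 1); if c = 1,
    another process has an atom and an indicator equals 1.\<close>
  define Y where "Y = (\<lambda>p \<omega>. 2 * (real (count h p \<omega>) * (real (count h p \<omega>) - 1)) +
      (\<Sum>q\<in>?P - {p}. indicator (?I p q) \<omega>))"
  have I_sets: "?I p q \<in> sets M" for p q by measurable
  have Y_int: "integrable M (Y p)" for p
    unfolding Y_def using count_moments(2)[of h p] I_sets
    by (intro Bochner_Integration.integrable_add integrable_mult_right Bochner_Integration.integrable_sum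
        integrable_real_indicator) (auto simp: has_bochner_integral_iff emeasure_eq_measure)
  have Y_mean: "expectation (Y p) \<le> (2 + ?m) * ?t" for p
  proof -
    have "expectation (Y p) = 2 * (intensity (rect h p))\<^sup>2 + (\<Sum>q\<in>?P - {p}. prob (?I p q))"
      unfolding Y_def using count_moments(2)[of h p] I_sets
      by (subst Bochner_Integration.integral_add)
        (auto simp: has_bochner_integral_iff emeasure_eq_measure intro!: Bochner_Integration.integrable_sum integrable_real_indicator)
    also have "\<dots> \<le> 2 * ?t + (\<Sum>q\<in>?P - {p}. ?t)"
      using intensity_rect(2,3)[OF assms, of p] prob_two_counts[OF assms]
      by (intro add_mono mult_left_mono power_mono sum_mono) auto
    also have "(\<Sum>q\<in>?P - {p}. ?t) = real (card (?P - {p})) * ?t" by simp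
    also have "real (card (?P - {p})) * ?t \<le> ?m * ?t"
      using near_finite by (intro mult_right_mono) (auto intro!: card_mono)
    finally show ?thesis by (simp add: algebra_simps)
  qed
  have point: "error h \<omega> \<le> ?m * (\<Sum>p\<in>?P. Y p \<omega>)" if "\<omega> \<in> space M" for \<omega>
  proof -
    let ?c = "\<lambda>p. real (count h p \<omega>)"
    have ind_nonneg: "0 \<le> (\<Sum>q\<in>?P - {p}. indicator (?I p q) \<omega> :: real)" for p
      by (intro sum_nonneg) simp
    have Y0: "0 \<le> Y p \<omega>" for p
      using ind_nonneg[of p] unfolding Y_def by (cases "count h p \<omega>") auto
    show ?thesis
    proof (cases "2 \<le> total h \<omega>")
      case True
      have sq: "(?c p)\<^sup>2 \<le> Y p \<omega>" if "p \<in> ?P" for p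
      proof -
        consider "count h p \<omega> = 0" | "count h p \<omega> = 1" | "2 \<le> count h p \<omega>" by linarith
        then show ?thesis
        proof cases
          case 2
          have "total h \<omega> = count h p \<omega> + (\<Sum>q\<in>?P - {p}. count h q \<omega>)"
            unfolding total_def by (rule sum.remove[OF near_finite(2) that])
          then have "(\<Sum>q\<in>?P - {p}. count h q \<omega>) \<noteq> 0" using True 2 by linarith
          then obtain q where q: "q \<in> ?P - {p}" "count h q \<omega> \<noteq> 0" by (meson sum.neutral)
          have "(indicator (?I p q) \<omega> :: real) \<le> (\<Sum>q\<in>?P - {p}. indicator (?I p q) \<omega>)"
            using q near_finite by (intro member_le_sum) auto
          moreover have "indicator (?I p q) \<omega> = (1::real)" using 2 q \<open>\<omega> \<in> space M\<close> by (simp add: indicator_def)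
          ultimately show ?thesis using 2 unfolding Y_def by simp
        next
          case 3
          then have "0 \<le> ?c p * (?c p - 2)" by simp
          then have "(?c p)\<^sup>2 \<le> 2 * (?c p * (?c p - 1))" by (simp add: power2_eq_square algebra_simps)
          then show ?thesis using ind_nonneg[of p] unfolding Y_def by linarith
        qed (use Y0 in simp)
      qed
      have "error h \<omega> = (\<Sum>p\<in>?P. ?c p)\<^sup>2" using True unfolding error_def total_def by simp
      also have "\<dots> \<le> (\<Sum>p\<in>?P. (?c p)\<^sup>2) * ?m"
        using sum_squared_le_sum_of_squares[of ?c ?P] by simp
      also have "\<dots> \<le> (\<Sum>p\<in>?P. Y p \<omega>) * ?m"
        by (intro mult_right_mono sum_mono sq) auto
      finally show ?thesis by (simp add: mult.commute)
    next
      case False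
      then show ?thesis using Y0 unfolding error_def by (simp add: sum_nonneg)
    qed
  qed
  have bound_int: "integrable M (\<lambda>\<omega>. ?m * (\<Sum>p\<in>?P. Y p \<omega>))"
    by (intro integrable_mult_right Bochner_Integration.integrable_sum Y_int)
  have error0: "0 \<le> error h \<omega>" for \<omega> unfolding error_def by simp
  show int: "integrable M (error h)"
    by (rule Bochner_Integration.integrable_bound[OF bound_int])
      (use point error0 in \<open>auto intro!: AE_I2 simp: order_trans[OF _ abs_ge_self]\<close>)
  have "expectation (error h) \<le> expectation (\<lambda>\<omega>. ?m * (\<Sum>p\<in>?P. Y p \<omega>))"
    by (rule integral_mono[OF int bound_int point])
  also have "\<dots> = ?m * (\<Sum>p\<in>?P. expectation (Y p))"
    using Y_int by (simp add: Bochner_Integration.integral_sum)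
  also have "\<dots> \<le> ?m * (\<Sum>p\<in>?P. (2 + ?m) * ?t)"
    by (intro mult_left_mono sum_mono Y_mean) simp
  also have "\<dots> = error_constant * h\<^sup>2"
    unfolding error_constant_def Let_def by (simp add: power_mult_distrib)
  finally show "expectation (error h) \<le> error_constant * h\<^sup>2" .
qed

lemma count_Inl: "count h (Inl i) \<omega> = card (A i \<omega> \<inter> {0<..h})"
proof -
  have "{t. (t, 0) \<in> {0<..h} \<times> {0..top_mark}} = {0<..h}" using top_mark_pos by auto
  then show ?thesis unfolding count_def rect_def card_drive_Inl by simp
qed

lemma count_Inr: "count h (Inr i) \<omega> = card (D i \<omega> \<inter> {0<..h} \<times> {0..top_mark})"
  unfolding count_def rect_def by (rule card_drive_Inr)

lemma D_props:
  assumes "\<omega> \<in> space M"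
  shows "D i \<omega> \<subseteq> UNIV \<times> {0..top_mark}" "finite (D i \<omega> \<inter> {0<..h} \<times> {0..r::real})"
proof -
  show "D i \<omega> \<subseteq> UNIV \<times> {0..top_mark}" by (rule poisson_process_count(1)[OF services_poisson assms])
  have "bounded ({0<..h} \<times> {0..r})" by (intro bounded_Times) auto
  then show "finite (D i \<omega> \<inter> {0<..h} \<times> {0..r})" by (rule poisson_process_count(2)[OF services_poisson assms])
qed

lemma thinned_le:
  assumes "\<omega> \<in> space M" "r \<le> top_mark"
  shows "thinned h r i \<omega> \<le> count h (Inr i) \<omega>"
  unfolding thinned_def count_Inr card_drive_Inr
  using D_props(2)[OF assms(1)] assms(2) by (intro card_mono) auto

lemma flow_bounds:
  assumes "\<omega> \<in> space M" "drive \<omega> \<in> good" "0 < h"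
  shows "flow 0 h \<xi> (drive \<omega>) i \<le> \<xi> i + count h (Inl i) \<omega>"
    "\<xi> i \<le> flow 0 h \<xi> (drive \<omega>) i + count h (Inr i) \<omega>"
proof -
  interpret driven a "\<lambda>i. A i \<omega>" "\<lambda>i. D i \<omega>" using good_driven[OF assms(2)] by simp
  show "flow 0 h \<xi> (drive \<omega>) i \<le> \<xi> i + count h (Inl i) \<omega>"
    using evolve_upper[OF assms(3)] assms(2) unfolding flow_def count_Inl by simp
  have "fst ` D i \<omega> \<inter> {0<..h} \<subseteq> fst ` (D i \<omega> \<inter> {0<..h} \<times> {0..top_mark})"
    using D_props(1)[OF assms(1), of i] by force
  then have "card (fst ` D i \<omega> \<inter> {0<..h}) \<le> card (fst ` (D i \<omega> \<inter> {0<..h} \<times> {0..top_mark}))"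
    using D_props(2)[OF assms(1)] by (intro card_mono) auto
  also have "\<dots> \<le> count h (Inr i) \<omega>" unfolding count_Inr by (rule card_image_le[OF D_props(2)[OF assms(1)]])
  finally show "\<xi> i \<le> flow 0 h \<xi> (drive \<omega>) i + count h (Inr i) \<omega>"
    using evolve_lower[OF assms(3), of \<xi> i] assms(2) unfolding flow_def by simp
qed

lemma total_card:
  assumes "\<omega> \<in> space M"
  shows "total h \<omega> = card (\<Union>p\<in>near_processes. drive \<omega> \<inter> rect h p)"
    "finite (\<Union>p\<in>near_processes. drive \<omega> \<inter> rect h p)"
proof -
  have fin: "finite (drive \<omega> \<inter> rect h p)" for p
    by (rule finite_pattern[OF drive_space[OF assms] rect_window])
  show "total h \<omega> = card (\<Union>p\<in>near_processes. drive \<omega> \<inter> rect h p)"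
    unfolding total_def count_def using near_finite fin
    by (intro card_UN_disjoint[symmetric]) (auto simp: rect_def)
  show "finite (\<Union>p\<in>near_processes. drive \<omega> \<inter> rect h p)" using near_finite fin by blast
qed

lemma counts_le_total:
  assumes "0 < a i"
  shows "count h (Inl i) \<omega> + count h (Inr i) \<omega> \<le> total h \<omega>"
    and "0 < a j \<Longrightarrow> i \<noteq> j \<Longrightarrow>
      count h (Inl i) \<omega> + count h (Inr i) \<omega> + (count h (Inl j) \<omega> + count h (Inr j) \<omega>) \<le> total h \<omega>"
proof -
  have mem: "Inl i \<in> near_processes" "Inr i \<in> near_processes" if "0 < a i" for i
    using near_self[OF that] unfolding near_processes_def by auto
  have "(\<Sum>p\<in>{Inl i, Inr i}. count h p \<omega>) \<le> total h \<omega>"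
    unfolding total_def using mem[OF assms] near_finite by (intro sum_mono2) auto
  then show "count h (Inl i) \<omega> + count h (Inr i) \<omega> \<le> total h \<omega>" by simp
  assume j: "0 < a j" "i \<noteq> j"
  have "(\<Sum>p\<in>{Inl i, Inr i, Inl j, Inr j}. count h p \<omega>) \<le> total h \<omega>"
    unfolding total_def using mem[OF assms] mem[OF j(1)] near_finite by (intro sum_mono2) auto
  then show "count h (Inl i) \<omega> + count h (Inr i) \<omega> + (count h (Inl j) \<omega> + count h (Inr j) \<omega>) \<le> total h \<omega>"
    using j(2) by simp
qed

lemma flow_single_atom:
  assumes \<omega>: "\<omega> \<in> space M" "drive \<omega> \<in> good" and "0 < h" and one: "total h \<omega> \<le> 1" and i: "0 < a i"
  shows "real (flow 0 h \<xi> (drive \<omega>) i) = real (\<xi> i) + real (count h (Inl i) \<omega>)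
    - (if 0 < \<xi> i then real (thinned h (departure_rate a \<xi> i) i \<omega>) else 0)"
proof -
  interpret driven a "\<lambda>i. A i \<omega>" "\<lambda>i. D i \<omega>" using good_driven[OF \<omega>(2)] by simp
  let ?T = "\<Union>p\<in>near_processes. drive \<omega> \<inter> rect h p"
  let ?R = "departure_rate a \<xi> i"
  have R: "0 \<le> ?R" "?R \<le> top_mark" using departure_rate_bounds unfolding top_mark_def by auto
  have T: "x = y" if "x \<in> ?T" "y \<in> ?T" for x y
    using one total_card[OF \<omega>(1), of h] that card_le_Suc0_iff_eq[of ?T] by auto
  have atom_A: "(Inl j, t, 0) \<in> ?T" if "j \<in> near" "t \<in> A j \<omega>" "0 < t" "t \<le> h" for j t
    using that top_mark_pos unfolding near_processes_def rect_def drive_def by auto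
  have atom_D: "(Inr j, t, U) \<in> ?T" if "j \<in> near" "(t, U) \<in> D j \<omega>" "0 < t" "t \<le> h" for j t U
    using that D_props(1)[OF \<omega>(1), of j] unfolding near_processes_def rect_def drive_def by auto
  have near: "j \<in> near" if "0 < a (i - j)" for j using that i unfolding near_def by auto
  have i_near: "i \<in> near" by (rule near_self[OF i])
  have ex_atom: "\<exists>p U. (p, t, U) \<in> ?T" if "0 < a (i - j)" "t \<in> E j \<inter> {0<..h}" for j t
    using that(2) atom_A[OF near[OF that(1)], of t] atom_D[OF near[OF that(1)], of t]
    unfolding event_times_def by fastforce
  obtain u where u: "0 < u" "u \<le> h" and single: "\<And>j. 0 < a (i - j) \<Longrightarrow> E j \<inter> {0<..h} \<subseteq> {u}"
  proof (cases "\<exists>j u. 0 < a (i - j) \<and> u \<in> E j \<inter> {0<..h}")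
    case True
    then obtain j u where ju: "0 < a (i - j)" "u \<in> E j \<inter> {0<..h}" by blast
    show ?thesis
    proof (rule that[of u])
      fix j' assume j': "0 < a (i - j')"
      show "E j' \<inter> {0<..h} \<subseteq> {u}"
        using ex_atom[OF j'] ex_atom[OF ju] T by blast
    qed (use ju in auto)
  next
    case False
    \<comment> \<open>When nothing happens nearby, any time in (0, h] serves as \<open>u\<close>,
      since \<open>upd\<close> changes nothing there.\<close>
    then show ?thesis using that[of h] \<open>0 < h\<close> by blast
  qed
  have "flow 0 h \<xi> (drive \<omega>) i = upd \<xi> u i"
    using evolve_single_event[OF u single] \<omega>(2) unfolding flow_def by simp
  moreover have "E i \<inter> {0<..h} \<subseteq> {u}" using single[of i] a_zero by simp
  then have "A i \<omega> \<inter> {0<..h} = (if u \<in> A i \<omega> then {u} else {})"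
    using u unfolding event_times_def by auto
  then have "count h (Inl i) \<omega> = (if u \<in> A i \<omega> then 1 else 0)" unfolding count_Inl by simp
  moreover have "thinned h ?R i \<omega> = (if \<exists>U. (u, U) \<in> D i \<omega> \<and> U \<le> ?R then 1 else 0)"
  proof (cases "\<exists>U. (u, U) \<in> D i \<omega> \<and> U \<le> ?R")
    case True
    then obtain U where U: "(u, U) \<in> D i \<omega>" "U \<le> ?R" by blast
    have "D i \<omega> \<inter> {0<..h} \<times> {0..?R} = {(u, U)}"
    proof
      show "D i \<omega> \<inter> {0<..h} \<times> {0..?R} \<subseteq> {(u, U)}"
      proof
        fix x assume x: "x \<in> D i \<omega> \<inter> {0<..h} \<times> {0..?R}"
        then show "x \<in> {(u, U)}"
          using T[OF atom_D[OF i_near, of "fst x" "snd x"] atom_D[OF i_near U(1) u]] by auto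
      qed
      show "{(u, U)} \<subseteq> D i \<omega> \<inter> {0<..h} \<times> {0..?R}"
        using U u D_props(1)[OF \<omega>(1), of i] by auto
    qed
    then show ?thesis using True unfolding thinned_def card_drive_Inr by simp
  next
    case False
    have "D i \<omega> \<inter> {0<..h} \<times> {0..?R} = {}"
    proof (rule ccontr)
      assume "D i \<omega> \<inter> {0<..h} \<times> {0..?R} \<noteq> {}"
      then obtain t U where tU: "(t, U) \<in> D i \<omega>" "0 < t" "t \<le> h" "U \<le> ?R" by auto
      then have "t \<in> E i \<inter> {0<..h}" unfolding event_times_def by force
      then have "t = u" using \<open>E i \<inter> {0<..h} \<subseteq> {u}\<close> by blast
      then show False using False tU by blast
    qed
    then show ?thesis using False unfolding thinned_def card_drive_Inr by simp
  qed
  ultimately show ?thesis unfolding update_def by auto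
qed

text \<open>The increment predicted by the rate frozen at its initial value.\<close>

definition drift :: "real \<Rightarrow> (int ^ 'd \<Rightarrow> nat) \<Rightarrow> int ^ 'd \<Rightarrow> 'w \<Rightarrow> real" where
  "drift h \<xi> i \<omega> = real (count h (Inl i) \<omega>)
    - (if 0 < \<xi> i then real (thinned h (departure_rate a \<xi> i) i \<omega>) else 0)"

text \<open>Up and down jumps with the same sign: this predicts the square of an increment that is
  0, 1 or -1.\<close>

definition jumps :: "real \<Rightarrow> (int ^ 'd \<Rightarrow> nat) \<Rightarrow> int ^ 'd \<Rightarrow> 'w \<Rightarrow> real" where
  "jumps h \<xi> i \<omega> = real (count h (Inl i) \<omega>)
    + (if 0 < \<xi> i then real (thinned h (departure_rate a \<xi> i) i \<omega>) else 0)"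

definition increment :: "real \<Rightarrow> (int ^ 'd \<Rightarrow> nat) \<Rightarrow> int ^ 'd \<Rightarrow> 'w \<Rightarrow> real" where
  "increment h \<xi> i \<omega> = real (flow 0 h \<xi> (drive \<omega>) i) - real (\<xi> i)"

lemma drift_jumps_mean:
  assumes "0 < h"
  shows "has_bochner_integral M (drift h \<xi> i) (h * (lam - departure_rate a \<xi> i))"
    "has_bochner_integral M (jumps h \<xi> i) (h * (lam + departure_rate a \<xi> i))"
proof -
  let ?R = "departure_rate a \<xi> i"
  have R: "0 \<le> ?R" "?R \<le> top_mark" using departure_rate_bounds unfolding top_mark_def by auto
  have c: "has_bochner_integral M (\<lambda>\<omega>. real (count h (Inl i) \<omega>)) (lam * h)"
    using count_moments(1)[of h "Inl i"] unfolding intensity_rect(1)[OF assms] .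
  have t: "has_bochner_integral M (\<lambda>\<omega>. if 0 < \<xi> i then real (thinned h ?R i \<omega>) else 0) (h * ?R)"
  proof (cases "0 < \<xi> i")
    case False
    then have "?R = 0" unfolding departure_rate_def by simp
    then show ?thesis using False by (simp add: has_bochner_integral_zero)
  qed (use thinned_mean[OF assms R] in simp)
  show "has_bochner_integral M (drift h \<xi> i) (h * (lam - departure_rate a \<xi> i))"
    using has_bochner_integral_diff[OF c t] unfolding drift_def[abs_def] by (simp add: algebra_simps)
  show "has_bochner_integral M (jumps h \<xi> i) (h * (lam + departure_rate a \<xi> i))"
    using has_bochner_integral_add[OF c t] unfolding jumps_def[abs_def] by (simp add: algebra_simps)
qed

text \<open>With at most one nearby atom both differences vanish: the increment is the drift, its
  square is the number of jumps, and two different queues cannot both move. Otherwise crude bounds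
  by the number of atoms suffice.\<close>

theorem increment_error:
  assumes \<omega>: "\<omega> \<in> space M" "drive \<omega> \<in> good" and "0 < h" and i: "0 < a i" and j: "0 < a j"
  shows "\<bar>increment h \<xi> i \<omega> - drift h \<xi> i \<omega>\<bar> \<le> 2 * error h \<omega>"
    "\<bar>increment h \<xi> i \<omega> * increment h \<xi> j \<omega> - (if i = j then jumps h \<xi> i \<omega> else 0)\<bar> \<le> 2 * error h \<omega>"
proof -
  let ?N = "real (total h \<omega>)"
  let ?n = "\<lambda>i. real (count h (Inl i) \<omega>) + real (count h (Inr i) \<omega>)"
  have th: "real (thinned h (departure_rate a \<xi> i) i \<omega>) \<le> real (count h (Inr i) \<omega>)" for i
    using thinned_le[OF \<omega>(1)] departure_rate_bounds unfolding top_mark_def by simp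
  have inc: "\<bar>increment h \<xi> i \<omega>\<bar> \<le> ?n i" for i
    using flow_bounds[OF \<omega> \<open>0 < h\<close>, of \<xi> i] unfolding increment_def by linarith
  have dr: "\<bar>drift h \<xi> i \<omega>\<bar> \<le> ?n i" "0 \<le> jumps h \<xi> i \<omega>" "jumps h \<xi> i \<omega> \<le> ?n i" for i
    using th[of i] unfolding drift_def jumps_def by auto
  have nN: "?n i \<le> ?N" "?n j \<le> ?N"
    using counts_le_total(1)[OF i, of h \<omega>] counts_le_total(1)[OF j, of h \<omega>] by linarith+
  show "\<bar>increment h \<xi> i \<omega> - drift h \<xi> i \<omega>\<bar> \<le> 2 * error h \<omega>"
  proof (cases "2 \<le> total h \<omega>")
    case True
    then have "2 * ?N \<le> ?N\<^sup>2" by (simp add: power2_eq_square)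
    then show ?thesis using inc[of i] dr[of i] nN True unfolding error_def by auto
  next
    case False
    then show ?thesis
      using flow_single_atom[OF \<omega> \<open>0 < h\<close> _ i] unfolding increment_def drift_def error_def by simp
  qed
  show "\<bar>increment h \<xi> i \<omega> * increment h \<xi> j \<omega> - (if i = j then jumps h \<xi> i \<omega> else 0)\<bar> \<le> 2 * error h \<omega>"
  proof (cases "2 \<le> total h \<omega>")
    case True
    then have sq: "?N \<le> ?N\<^sup>2" by (simp add: power2_eq_square)
    have "\<bar>increment h \<xi> i \<omega> * increment h \<xi> j \<omega>\<bar> \<le> ?N * ?N"
      unfolding abs_mult using inc[of i] inc[of j] nN by (intro mult_mono) auto
    then have "\<bar>increment h \<xi> i \<omega> * increment h \<xi> j \<omega>\<bar> \<le> ?N\<^sup>2" by (simp add: power2_eq_square)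
    moreover have "0 \<le> jumps h \<xi> i \<omega>" "jumps h \<xi> i \<omega> \<le> ?N\<^sup>2" using dr(2,3)[of i] nN sq by linarith+
    moreover have "error h \<omega> = ?N\<^sup>2" using True unfolding error_def by simp
    moreover have "\<bar>p - (if b then q else 0)\<bar> \<le> 2 * e"
      if "\<bar>p\<bar> \<le> e" "0 \<le> q" "q \<le> e" for p q e :: real and b
      using that by (cases b) auto
    ultimately show ?thesis by metis
  next
    case False
    then have "total h \<omega> \<le> 1" by simp
    show ?thesis
    proof (cases "i = j")
      case True
      define x where "x = count h (Inl i) \<omega>"
      define y where "y = (if 0 < \<xi> i then thinned h (departure_rate a \<xi> i) i \<omega> else 0)"
      have "x + y \<le> 1"
        using counts_le_total(1)[OF i, of h \<omega>] \<open>total h \<omega> \<le> 1\<close> th[of i] unfolding x_def y_def by auto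
      then have "(real x - real y) * (real x - real y) = real x + real y"
        by (cases x; cases y) auto
      moreover have "increment h \<xi> i \<omega> = real x - real y"
        using flow_single_atom[OF \<omega> \<open>0 < h\<close> \<open>total h \<omega> \<le> 1\<close> i] unfolding increment_def x_def y_def by auto
      moreover have "jumps h \<xi> i \<omega> = real x + real y" unfolding jumps_def x_def y_def by simp
      ultimately show ?thesis using True False unfolding error_def by simp
    next
      case neq: False
      have "count h (Inl i) \<omega> + count h (Inr i) \<omega> = 0 \<or> count h (Inl j) \<omega> + count h (Inr j) \<omega> = 0"
        using counts_le_total(2)[OF i j neq, of h \<omega>] \<open>total h \<omega> \<le> 1\<close> by linarith
      then have "?n i = 0 \<or> ?n j = 0" by auto
      then have "increment h \<xi> i \<omega> * increment h \<xi> j \<omega> = 0" using inc[of i] inc[of j] by auto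
      then show ?thesis using neq unfolding error_def by auto
    qed
  qed
qed

end

section \<open>The mean of a translation invariant stationary law\<close>

lemma space_config [simp]: "space config_space = UNIV"
  unfolding config_space_def by (simp add: space_PiM PiE_UNIV_domain)

lemma config_component [measurable]: "(\<lambda>y. y i) \<in> config_space \<rightarrow>\<^sub>M count_space UNIV"
  unfolding config_space_def by (rule measurable_component_singleton) simp

context network
begin

lemma departure_rate_measurable [measurable]: "(\<lambda>y. departure_rate a y i) \<in> borel_measurable config_space"
  unfolding departure_rate_def by measurable

lemma flow_drive_measurable:
  assumes "s \<le> t" and sets: "sets \<pi> = sets config_space"
  shows "(\<lambda>(\<xi>, \<omega>). flow s t \<xi> (drive \<omega>)) \<in> \<pi> \<Otimes>\<^sub>M M \<rightarrow>\<^sub>M config_space"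
proof -
  have id: "(\<lambda>\<xi>. \<xi>) \<in> \<pi> \<rightarrow>\<^sub>M config_space" by (rule measurable_ident_sets[OF sets])
  have "(\<lambda>x. (fst x, drive (snd x))) \<in> \<pi> \<Otimes>\<^sub>M M \<rightarrow>\<^sub>M config_space \<Otimes>\<^sub>M pats"
    by (intro measurable_Pair measurable_compose[OF measurable_fst id] measurable_compose[OF measurable_snd drive_measurable])
  from measurable_compose[OF this flow_measurable[OF assms(1)]] show ?thesis by (simp add: split_beta')
qed

lemma flow_drive_measurable1:
  assumes "s \<le> t"
  shows "(\<lambda>\<omega>. flow s t \<xi> (drive \<omega>)) \<in> M \<rightarrow>\<^sub>M config_space"
proof -
  have "(\<lambda>\<omega>. (\<xi>, drive \<omega>)) \<in> M \<rightarrow>\<^sub>M config_space \<Otimes>\<^sub>M pats"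
    using drive_measurable by (intro measurable_Pair measurable_const) auto
  from measurable_compose[OF this flow_measurable[OF assms]] show ?thesis by simp
qed

text \<open>The mean of \<open>Y\<close> is known only through that of \<open>Z\<close>, and
  integrability of \<open>Y\<close> likewise comes from \<open>Z\<close> and the error.\<close>

lemma integral_approx:
  assumes Y: "Y \<in> borel_measurable M" and Z: "has_bochner_integral M Z z" and "0 < h" "0 \<le> c"
    and close: "AE \<omega> in M. \<bar>Y \<omega> - Z \<omega>\<bar> \<le> c * error h \<omega>"
  shows "integrable M Y" "\<bar>expectation Y - z\<bar> \<le> c * error_constant * h\<^sup>2"
proof -
  have Zi: "integrable M Z" "expectation Z = z" using Z by (auto simp: has_bochner_integral_iff)
  have Ei: "integrable M (\<lambda>\<omega>. c * error h \<omega>)" using error_mean(1)[OF \<open>0 < h\<close>] by simp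
  have Di: "integrable M (\<lambda>\<omega>. Y \<omega> - Z \<omega>)"
  proof (rule Bochner_Integration.integrable_bound[OF Ei])
    show "(\<lambda>\<omega>. Y \<omega> - Z \<omega>) \<in> borel_measurable M" using Y Zi(1) by simp
    show "AE \<omega> in M. norm (Y \<omega> - Z \<omega>) \<le> norm (c * error h \<omega>)"
      using close by eventually_elim simp
  qed
  have "integrable M (\<lambda>\<omega>. (Y \<omega> - Z \<omega>) + Z \<omega>)" by (rule Bochner_Integration.integrable_add[OF Di Zi(1)])
  then show Yi: "integrable M Y" by simp
  have "\<bar>expectation Y - z\<bar> = \<bar>expectation (\<lambda>\<omega>. Y \<omega> - Z \<omega>)\<bar>"
    using Yi Zi by simp
  also have "\<dots> \<le> expectation (\<lambda>\<omega>. \<bar>Y \<omega> - Z \<omega>\<bar>)" by (rule integral_abs_bound)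
  also have "\<dots> \<le> expectation (\<lambda>\<omega>. c * error h \<omega>)"
    by (rule integral_mono_AE[OF _ Ei close]) (use Di in auto)
  also have "\<dots> \<le> c * (error_constant * h\<^sup>2)"
    using error_mean[OF \<open>0 < h\<close>] \<open>0 \<le> c\<close> by (simp add: mult_left_mono)
  finally show "\<bar>expectation Y - z\<bar> \<le> c * error_constant * h\<^sup>2" by (simp add: mult.assoc)
qed

definition pair_functional :: "(int ^ 'd \<Rightarrow> nat) \<Rightarrow> real" where
  "pair_functional y = (\<Sum>j | 0 < a j. a j * (real (y 0) * real (y j)))"

text \<open>The generator applied to \<open>pair_functional\<close>: a product rule for each pair,
  plus, on the diagonal, the rate at which squared jumps accumulate.\<close>

definition pair_drift :: "(int ^ 'd \<Rightarrow> nat) \<Rightarrow> real" where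
  "pair_drift y = (\<Sum>j | 0 < a j. a j * ((lam - departure_rate a y 0) * real (y j) +
     real (y 0) * (lam - departure_rate a y j) + (if 0 = j then lam + departure_rate a y 0 else 0)))"

text \<open>Linear in the state, hence integrable under a finite second moment.\<close>

definition pair_error :: "(int ^ 'd \<Rightarrow> nat) \<Rightarrow> real" where
  "pair_error y = (\<Sum>j | 0 < a j. a j * (2 * real (y j) + 2 * real (y 0) + 2))"

lemma increment_measurable: "0 < h \<Longrightarrow> (\<lambda>\<omega>. increment h \<xi> i \<omega>) \<in> borel_measurable M"
  unfolding increment_def
  using measurable_compose[OF flow_drive_measurable1[of 0 h \<xi>] config_component[of i]] by simp

lemma mean_step:
  assumes "0 < h"
  shows "integrable M (\<lambda>\<omega>. real (flow 0 h \<xi> (drive \<omega>) 0))"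
    "\<bar>expectation (\<lambda>\<omega>. real (flow 0 h \<xi> (drive \<omega>) 0)) - real (\<xi> 0) - h * (lam - departure_rate a \<xi> 0)\<bar>
      \<le> h\<^sup>2 * (2 * error_constant)"
proof -
  have close: "AE \<omega> in M. \<bar>increment h \<xi> 0 \<omega> - drift h \<xi> 0 \<omega>\<bar> \<le> 2 * error h \<omega>"
    using AE_good AE_space by eventually_elim (rule increment_error(1)[OF _ _ assms a_zero a_zero])
  note * = integral_approx[OF increment_measurable[OF assms] drift_jumps_mean(1)[OF assms] assms _ close]
  have "integrable M (\<lambda>\<omega>. increment h \<xi> 0 \<omega> + real (\<xi> 0))" using *(1) by simp
  then show int: "integrable M (\<lambda>\<omega>. real (flow 0 h \<xi> (drive \<omega>) 0))" unfolding increment_def by simp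
  have "expectation (\<lambda>\<omega>. increment h \<xi> 0 \<omega>) = expectation (\<lambda>\<omega>. real (flow 0 h \<xi> (drive \<omega>) 0)) - real (\<xi> 0)"
    unfolding increment_def using int by (simp add: prob_space)
  then show "\<bar>expectation (\<lambda>\<omega>. real (flow 0 h \<xi> (drive \<omega>) 0)) - real (\<xi> 0) - h * (lam - departure_rate a \<xi> 0)\<bar>
      \<le> h\<^sup>2 * (2 * error_constant)"
    using *(2) by (simp add: mult.commute)
qed

lemma pair_step:
  assumes "0 < h"
  shows "integrable M (\<lambda>\<omega>. pair_functional (flow 0 h \<xi> (drive \<omega>)))"
    "\<bar>expectation (\<lambda>\<omega>. pair_functional (flow 0 h \<xi> (drive \<omega>))) - pair_functional \<xi> - h * pair_drift \<xi>\<bar>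
      \<le> h\<^sup>2 * (pair_error \<xi> * error_constant)"
proof -
  let ?S = "{j. 0 < a j}"
  let ?R = "departure_rate a \<xi>"
  \<comment> \<open>The increment of a product, expanded into two terms linear in the increments and
    their product; \<open>Z\<close> replaces each by its frozen-rate prediction.\<close>
  define Y where "Y = (\<lambda>\<omega>. \<Sum>j\<in>?S. a j * (increment h \<xi> 0 \<omega> * real (\<xi> j) +
     real (\<xi> 0) * increment h \<xi> j \<omega> + increment h \<xi> 0 \<omega> * increment h \<xi> j \<omega>))"
  define Z where "Z = (\<lambda>\<omega>. \<Sum>j\<in>?S. a j * (drift h \<xi> 0 \<omega> * real (\<xi> j) +
     real (\<xi> 0) * drift h \<xi> j \<omega> + (if 0 = j then jumps h \<xi> 0 \<omega> else 0)))"
  have Y_eq: "Y \<omega> = pair_functional (flow 0 h \<xi> (drive \<omega>)) - pair_functional \<xi>" for \<omega>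
    unfolding Y_def pair_functional_def increment_def sum_subtractf[symmetric]
    by (intro sum.cong) (auto simp: algebra_simps)
  have Y_meas: "Y \<in> borel_measurable M"
    unfolding Y_def using increment_measurable[OF assms] by measurable
  have jump_int: "has_bochner_integral M (\<lambda>\<omega>. if 0 = j then jumps h \<xi> 0 \<omega> else 0)
      (if 0 = j then h * (lam + ?R 0) else 0)" for j :: "int ^ 'd"
    using drift_jumps_mean(2)[OF assms, of \<xi> 0] by (cases "0 = j") (simp_all add: has_bochner_integral_zero)
  have "has_bochner_integral M Z (\<Sum>j\<in>?S. a j * (h * (lam - ?R 0) * real (\<xi> j) +
     real (\<xi> 0) * (h * (lam - ?R j)) + (if 0 = j then h * (lam + ?R 0) else 0)))"
    unfolding Z_def
    by (intro has_bochner_integral_sum has_bochner_integral_mult_right has_bochner_integral_add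
        has_bochner_integral_mult_left drift_jumps_mean(1)[OF assms] jump_int)
  also have "(\<Sum>j\<in>?S. a j * (h * (lam - ?R 0) * real (\<xi> j) +
     real (\<xi> 0) * (h * (lam - ?R j)) + (if 0 = j then h * (lam + ?R 0) else 0))) = h * pair_drift \<xi>"
    unfolding pair_drift_def sum_distrib_left by (intro sum.cong) (auto simp: algebra_simps)
  finally have Z_int: "has_bochner_integral M Z (h * pair_drift \<xi>)" .
  have close: "AE \<omega> in M. \<bar>Y \<omega> - Z \<omega>\<bar> \<le> pair_error \<xi> * error h \<omega>"
    using AE_good AE_space
  proof eventually_elim
    case (elim \<omega>)
    have e1: "\<bar>increment h \<xi> j \<omega> - drift h \<xi> j \<omega>\<bar> \<le> 2 * error h \<omega>" if "0 < a j" for j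
      by (rule increment_error(1)[OF elim(2,1) assms that a_zero])
    have e2: "\<bar>increment h \<xi> 0 \<omega> * increment h \<xi> j \<omega> - (if 0 = j then jumps h \<xi> 0 \<omega> else 0)\<bar> \<le> 2 * error h \<omega>"
      if "0 < a j" for j
      by (rule increment_error(2)[OF elim(2,1) assms a_zero that])
    have diff: "Y \<omega> - Z \<omega> = (\<Sum>j\<in>?S. a j * ((increment h \<xi> 0 \<omega> - drift h \<xi> 0 \<omega>) * real (\<xi> j) +
        real (\<xi> 0) * (increment h \<xi> j \<omega> - drift h \<xi> j \<omega>) +
        (increment h \<xi> 0 \<omega> * increment h \<xi> j \<omega> - (if 0 = j then jumps h \<xi> 0 \<omega> else 0))))"
      unfolding Y_def Z_def sum_subtractf[symmetric] by (intro sum.cong) (auto simp: algebra_simps)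
    have "\<bar>Y \<omega> - Z \<omega>\<bar> \<le> (\<Sum>j\<in>?S. a j * (2 * error h \<omega> * real (\<xi> j) + real (\<xi> 0) * (2 * error h \<omega>) + 2 * error h \<omega>))"
      unfolding diff
    proof (rule order_trans[OF sum_abs], rule sum_mono)
      fix j assume j: "j \<in> ?S"
      have "\<bar>(increment h \<xi> 0 \<omega> - drift h \<xi> 0 \<omega>) * real (\<xi> j)\<bar> \<le> 2 * error h \<omega> * real (\<xi> j)"
        using e1[OF a_zero] by (simp add: abs_mult mult_right_mono)
      moreover have "\<bar>real (\<xi> 0) * (increment h \<xi> j \<omega> - drift h \<xi> j \<omega>)\<bar> \<le> real (\<xi> 0) * (2 * error h \<omega>)"
        using e1[of j] j by (simp add: abs_mult mult_left_mono)
      ultimately have "\<bar>(increment h \<xi> 0 \<omega> - drift h \<xi> 0 \<omega>) * real (\<xi> j) +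
          real (\<xi> 0) * (increment h \<xi> j \<omega> - drift h \<xi> j \<omega>) +
          (increment h \<xi> 0 \<omega> * increment h \<xi> j \<omega> - (if 0 = j then jumps h \<xi> 0 \<omega> else 0))\<bar>
          \<le> 2 * error h \<omega> * real (\<xi> j) + real (\<xi> 0) * (2 * error h \<omega>) + 2 * error h \<omega>"
        using e2[of j] j by (intro order_trans[OF abs_triangle_ineq] add_mono) auto
      then show "\<bar>a j * ((increment h \<xi> 0 \<omega> - drift h \<xi> 0 \<omega>) * real (\<xi> j) +
          real (\<xi> 0) * (increment h \<xi> j \<omega> - drift h \<xi> j \<omega>) +
          (increment h \<xi> 0 \<omega> * increment h \<xi> j \<omega> - (if 0 = j then jumps h \<xi> 0 \<omega> else 0)))\<bar>
          \<le> a j * (2 * error h \<omega> * real (\<xi> j) + real (\<xi> 0) * (2 * error h \<omega>) + 2 * error h \<omega>)"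
        unfolding abs_mult[of "a j"] using a_nonneg[of j] by (simp add: mult_left_mono)
    qed
    also have "\<dots> = pair_error \<xi> * error h \<omega>"
      unfolding pair_error_def sum_distrib_right by (intro sum.cong) (auto simp: algebra_simps)
    finally show ?case .
  qed
  have "0 \<le> pair_error \<xi>" unfolding pair_error_def using a_nonneg by (intro sum_nonneg) simp
  note * = integral_approx[OF Y_meas Z_int assms this close]
  have "integrable M (\<lambda>\<omega>. Y \<omega> + pair_functional \<xi>)" using *(1) by simp
  then show int: "integrable M (\<lambda>\<omega>. pair_functional (flow 0 h \<xi> (drive \<omega>)))" unfolding Y_eq by simp
  have "expectation Y = expectation (\<lambda>\<omega>. pair_functional (flow 0 h \<xi> (drive \<omega>))) - pair_functional \<xi>"
    unfolding Y_eq using int by (simp add: prob_space)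
  then show "\<bar>expectation (\<lambda>\<omega>. pair_functional (flow 0 h \<xi> (drive \<omega>))) - pair_functional \<xi> - h * pair_drift \<xi>\<bar>
      \<le> h\<^sup>2 * (pair_error \<xi> * error_constant)"
    using *(2) by (simp add: mult.commute)
qed

text \<open>The working form of \<open>stationary\<close>: as \<open>flow\<close> is measurable, the
  completion disappears. The two agree by \<open>stationary_iff\<close>.\<close>

definition flow_stationary :: "(int ^ 'd \<Rightarrow> nat) measure \<Rightarrow> bool" where
  "flow_stationary \<pi> \<longleftrightarrow>
     (\<forall>t\<ge>0. distr (\<pi> \<Otimes>\<^sub>M M) config_space (\<lambda>(\<xi>, \<omega>). flow 0 t \<xi> (drive \<omega>)) = \<pi>)"

text \<open>Stationarity makes the mean of \<open>f\<close> unchanged over (0, h], so h times the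
  mean of \<open>L\<close> is at most \<open>h\<^sup>2\<close> times the mean of \<open>W\<close> in
  absolute value. Dividing by h and letting h tend to 0 leaves mean zero. Nonnegativity of
  \<open>f\<close> allows Tonelli before integrability over the product is known.\<close>

theorem stationary_generator:
  assumes \<pi>: "config_prob \<pi>" and stat: "flow_stationary \<pi>"
    and f: "f \<in> borel_measurable config_space" "\<And>y. 0 \<le> f y" "integrable \<pi> f"
    and L: "integrable \<pi> L" and W: "integrable \<pi> W"
    and int: "\<And>h \<xi>. 0 < h \<Longrightarrow> integrable M (\<lambda>\<omega>. f (flow 0 h \<xi> (drive \<omega>)))"
    and step: "\<And>h \<xi>. 0 < h \<Longrightarrow>
      \<bar>expectation (\<lambda>\<omega>. f (flow 0 h \<xi> (drive \<omega>))) - f \<xi> - h * L \<xi>\<bar> \<le> h\<^sup>2 * W \<xi>"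
  shows "(\<integral>y. L y \<partial>\<pi>) = 0"
proof -
  interpret \<pi>: prob_space \<pi> using \<pi> unfolding config_prob_def by simp
  have sets: "sets \<pi> = sets config_space" using \<pi> unfolding config_prob_def by simp
  have bound: "\<bar>\<integral>y. L y \<partial>\<pi>\<bar> \<le> h * (\<integral>y. W y \<partial>\<pi>)" if "0 < h" for h
  proof -
    define \<phi> where "\<phi> = (\<lambda>\<xi>. expectation (\<lambda>\<omega>. f (flow 0 h \<xi> (drive \<omega>))))"
    have meas: "(\<lambda>(\<xi>, \<omega>). f (flow 0 h \<xi> (drive \<omega>))) \<in> borel_measurable (\<pi> \<Otimes>\<^sub>M M)"
      using measurable_compose[OF flow_drive_measurable[OF less_imp_le[OF that] sets] f(1)]
      by (simp add: split_beta')
    have "(\<integral>\<^sup>+ y. ennreal (f y) \<partial>\<pi>) =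
        (\<integral>\<^sup>+ y. ennreal (f y) \<partial>distr (\<pi> \<Otimes>\<^sub>M M) config_space (\<lambda>(\<xi>, \<omega>). flow 0 h \<xi> (drive \<omega>)))"
      using stat that unfolding flow_stationary_def by simp
    also have "\<dots> = (\<integral>\<^sup>+ x. ennreal (f (case x of (\<xi>, \<omega>) \<Rightarrow> flow 0 h \<xi> (drive \<omega>))) \<partial>(\<pi> \<Otimes>\<^sub>M M))"
      using flow_drive_measurable[OF less_imp_le[OF that] sets] f(1) by (intro nn_integral_distr) auto
    also have "\<dots> = (\<integral>\<^sup>+ \<xi>. \<integral>\<^sup>+ \<omega>. ennreal (f (flow 0 h \<xi> (drive \<omega>))) \<partial>M \<partial>\<pi>)"
      using meas by (subst nn_integral_fst[symmetric]) (simp_all add: split_beta')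
    also have "\<dots> = (\<integral>\<^sup>+ \<xi>. ennreal (\<phi> \<xi>) \<partial>\<pi>)"
      unfolding \<phi>_def using int[OF that] f(2) by (intro nn_integral_cong nn_integral_eq_integral) auto
    finally have eq: "(\<integral>\<^sup>+ \<xi>. ennreal (\<phi> \<xi>) \<partial>\<pi>) = ennreal (\<integral>y. f y \<partial>\<pi>)"
      using nn_integral_eq_integral[OF f(3)] f(2) by simp
    have "\<phi> \<in> borel_measurable \<pi>"
      unfolding \<phi>_def using borel_measurable_lebesgue_integral[of "\<lambda>\<xi> \<omega>. f (flow 0 h \<xi> (drive \<omega>))" \<pi>] meas by simp
    then have "has_bochner_integral \<pi> \<phi> (\<integral>y. f y \<partial>\<pi>)"
      using eq f(2) unfolding \<phi>_def by (intro has_bochner_integral_nn_integral) (auto intro!: integral_nonneg)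
    then have \<phi>: "integrable \<pi> \<phi>" "(\<integral>y. \<phi> y \<partial>\<pi>) = (\<integral>y. f y \<partial>\<pi>)" by (auto simp: has_bochner_integral_iff)
    have "\<bar>\<integral>y. \<phi> y - f y - h * L y \<partial>\<pi>\<bar> \<le> (\<integral>y. \<bar>\<phi> y - f y - h * L y\<bar> \<partial>\<pi>)" by (rule integral_abs_bound)
    also have "\<dots> \<le> (\<integral>y. h\<^sup>2 * W y \<partial>\<pi>)"
      using \<phi>(1) f(3) L W step[OF that] unfolding \<phi>_def by (intro integral_mono) auto
    also have "(\<integral>y. \<phi> y - f y - h * L y \<partial>\<pi>) = - (h * (\<integral>y. L y \<partial>\<pi>))"
      using \<phi> f(3) L by simp
    finally have "h * \<bar>\<integral>y. L y \<partial>\<pi>\<bar> \<le> h * (h * (\<integral>y. W y \<partial>\<pi>))"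
      using that by (simp add: abs_mult power2_eq_square mult.assoc)
    then show ?thesis using that by simp
  qed
  have lim: "((\<lambda>h. h * (\<integral>y. W y \<partial>\<pi>)) \<longlongrightarrow> 0 * (\<integral>y. W y \<partial>\<pi>)) (at_right 0)"
    by (intro tendsto_intros)
  have "\<bar>\<integral>y. L y \<partial>\<pi>\<bar> \<le> 0 * (\<integral>y. W y \<partial>\<pi>)"
    by (rule tendsto_lowerbound[OF lim])
      (use bound in \<open>auto intro: eventually_mono[OF eventually_at_right_less[of 0]]\<close>)
  then show ?thesis by simp
qed

lemma pair_moments:
  assumes \<pi>: "config_prob \<pi>" and fin: "finite_second_moment \<pi>"
  shows "integrable \<pi> (\<lambda>y. real (y i) * real (y j))" "integrable \<pi> (\<lambda>y. real (y i))"
    "integrable \<pi> (\<lambda>y. departure_rate a y i * real (y j))" "integrable \<pi> (\<lambda>y. departure_rate a y i)"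
proof -
  interpret \<pi>: prob_space \<pi> using \<pi> unfolding config_prob_def by simp
  have sets [measurable_cong]: "sets \<pi> = sets config_space" using \<pi> unfolding config_prob_def by simp
  have R: "0 \<le> departure_rate a y i" "departure_rate a y i \<le> top_mark" for y i
    using departure_rate_bounds unfolding top_mark_def by auto
  have sq: "integrable \<pi> (\<lambda>y. (real (y i))\<^sup>2)" for i
  proof (rule integrableI_bounded)
    have "(\<integral>\<^sup>+ y. ennreal (norm ((real (y i))\<^sup>2)) \<partial>\<pi>) = (\<integral>\<^sup>+ y. (of_nat (y i))\<^sup>2 \<partial>\<pi>)"
      by (intro nn_integral_cong) (simp add: ennreal_of_nat_eq_real_of_nat ennreal_power)
    then show "(\<integral>\<^sup>+ y. ennreal (norm ((real (y i))\<^sup>2)) \<partial>\<pi>) < \<infinity>"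
      using fin unfolding finite_second_moment_def by simp
  qed measurable
  show yy: "integrable \<pi> (\<lambda>y. real (y i) * real (y j))" for i j
  proof (rule Bochner_Integration.integrable_bound[OF Bochner_Integration.integrable_add[OF sq[of i] sq[of j]]])
    have "u * v \<le> u\<^sup>2 + v\<^sup>2" if "0 \<le> u" "0 \<le> v" for u v :: real
    proof -
      have "0 \<le> (u - v)\<^sup>2" "0 \<le> u * v" using that by auto
      then show ?thesis by (simp add: power2_diff)
    qed
    then show "AE y in \<pi>. norm (real (y i) * real (y j)) \<le> norm ((real (y i))\<^sup>2 + (real (y j))\<^sup>2)"
      by (intro AE_I2) simp
  qed measurable
  show y: "integrable \<pi> (\<lambda>y. real (y i))" for i
  proof (rule Bochner_Integration.integrable_bound[OF sq[of i]])
    have "real n \<le> (real n)\<^sup>2" for n :: nat by (cases n) (auto simp: power2_eq_square)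
    then show "AE y in \<pi>. norm (real (y i)) \<le> norm ((real (y i))\<^sup>2)" by (intro AE_I2) simp
  qed measurable
  show "integrable \<pi> (\<lambda>y. departure_rate a y i * real (y j))"
  proof (rule Bochner_Integration.integrable_bound[OF integrable_mult_right[OF y[of j], of top_mark]])
    show "AE y in \<pi>. norm (departure_rate a y i * real (y j)) \<le> norm (top_mark * real (y j))"
      using R[of _ i] top_mark_pos by (intro AE_I2) (simp add: abs_mult mult_right_mono)
  qed measurable
  show "integrable \<pi> (\<lambda>y. departure_rate a y i)"
  proof (rule \<pi>.integrable_const_bound[of _ top_mark])
    show "AE y in \<pi>. norm (departure_rate a y i) \<le> top_mark" using R[of _ i] by (intro AE_I2) simp
  qed measurable
qed

lemma translation_invariant_integral:
  assumes \<pi>: "config_prob \<pi>" and ti: "translation_invariant \<pi>" and F: "F \<in> borel_measurable config_space"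
  shows "(\<integral>y. F (\<lambda>i. y (i - v)) \<partial>\<pi>) = (\<integral>y. F y \<partial>\<pi> :: real)"
proof -
  have sets: "sets \<pi> = sets config_space" using \<pi> unfolding config_prob_def by simp
  have sh: "(\<lambda>y i. y (i - v)) \<in> \<pi> \<rightarrow>\<^sub>M config_space"
    unfolding measurable_config_iff measurable_cong_sets[OF sets refl] by simp
  have "(\<integral>y. F y \<partial>\<pi>) = (\<integral>y. F y \<partial>distr \<pi> config_space (\<lambda>y i. y (i - v)))"
    using ti unfolding translation_invariant_def by simp
  also have "\<dots> = (\<integral>y. F (\<lambda>i. y (i - v)) \<partial>\<pi>)" by (rule integral_distr[OF sh F])
  finally show ?thesis ..
qed

theorem stationary_mean:
  assumes \<pi>: "config_prob \<pi>" and ti: "translation_invariant \<pi>" and stat: "flow_stationary \<pi>"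
    and fin: "finite_second_moment \<pi>"
  shows "(\<integral>y. real (y 0) \<partial>\<pi>) * (1 - lam * (\<Sum>j | 0 < a j. a j)) = lam * a 0"
proof -
  interpret \<pi>: prob_space \<pi> using \<pi> unfolding config_prob_def by simp
  have sets [measurable_cong]: "sets \<pi> = sets config_space" using \<pi> unfolding config_prob_def by simp
  let ?S = "{j. 0 < a j}"
  let ?R = "departure_rate a"
  note int = pair_moments[OF \<pi> fin]
  define m where "m = (\<integral>y. real (y 0) \<partial>\<pi>)"
  define r where "r = (\<lambda>j. \<integral>y. ?R y 0 * real (y (- j)) \<partial>\<pi>)"
  have mean: "(\<integral>y. real (y i) \<partial>\<pi>) = m" for i
    using translation_invariant_integral[OF \<pi> ti, of "\<lambda>y. real (y i)" i] unfolding m_def by simp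
  have corr: "(\<integral>y. real (y 0) * ?R y j \<partial>\<pi>) = r j" for j
  proof -
    have "(\<integral>y. real (y 0) * ?R y j \<partial>\<pi>) = (\<integral>y. real (y (0 - j)) * ?R (\<lambda>i. y (i - j)) j \<partial>\<pi>)"
      by (rule translation_invariant_integral[OF \<pi> ti, symmetric]) measurable
    then show ?thesis unfolding r_def departure_rate_space_shift by (simp add: mult.commute)
  qed
  have "(\<integral>y. lam - ?R y 0 \<partial>\<pi>) = 0"
  proof (rule stationary_generator[OF \<pi> stat _ _ int(2)[of 0] _ _ mean_step])
    show "integrable \<pi> (\<lambda>y. lam - ?R y 0)" using int(4)[of 0] by simp
  qed auto
  then have R: "(\<integral>y. ?R y 0 \<partial>\<pi>) = lam" using int(4)[of 0] by (simp add: \<pi>.prob_space)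
  have sum_r: "(\<Sum>j\<in>?S. a j * r j) = m"
  proof -
    have "(\<Sum>j\<in>?S. a j * r j) = (\<integral>y. (\<Sum>j\<in>?S. a j * (?R y 0 * real (y (- j)))) \<partial>\<pi>)"
      unfolding r_def using int(3)[of 0] by (subst Bochner_Integration.integral_sum) auto
    also have "\<dots> = (\<integral>y. real (y 0) \<partial>\<pi>)"
    proof (rule Bochner_Integration.integral_cong[OF refl])
      fix y
      let ?s = "\<Sum>j\<in>?S. a j * real (y (0 - j))"
      have "(\<Sum>j\<in>?S. a j * (?R y 0 * real (y (- j)))) = ?R y 0 * ?s"
        unfolding sum_distrib_left by (intro sum.cong) auto
      also have "\<dots> = real (y 0)"
      \<comment> \<open>With zero interference the queue at 0 is itself empty, so the convention for
        \<open>0 / 0\<close> agrees with the identity.\<close>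
      proof (cases "?s = 0")
        case True
        then have "y 0 = 0" using interference_sum_ge[of y 0] a_zero
          by (auto simp: mult_le_0_iff)
        then show ?thesis using True by simp
      qed (simp add: departure_rate_def)
      finally show "(\<Sum>j\<in>?S. a j * (?R y 0 * real (y (- j)))) = real (y 0)" .
    qed
    finally show ?thesis unfolding m_def .
  qed
  \<comment> \<open>The substitution of -j for j, with \<open>a\<close> symmetric.\<close>
  have sum_r': "(\<Sum>j\<in>?S. a j * (\<integral>y. ?R y 0 * real (y j) \<partial>\<pi>)) = m"
  proof -
    have "(\<Sum>j\<in>?S. a j * (\<integral>y. ?R y 0 * real (y j) \<partial>\<pi>)) = (\<Sum>j\<in>?S. a j * r j)"
      by (rule sum.reindex_bij_witness[of _ uminus uminus]) (auto simp: a_sym r_def)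
    then show ?thesis using sum_r by simp
  qed
  have term_int: "integrable \<pi> (\<lambda>y. (lam - ?R y 0) * real (y j) + real (y 0) * (lam - ?R y j) +
      (if 0 = j then lam + ?R y 0 else 0))" and
    term_val: "(\<integral>y. (lam - ?R y 0) * real (y j) + real (y 0) * (lam - ?R y j) +
      (if 0 = j then lam + ?R y 0 else 0) \<partial>\<pi>) =
      2 * lam * m - (\<integral>y. ?R y 0 * real (y j) \<partial>\<pi>) - r j + (if 0 = j then 2 * lam else 0)" for j
  proof -
    have 1: "has_bochner_integral \<pi> (\<lambda>y. (lam - ?R y 0) * real (y j)) (lam * m - (\<integral>y. ?R y 0 * real (y j) \<partial>\<pi>))"
      using int(2)[of j] int(3)[of 0 j] mean[of j] by (simp add: has_bochner_integral_iff left_diff_distrib)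
    have 2: "has_bochner_integral \<pi> (\<lambda>y. real (y 0) * (lam - ?R y j)) (lam * m - r j)"
      using int(2)[of 0] int(3)[of j 0] mean[of 0] corr[of j]
      by (simp add: has_bochner_integral_iff right_diff_distrib mult.commute)
    \<comment> \<open>The rate has mean \<open>lam\<close> by the first conservation law, so up and
      down jumps contribute equally, which gives \<open>2 * lam\<close>.\<close>
    have 3: "has_bochner_integral \<pi> (\<lambda>y. if 0 = j then lam + ?R y 0 else 0) (if 0 = j then 2 * lam else 0)"
      using int(4)[of 0] R by (simp add: has_bochner_integral_iff \<pi>.prob_space)
    from has_bochner_integral_add[OF has_bochner_integral_add[OF 1 2] 3]
    show "integrable \<pi> (\<lambda>y. (lam - ?R y 0) * real (y j) + real (y 0) * (lam - ?R y j) +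
      (if 0 = j then lam + ?R y 0 else 0))"
      "(\<integral>y. (lam - ?R y 0) * real (y j) + real (y 0) * (lam - ?R y j) +
      (if 0 = j then lam + ?R y 0 else 0) \<partial>\<pi>) =
      2 * lam * m - (\<integral>y. ?R y 0 * real (y j) \<partial>\<pi>) - r j + (if 0 = j then 2 * lam else 0)"
      unfolding has_bochner_integral_iff by auto
  qed
  have "(\<integral>y. pair_drift y \<partial>\<pi>) = 0"
  proof (rule stationary_generator[OF \<pi> stat _ _ _ _ _ pair_step])
    show "pair_functional \<in> borel_measurable config_space" unfolding pair_functional_def[abs_def] by measurable
    show "0 \<le> pair_functional y" for y
      unfolding pair_functional_def using a_nonneg by (intro sum_nonneg) simp
    show "integrable \<pi> pair_functional" unfolding pair_functional_def[abs_def] using int(1) by auto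
    show "integrable \<pi> pair_drift" unfolding pair_drift_def[abs_def] using term_int by auto
    show "integrable \<pi> (\<lambda>y. pair_error y * error_constant)" unfolding pair_error_def[abs_def] using int(2) by auto
  qed
  also have "(\<integral>y. pair_drift y \<partial>\<pi>) =
      (\<Sum>j\<in>?S. a j * (2 * lam * m - (\<integral>y. ?R y 0 * real (y j) \<partial>\<pi>) - r j + (if 0 = j then 2 * lam else 0)))"
    unfolding pair_drift_def
    by (subst Bochner_Integration.integral_sum)
      (rule integrable_mult_right[OF term_int], simp only: integral_mult_right_zero term_val)
  also have "\<dots> = 2 * lam * m * (\<Sum>j\<in>?S. a j) - m - m + (\<Sum>j\<in>?S. a j * (if 0 = j then 2 * lam else 0))"
  proof -
    have "(\<Sum>j\<in>?S. a j * (2 * lam * m - (\<integral>y. ?R y 0 * real (y j) \<partial>\<pi>) - r j + (if 0 = j then 2 * lam else 0))) =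
        (\<Sum>j\<in>?S. a j * (2 * lam * m)) - (\<Sum>j\<in>?S. a j * (\<integral>y. ?R y 0 * real (y j) \<partial>\<pi>)) -
        (\<Sum>j\<in>?S. a j * r j) + (\<Sum>j\<in>?S. a j * (if 0 = j then 2 * lam else 0))"
      by (simp add: sum.distrib[symmetric] sum_subtractf[symmetric] algebra_simps)
    then show ?thesis unfolding sum_r sum_r' by (simp add: sum_distrib_right[symmetric] mult.commute)
  qed
  also have "(\<Sum>j\<in>?S. a j * (if 0 = j then 2 * lam else 0)) = a 0 * (2 * lam)"
    using finite_support a_zero by (simp add: if_distrib[of "(*) _"] sum.delta cong: if_cong)
  finally show ?thesis unfolding m_def[symmetric] by (simp add: algebra_simps)
qed

end

section \<open>Laws on the configuration space\<close>

text \<open>Links the laws in the problem, taken under the completion for a possibly nonmeasurable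
  map, with the law of a measurable version that agrees almost everywhere.\<close>

lemma distr_completion_AE:
  assumes f: "f \<in> N \<rightarrow>\<^sub>M K" and ae: "AE x in N. g x = f x" and g: "\<And>x. g x \<in> space K"
  shows "distr (completion N) K g = distr N K f"
proof -
  have fc: "f \<in> completion N \<rightarrow>\<^sub>M K" by (rule measurable_completion[OF f])
  have aec: "AE x in completion N. g x = f x" by (rule AE_completion[OF ae])
  have gc: "g \<in> completion N \<rightarrow>\<^sub>M K"
  proof (rule measurableI)
    fix X assume X: "X \<in> sets K"
    show "g -` X \<inter> space (completion N) \<in> sets (completion N)"
    proof (rule completion.in_sets_AE[where A = "f -` X \<inter> space (completion N)"])
      show "AE x in completion N. (x \<in> f -` X \<inter> space (completion N)) = (x \<in> g -` X \<inter> space (completion N))"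
        using aec by eventually_elim auto
    qed (use measurable_sets[OF fc X] in auto)
  qed (rule g)
  have "distr (completion N) K g = distr (completion N) K f"
    by (rule distr_cong_AE[OF refl refl aec gc fc])
  also have "\<dots> = distr N K f" by (rule distr_completion[OF f])
  finally show ?thesis .
qed

lemma distr_pair_second:
  assumes "prob_space N" "prob_space N'"
  shows "distr (N \<Otimes>\<^sub>M N') N' snd = N'"
proof (rule measure_eqI)
  interpret N: prob_space N by fact
  interpret N': prob_space N' by fact
  fix X assume "X \<in> sets (distr (N \<Otimes>\<^sub>M N') N' snd)"
  then have X: "X \<in> sets N'" by simp
  have "snd -` X \<inter> space (N \<Otimes>\<^sub>M N') = space N \<times> X"
    using sets.sets_into_space[OF X] by (auto simp: space_pair_measure)
  then show "emeasure (distr (N \<Otimes>\<^sub>M N') N' snd) X = emeasure N' X"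
    using X by (simp add: emeasure_distr N'.emeasure_pair_measure_Times N.emeasure_space_1)
qed simp

definition cylinder :: "(int ^ 'd) set \<Rightarrow> (int ^ 'd \<Rightarrow> nat set) \<Rightarrow> (int ^ 'd \<Rightarrow> nat) set" where
  "cylinder F B = {y. \<forall>i\<in>F. y i \<in> B i}"

lemma cylinder_sets:
  assumes "finite F"
  shows "cylinder F B \<in> sets config_space"
proof -
  have "{y \<in> space config_space. \<forall>i\<in>F. y i \<in> B i} \<in> sets config_space"
    using assms by measurable
  then show ?thesis unfolding cylinder_def by simp
qed

lemma config_prob_eqI:
  assumes \<mu>: "config_prob \<mu>" and \<nu>: "config_prob \<nu>"
    and eq: "\<And>F B. finite F \<Longrightarrow> measure \<mu> (cylinder F B) = measure \<nu> (cylinder F B)"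
  shows "\<mu> = \<nu>"
proof -
  interpret \<mu>: prob_space \<mu> using \<mu> unfolding config_prob_def by simp
  interpret \<nu>: prob_space \<nu> using \<nu> unfolding config_prob_def by simp
  show ?thesis
  proof (rule measure_eqI_PiM_infinite)
    show "sets \<mu> = sets (PiM UNIV (\<lambda>_. count_space UNIV))" "sets \<nu> = sets (PiM UNIV (\<lambda>_. count_space UNIV))"
      using \<mu> \<nu> unfolding config_prob_def config_space_def by auto
    fix B and F :: "(int ^ 'a) set" assume F: "finite F"
    have "prod_emb UNIV (\<lambda>_. count_space UNIV) F (Pi\<^sub>E F B) = cylinder F B"
      unfolding cylinder_def prod_emb_def by (auto simp: PiE_iff)
    then show "emeasure \<mu> (prod_emb UNIV (\<lambda>_. count_space UNIV) F (Pi\<^sub>E F B)) =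
        emeasure \<nu> (prod_emb UNIV (\<lambda>_. count_space UNIV) F (Pi\<^sub>E F B))"
      using eq[OF F] by (simp add: \<mu>.emeasure_eq_measure \<nu>.emeasure_eq_measure)
  qed (rule \<mu>.finite_measure_axioms)
qed

lemma config_prob_distr:
  assumes "prob_space N" "Y \<in> N \<rightarrow>\<^sub>M config_space"
  shows "config_prob (distr N config_space Y)"
  using prob_space.prob_space_distr[OF assms] unfolding config_prob_def by simp

text \<open>Eventual equality in each coordinate becomes eventual equality of cylinder indicators,
  as a cylinder involves finitely many coordinates; dominated convergence does the rest.\<close>

lemma cylinder_convergence:
  fixes Y :: "nat \<Rightarrow> 'a \<Rightarrow> int ^ 'd \<Rightarrow> nat"
  assumes N: "prob_space N" and Y: "\<And>n. Y n \<in> N \<rightarrow>\<^sub>M config_space" and Z: "Z \<in> N \<rightarrow>\<^sub>M config_space"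
    and conv: "AE \<omega> in N. \<forall>i. \<forall>\<^sub>F n in sequentially. Y n \<omega> i = Z \<omega> i" and F: "finite F"
  shows "(\<lambda>n. measure (distr N config_space (Y n)) (cylinder F B)) \<longlonglongrightarrow>
    measure (distr N config_space Z) (cylinder F B)"
proof -
  interpret N: prob_space N by fact
  let ?C = "cylinder F B"
  have val: "measure (distr N config_space X) ?C = (\<integral>\<omega>. indicator ?C (X \<omega>) \<partial>N)"
    if X: "X \<in> N \<rightarrow>\<^sub>M config_space" for X
  proof -
    have "measure (distr N config_space X) ?C = measure N (X -` ?C \<inter> space N)"
      by (rule measure_distr[OF X cylinder_sets[OF F]])
    also have "\<dots> = (\<integral>\<omega>. indicator (X -` ?C \<inter> space N) \<omega> \<partial>N)"
      using measurable_sets[OF X cylinder_sets[OF F]] by simp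
    also have "\<dots> = (\<integral>\<omega>. indicator ?C (X \<omega>) \<partial>N)"
      by (intro Bochner_Integration.integral_cong) (auto simp: indicator_def)
    finally show ?thesis .
  qed
  have ind: "(\<lambda>\<omega>. indicator ?C (X \<omega>) :: real) \<in> borel_measurable N" if "X \<in> N \<rightarrow>\<^sub>M config_space" for X
    by (rule measurable_compose[OF that]) (use cylinder_sets[OF F] in simp)
  have "(\<lambda>n. \<integral>\<omega>. indicator ?C (Y n \<omega>) \<partial>N) \<longlonglongrightarrow> (\<integral>\<omega>. indicator ?C (Z \<omega>) \<partial>N :: real)"
  proof (rule integral_dominated_convergence[where w = "\<lambda>_. 1"])
    show "AE \<omega> in N. (\<lambda>n. indicator ?C (Y n \<omega>)) \<longlonglongrightarrow> (indicator ?C (Z \<omega>) :: real)"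
      using conv
    proof eventually_elim
      case (elim \<omega>)
      have "\<forall>\<^sub>F n in sequentially. \<forall>i\<in>F. Y n \<omega> i = Z \<omega> i"
        using elim by (intro eventually_ball_finite[OF F]) auto
      then have "\<forall>\<^sub>F n in sequentially. indicator ?C (Y n \<omega>) = (indicator ?C (Z \<omega>) :: real)"
        by eventually_elim (simp add: cylinder_def indicator_def)
      then show ?case by (rule tendsto_eventually)
    qed
  qed (use ind Y Z in \<open>auto simp: indicator_def\<close>)
  then show ?thesis using val[OF Y] val[OF Z] by simp
qed

section \<open>The law of the system started empty\<close>

context network
begin

lemma AE_good_pair:
  assumes "prob_space N"
  shows "AE x in N \<Otimes>\<^sub>M M. drive (snd x) \<in> good"
proof -
  interpret N: prob_space N by fact
  interpret P: pair_prob_space N M ..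
  have "(\<lambda>x. drive (snd x)) -` good \<inter> space (N \<Otimes>\<^sub>M M) \<in> sets (N \<Otimes>\<^sub>M M)"
    by (rule measurable_sets[OF measurable_compose[OF measurable_snd drive_measurable] good_sets])
  also have "(\<lambda>x. drive (snd x)) -` good \<inter> space (N \<Otimes>\<^sub>M M) = {x \<in> space (N \<Otimes>\<^sub>M M). drive (snd x) \<in> good}" by auto
  finally show ?thesis by (rule P.AE_pair_measure) (use AE_good in simp)
qed

lemma stationary_iff:
  assumes "config_prob \<pi>"
  shows "stationary M a A D \<pi> \<longleftrightarrow> flow_stationary \<pi>"
proof -
  have \<pi>: "prob_space \<pi>" "sets \<pi> = sets config_space" using assms unfolding config_prob_def by auto
  have "distr (completion (\<pi> \<Otimes>\<^sub>M M)) config_space (\<lambda>(\<xi>, \<omega>). evolve a (\<lambda>i. A i \<omega>) (\<lambda>i. D i \<omega>) 0 \<xi> t) =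
      distr (\<pi> \<Otimes>\<^sub>M M) config_space (\<lambda>(\<xi>, \<omega>). flow 0 t \<xi> (drive \<omega>))" if "0 \<le> t" for t
  proof (rule distr_completion_AE[OF flow_drive_measurable[OF that \<pi>(2)]])
    show "AE x in \<pi> \<Otimes>\<^sub>M M. (case x of (\<xi>, \<omega>) \<Rightarrow> evolve a (\<lambda>i. A i \<omega>) (\<lambda>i. D i \<omega>) 0 \<xi> t) =
        (case x of (\<xi>, \<omega>) \<Rightarrow> flow 0 t \<xi> (drive \<omega>))"
      using AE_good_pair[OF \<pi>(1)] by eventually_elim (auto simp: flow_def split_beta)
  qed simp
  then show ?thesis unfolding stationary_def flow_stationary_def by simp
qed

text \<open>Shifted, translated and spliced patterns share the law of \<open>drive\<close>; whatever
  depends measurably on the pattern can be computed from any of them, and each is almost surely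
  good.\<close>

lemma law_transfer:
  assumes X: "X \<in> N \<rightarrow>\<^sub>M pats" and law: "distr N pats X = distr M pats drive"
  shows "f \<in> pats \<rightarrow>\<^sub>M K \<Longrightarrow> distr N K (\<lambda>\<omega>. f (X \<omega>)) = distr M K (\<lambda>\<omega>. f (drive \<omega>))"
    and "AE \<omega> in N. X \<omega> \<in> good"
proof -
  { assume f: "f \<in> pats \<rightarrow>\<^sub>M K"
    have "distr N K (\<lambda>\<omega>. f (X \<omega>)) = distr (distr N pats X) K f"
      using distr_distr[OF f X] by (simp add: comp_def)
    also have "\<dots> = distr M K (\<lambda>\<omega>. f (drive \<omega>))"
      unfolding law using distr_distr[OF f drive_measurable] by (simp add: comp_def)
    finally show "distr N K (\<lambda>\<omega>. f (X \<omega>)) = distr M K (\<lambda>\<omega>. f (drive \<omega>))" . }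
  have g: "{g \<in> space pats. g \<in> good} \<in> sets pats" "{g \<in> space pats. g \<in> good} = good"
    using good_sets sets.sets_into_space[OF good_sets] by (auto simp: Int_def[symmetric] Int_absorb1)
  have "AE g in distr M pats drive. g \<in> good"
    using AE_good by (subst AE_distr_iff[OF drive_measurable g(1)])
  then have "AE g in distr N pats X. g \<in> good" unfolding law .
  then show "AE \<omega> in N. X \<omega> \<in> good" by (subst (asm) AE_distr_iff[OF X g(1)])
qed

lemma flow_pattern_measurable:
  assumes "s \<le> t"
  shows "flow s t \<xi> \<in> pats \<rightarrow>\<^sub>M config_space"
proof -
  have "(\<lambda>g. (\<xi>, g)) \<in> pats \<rightarrow>\<^sub>M config_space \<Otimes>\<^sub>M pats"
    by (intro measurable_Pair measurable_const) auto
  from measurable_compose[OF this flow_measurable[OF assms]] show ?thesis by simp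
qed

definition empty_law :: "real \<Rightarrow> (int ^ 'd \<Rightarrow> nat) measure" where
  "empty_law t = distr M config_space (\<lambda>\<omega>. flow 0 t (\<lambda>_. 0) (drive \<omega>))"

lemma flow_shift:
  assumes "g \<in> good" "shift_pattern v g \<in> good" "s \<le> t"
  shows "flow s t \<xi> (shift_pattern v g) = flow (s + v) (t + v) \<xi> g"
proof -
  have eq: "arrivals (shift_pattern v g) = (\<lambda>i. {t. t + v \<in> arrivals g i})"
    "services (shift_pattern v g) = (\<lambda>i. {(t, U). (t + v, U) \<in> services g i})"
    unfolding arrivals_def services_def shift_pattern_def by auto
  show ?thesis
    using evolve_time_shift[OF good_driven[OF assms(1)] good_driven[OF assms(2), unfolded eq] assms(3), of \<xi>] assms
    unfolding flow_def by (simp add: eq)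
qed

lemma empty_law_shift:
  assumes "s \<le> t"
  shows "distr M config_space (\<lambda>\<omega>. flow s t (\<lambda>_. 0) (drive \<omega>)) = empty_law (t - s)"
proof -
  let ?X = "\<lambda>\<omega>. shift_pattern s (drive \<omega>)"
  have X: "?X \<in> M \<rightarrow>\<^sub>M pats" by (rule measurable_compose[OF drive_measurable shift_measurable])
  have m: "flow 0 (t - s) (\<lambda>_. 0) \<in> pats \<rightarrow>\<^sub>M config_space" using assms by (intro flow_pattern_measurable) simp
  have "distr M config_space (\<lambda>\<omega>. flow s t (\<lambda>_. 0) (drive \<omega>)) =
      distr M config_space (\<lambda>\<omega>. flow 0 (t - s) (\<lambda>_. 0) (?X \<omega>))"
  proof (rule distr_cong_AE[OF refl refl _ flow_drive_measurable1[OF assms] measurable_compose[OF X m]])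
    show "AE \<omega> in M. flow s t (\<lambda>_. 0) (drive \<omega>) = flow 0 (t - s) (\<lambda>_. 0) (?X \<omega>)"
      using AE_good law_transfer(2)[OF X shift_law]
      by eventually_elim (use assms in \<open>simp add: flow_shift\<close>)
  qed
  also have "\<dots> = empty_law (t - s)"
    unfolding empty_law_def by (rule law_transfer(1)[OF X shift_law m])
  finally show ?thesis .
qed

lemma empty_law_translation_invariant:
  assumes "0 \<le> t"
  shows "translation_invariant (empty_law t)"
  unfolding translation_invariant_def
proof
  fix v :: "int ^ 'd"
  let ?X = "\<lambda>\<omega>. translate_pattern v (drive \<omega>)"
  have X: "?X \<in> M \<rightarrow>\<^sub>M pats" by (rule measurable_compose[OF drive_measurable translate_measurable])
  have m: "flow 0 t (\<lambda>_. 0) \<in> pats \<rightarrow>\<^sub>M config_space" using assms by (intro flow_pattern_measurable) simp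
  have sh: "(\<lambda>y i. y (i - v)) \<in> config_space \<rightarrow>\<^sub>M config_space"
    unfolding measurable_config_iff by simp
  have "distr (empty_law t) config_space (\<lambda>y i. y (i - v)) =
      distr M config_space (\<lambda>\<omega> i. flow 0 t (\<lambda>_. 0) (drive \<omega>) (i - v))"
    unfolding empty_law_def by (subst distr_distr[OF sh flow_drive_measurable1[OF assms]]) (simp add: comp_def)
  also have "\<dots> = distr M config_space (\<lambda>\<omega>. flow 0 t (\<lambda>_. 0) (?X \<omega>))"
  proof (rule distr_cong_AE[OF refl refl _ measurable_compose[OF flow_drive_measurable1[OF assms] sh] measurable_compose[OF X m]])
    show "AE \<omega> in M. (\<lambda>i. flow 0 t (\<lambda>_. 0) (drive \<omega>) (i - v)) = flow 0 t (\<lambda>_. 0) (?X \<omega>)"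
      using AE_good law_transfer(2)[OF X translate_law]
    proof eventually_elim
      case (elim \<omega>)
      have eq: "arrivals (?X \<omega>) = (\<lambda>i. A (i - v) \<omega>)" "services (?X \<omega>) = (\<lambda>i. D (i - v) \<omega>)"
        unfolding arrivals_def services_def translate_pattern_def drive_def by auto
      show ?case
        using evolve_space_shift[of a "\<lambda>i. A i \<omega>" "\<lambda>i. D i \<omega>" v 0 t "\<lambda>_. 0"]
          good_driven[OF elim(1)] good_driven[OF elim(2), unfolded eq] assms elim
        unfolding flow_def by (simp add: eq)
    qed
  qed
  also have "\<dots> = empty_law t"
    unfolding empty_law_def by (rule law_transfer(1)[OF X translate_law m])
  finally show "distr (empty_law t) config_space (\<lambda>y i. y (i - v)) = empty_law t" .
qed

lemma random_initial_state:
  assumes X: "X \<in> M \<rightarrow>\<^sub>M config_space" and "0 \<le> t"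
  shows "(\<lambda>(\<omega>, \<omega>'). flow 0 t (X \<omega>) (drive \<omega>')) \<in> M \<Otimes>\<^sub>M M \<rightarrow>\<^sub>M config_space"
    and "distr (distr M config_space X \<Otimes>\<^sub>M M) config_space (\<lambda>(\<xi>, \<omega>). flow 0 t \<xi> (drive \<omega>)) =
      distr (M \<Otimes>\<^sub>M M) config_space (\<lambda>(\<omega>, \<omega>'). flow 0 t (X \<omega>) (drive \<omega>'))"
proof -
  have fl: "(\<lambda>(\<xi>, \<omega>). flow 0 t \<xi> (drive \<omega>)) \<in> config_space \<Otimes>\<^sub>M M \<rightarrow>\<^sub>M config_space"
    by (rule flow_drive_measurable[OF assms(2) refl])
  have pair: "(\<lambda>(\<omega>, \<omega>'). (X \<omega>, \<omega>')) \<in> M \<Otimes>\<^sub>M M \<rightarrow>\<^sub>M config_space \<Otimes>\<^sub>M M"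
    using X by measurable
  show "(\<lambda>(\<omega>, \<omega>'). flow 0 t (X \<omega>) (drive \<omega>')) \<in> M \<Otimes>\<^sub>M M \<rightarrow>\<^sub>M config_space"
    using measurable_compose[OF pair fl] by (simp add: split_beta')
  have "distr M config_space X \<Otimes>\<^sub>M M = distr M config_space X \<Otimes>\<^sub>M distr M M (\<lambda>\<omega>. \<omega>)"
    by (simp add: distr_id[unfolded id_def])
  also have "\<dots> = distr (M \<Otimes>\<^sub>M M) (config_space \<Otimes>\<^sub>M M) (\<lambda>(\<omega>, \<omega>'). (X \<omega>, \<omega>'))"
    by (rule pair_measure_distr[OF X]) (simp_all add: distr_id[unfolded id_def] sigma_finite_measure_axioms)
  finally show "distr (distr M config_space X \<Otimes>\<^sub>M M) config_space (\<lambda>(\<xi>, \<omega>). flow 0 t \<xi> (drive \<omega>)) =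
      distr (M \<Otimes>\<^sub>M M) config_space (\<lambda>(\<omega>, \<omega>'). flow 0 t (X \<omega>) (drive \<omega>'))"
    using distr_distr[OF fl pair] by (simp add: comp_def split_beta')
qed

text \<open>The initial state is realised as the outcome over (-T, 0] of one copy of the driving
  processes, the later evolution by an independent copy. Splicing the copies at 0 gives one pattern
  with the original law, whose flow from -T to t passes through that state.\<close>

theorem empty_law_semigroup:
  assumes "0 \<le> T" "0 \<le> t"
  shows "distr (empty_law T \<Otimes>\<^sub>M M) config_space (\<lambda>(\<xi>, \<omega>). flow 0 t \<xi> (drive \<omega>)) = empty_law (T + t)"
proof -
  interpret MM: pair_prob_space M M ..
  let ?z = "\<lambda>_. 0 :: nat"
  let ?X = "\<lambda>(\<omega>, \<omega>'). splice_at_zero (drive \<omega>) (drive \<omega>')"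
  have X: "?X \<in> M \<Otimes>\<^sub>M M \<rightarrow>\<^sub>M pats"
  proof -
    have "(\<lambda>x. (drive (fst x), drive (snd x))) \<in> M \<Otimes>\<^sub>M M \<rightarrow>\<^sub>M pats \<Otimes>\<^sub>M pats"
      using drive_measurable by measurable
    from measurable_compose[OF this splice_measurable] show ?thesis by (simp add: split_beta')
  qed
  have past: "(\<lambda>\<omega>. flow (- T) 0 ?z (drive \<omega>)) \<in> M \<rightarrow>\<^sub>M config_space"
    using assms by (intro flow_drive_measurable1) simp
  have m: "flow (- T) t ?z \<in> pats \<rightarrow>\<^sub>M config_space" using assms by (intro flow_pattern_measurable) simp
  have "empty_law T = distr M config_space (\<lambda>\<omega>. flow (- T) 0 ?z (drive \<omega>))"
    using empty_law_shift[of "- T" 0] assms by simp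
  then have "distr (empty_law T \<Otimes>\<^sub>M M) config_space (\<lambda>(\<xi>, \<omega>). flow 0 t \<xi> (drive \<omega>)) =
      distr (M \<Otimes>\<^sub>M M) config_space (\<lambda>(\<omega>, \<omega>'). flow 0 t (flow (- T) 0 ?z (drive \<omega>)) (drive \<omega>'))"
    using random_initial_state(2)[OF past assms(2)] by simp
  also have "\<dots> = distr (M \<Otimes>\<^sub>M M) config_space (\<lambda>x. flow (- T) t ?z (?X x))"
  proof (rule distr_cong_AE[OF refl refl _ _ measurable_compose[OF X m]])
    show "(\<lambda>(\<omega>, \<omega>'). flow 0 t (flow (- T) 0 ?z (drive \<omega>)) (drive \<omega>')) \<in> M \<Otimes>\<^sub>M M \<rightarrow>\<^sub>M config_space"
      by (rule random_initial_state(1)[OF past assms(2)])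
    have "AE x in M \<Otimes>\<^sub>M M. drive (fst x) \<in> good"
    proof -
      have "(\<lambda>x. drive (fst x)) -` good \<inter> space (M \<Otimes>\<^sub>M M) \<in> sets (M \<Otimes>\<^sub>M M)"
        by (rule measurable_sets[OF measurable_compose[OF measurable_fst drive_measurable] good_sets])
      also have "(\<lambda>x. drive (fst x)) -` good \<inter> space (M \<Otimes>\<^sub>M M) = {x \<in> space (M \<Otimes>\<^sub>M M). drive (fst x) \<in> good}" by auto
      finally show ?thesis by (rule MM.AE_pair_measure) (use AE_good in simp)
    qed
    then show "AE x in M \<Otimes>\<^sub>M M. (case x of (\<omega>, \<omega>') \<Rightarrow> flow 0 t (flow (- T) 0 ?z (drive \<omega>)) (drive \<omega>')) =
        flow (- T) t ?z (?X x)"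
      using AE_good_pair[OF prob_space_axioms] law_transfer(2)[OF X splice_law]
    proof eventually_elim
      case (elim x)
      obtain \<omega> \<omega>' where x: "x = (\<omega>, \<omega>')" by (cases x)
      let ?g = "splice_at_zero (drive \<omega>) (drive \<omega>')"
      have good: "drive \<omega> \<in> good" "drive \<omega>' \<in> good" "?g \<in> good" using elim unfolding x by auto
      note dr = good_driven[OF good(1)] good_driven[OF good(2)] good_driven[OF good(3)]
      have p: "evolve a (arrivals ?g) (services ?g) (- T) ?z 0 =
          evolve a (arrivals (drive \<omega>)) (services (drive \<omega>)) (- T) ?z 0"
        by (rule evolve_cong_driving[OF dr(3,1)])
          (use assms in \<open>auto simp: arrivals_def services_def splice_at_zero_def simp del: arrivals_drive services_drive\<close>)
      have f: "evolve a (arrivals ?g) (services ?g) 0 \<xi> t =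
          evolve a (arrivals (drive \<omega>')) (services (drive \<omega>')) 0 \<xi> t" for \<xi>
        by (rule evolve_cong_driving[OF dr(3,2)])
          (use assms in \<open>auto simp: arrivals_def services_def splice_at_zero_def simp del: arrivals_drive services_drive\<close>)
      have "evolve a (arrivals ?g) (services ?g) 0 (evolve a (arrivals ?g) (services ?g) (- T) ?z 0) t =
          evolve a (arrivals ?g) (services ?g) (- T) ?z t"
        by (rule driven.evolve_evolve[OF dr(3)]) (use assms in auto)
      then show ?case using good unfolding x flow_def p f by simp
    qed
  qed
  also have "\<dots> = distr M config_space (\<lambda>\<omega>. flow (- T) t ?z (drive \<omega>))"
    by (rule law_transfer(1)[OF X splice_law m])
  also have "\<dots> = empty_law (T + t)"
    using empty_law_shift[of "- T" t] assms by (simp add: add.commute)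
  finally show ?thesis .
qed

end

section \<open>The minimal stationary solution\<close>

context network
begin

text \<open>One driving pattern serves all starting times, as in the construction of the minimal
  solution, so these states are monotone in \<open>T\<close>.\<close>

definition coupled :: "real \<Rightarrow> 'w \<Rightarrow> int ^ 'd \<Rightarrow> nat" where
  "coupled T \<omega> = flow (- T) 0 (\<lambda>_. 0) (drive \<omega>)"

definition bounded_at :: "int ^ 'd \<Rightarrow> 'w \<Rightarrow> bool" where
  "bounded_at i \<omega> \<longleftrightarrow> (\<exists>k. \<forall>n::nat. coupled (real n) \<omega> i \<le> k)"

text \<open>The supremum over \<open>T\<close>, as a natural number, when \<open>bounded_at\<close>
  holds. Integer times suffice by monotonicity and make the definition visibly measurable.\<close>

definition limit_config :: "'w \<Rightarrow> int ^ 'd \<Rightarrow> nat" where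
  "limit_config \<omega> i = (LEAST k. \<forall>n::nat. coupled (real n) \<omega> i \<le> k)"

lemma coupled_measurable:
  assumes "0 \<le> T"
  shows "coupled T \<in> M \<rightarrow>\<^sub>M config_space"
  unfolding coupled_def[abs_def] using assms by (intro flow_drive_measurable1) simp

lemma coupled_component_measurable [measurable]: "(\<lambda>\<omega>. coupled (real n) \<omega> i) \<in> M \<rightarrow>\<^sub>M count_space UNIV"
  using coupled_measurable[of "real n"] unfolding measurable_config_iff by simp

lemma coupled_law: "0 \<le> T \<Longrightarrow> distr M config_space (coupled T) = empty_law T"
  unfolding coupled_def[abs_def] using empty_law_shift[of "- T" 0] by simp

lemma limit_config_measurable: "limit_config \<in> M \<rightarrow>\<^sub>M config_space"
  unfolding measurable_config_iff limit_config_def by measurable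

lemma coupled_mono:
  assumes "drive \<omega> \<in> good" "0 \<le> T" "T \<le> T'"
  shows "coupled T \<omega> \<le> coupled T' \<omega>"
proof -
  interpret driven a "\<lambda>i. A i \<omega>" "\<lambda>i. D i \<omega>" using good_driven[OF assms(1)] by simp
  let ?ev = "evolve a (\<lambda>i. A i \<omega>) (\<lambda>i. D i \<omega>)"
  have "?ev (- T) (\<lambda>_. 0) 0 \<le> ?ev (- T) (?ev (- T') (\<lambda>_. 0) (- T)) 0"
    using assms by (intro evolve_mono) (auto simp: le_fun_def)
  also have "\<dots> = ?ev (- T') (\<lambda>_. 0) 0" using assms by (intro evolve_evolve) auto
  finally show ?thesis using assms(1) unfolding coupled_def flow_def by simp
qed

lemma x_from_coupled: "drive \<omega> \<in> good \<Longrightarrow> x_from a A D T 0 \<omega> = coupled T \<omega>"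
  unfolding x_from_def coupled_def flow_def by simp

text \<open>Monotonicity in \<open>T\<close> turns the limit over real times into a supremum over
  integers: each real time lies below its ceiling.\<close>

lemma x_inf_SUP:
  assumes "drive \<omega> \<in> good"
  shows "x_inf a A D 0 \<omega> i = (SUP n::nat. enat (coupled (real n) \<omega> i))"
proof -
  let ?x = "\<lambda>T. enat (coupled T \<omega> i)"
  let ?S = "SUP n::nat. ?x (real n)"
  have mono: "?x T \<le> ?x T'" if "0 \<le> T" "T \<le> T'" for T T'
    using coupled_mono[OF assms that] by (simp add: le_fun_def)
  have "(?x \<longlongrightarrow> ?S) at_top"
  proof (rule order_tendstoI)
    fix y assume "y < ?S"
    then obtain n :: nat where n: "y < ?x (real n)" by (auto simp: less_SUP_iff)
    show "\<forall>\<^sub>F T in at_top. y < ?x T"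
      using eventually_ge_at_top[of "real n"] by eventually_elim (use n mono[of "real n"] in \<open>auto intro: less_le_trans\<close>)
  next
    fix y assume y: "?S < y"
    show "\<forall>\<^sub>F T in at_top. ?x T < y"
      using eventually_ge_at_top[of 0]
    proof eventually_elim
      case (elim T)
      have "?x T \<le> ?x (real (nat \<lceil>T\<rceil>))" using elim by (intro mono) linarith+
      also have "\<dots> \<le> ?S" by (rule SUP_upper) simp
      finally show ?case using y by simp
    qed
  qed
  then have "Lim at_top ?x = ?S" by (intro tendsto_Lim) auto
  then show ?thesis unfolding x_inf_def x_from_coupled[OF assms] .
qed

lemma limit_config_props:
  assumes "drive \<omega> \<in> good" "bounded_at i \<omega>"
  shows "coupled (real n) \<omega> i \<le> limit_config \<omega> i"
    and "\<forall>\<^sub>F T in at_top. coupled T \<omega> i = limit_config \<omega> i"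
    and "x_inf a A D 0 \<omega> i = enat (limit_config \<omega> i)"
    and "\<exists>n. coupled (real n) \<omega> i = limit_config \<omega> i"
proof -
  let ?P = "\<lambda>k. \<forall>n::nat. coupled (real n) \<omega> i \<le> k"
  let ?L = "limit_config \<omega> i"
  have L: "?P ?L" unfolding limit_config_def using assms(2) unfolding bounded_at_def by (rule LeastI_ex)
  then show "coupled (real n) \<omega> i \<le> ?L" ..
  \<comment> \<open>The supremum of integers is attained: otherwise \<open>?L - 1\<close> would
    already be an upper bound. Attainment gives convergence in the strong form of eventual
    equality.\<close>
  have "\<exists>n. \<not> coupled (real n) \<omega> i < ?L"
  proof (rule ccontr)
    assume less: "\<nexists>n. \<not> coupled (real n) \<omega> i < ?L"
    then have "0 < ?L" by (metis not_less_zero gr0I)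
    moreover have "?P (?L - 1)" using less by (metis One_nat_def Suc_pred calculation less_Suc_eq_le)
    ultimately show False using not_less_Least[of "?L - 1" ?P] unfolding limit_config_def by simp
  qed
  then obtain n where n: "coupled (real n) \<omega> i = ?L" using L by (metis order_le_less)
  then show "\<exists>n. coupled (real n) \<omega> i = ?L" ..
  show "\<forall>\<^sub>F T in at_top. coupled T \<omega> i = ?L"
    using eventually_ge_at_top[of "real n"]
  proof eventually_elim
    case (elim T)
    have "coupled (real n) \<omega> i \<le> coupled T \<omega> i" using coupled_mono[OF assms(1) _ elim] by (simp add: le_fun_def)
    moreover have "coupled T \<omega> i \<le> coupled (real (nat \<lceil>T\<rceil>)) \<omega> i"
      using coupled_mono[OF assms(1), of T "real (nat \<lceil>T\<rceil>)"] elim by (simp add: le_fun_def)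
    ultimately show ?case using n L by (metis order_antisym order_trans)
  qed
  show "x_inf a A D 0 \<omega> i = enat ?L"
    unfolding x_inf_SUP[OF assms(1)]
    by (intro antisym SUP_least) (use L n in \<open>auto intro: SUP_upper2[of n]\<close>)
qed

definition moment_sup :: "int ^ 'd \<Rightarrow> 'w \<Rightarrow> ennreal" where
  "moment_sup i \<omega> = (SUP n::nat. (of_nat (coupled (real n) \<omega> i))\<^sup>2)"

text \<open>The moment assumption concerns the queue at 0 alone. By monotone convergence these
  integrals are suprema of second moments of \<open>empty_law\<close>, which do not depend on the
  site.\<close>

lemma moment_sup_integral: "(\<integral>\<^sup>+ \<omega>. moment_sup i \<omega> \<partial>M) = (\<integral>\<^sup>+ \<omega>. moment_sup 0 \<omega> \<partial>M)"
proof -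
  have eq: "(\<integral>\<^sup>+ \<omega>. moment_sup j \<omega> \<partial>M) = (SUP n::nat. \<integral>\<^sup>+ y. (of_nat (y j))\<^sup>2 \<partial>empty_law (real n))" for j
  proof -
    have "(\<integral>\<^sup>+ \<omega>. moment_sup j \<omega> \<partial>M) = (SUP n::nat. \<integral>\<^sup>+ \<omega>. (of_nat (coupled (real n) \<omega> j))\<^sup>2 \<partial>M)"
      unfolding moment_sup_def
    proof (rule nn_integral_monotone_convergence_SUP_AE)
      show "AE \<omega> in M. (of_nat (coupled (real n) \<omega> j))\<^sup>2 \<le> ((of_nat (coupled (real (Suc n)) \<omega> j))\<^sup>2 :: ennreal)" for n
        using AE_good
      proof eventually_elim
        case (elim \<omega>)
        have "coupled (real n) \<omega> j \<le> coupled (real (Suc n)) \<omega> j"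
          using coupled_mono[OF elim, of "real n" "real (Suc n)"] by (simp add: le_fun_def)
        then show ?case by (intro power_mono) auto
      qed
      show "(\<lambda>\<omega>. (of_nat (coupled (real n) \<omega> j))\<^sup>2 :: ennreal) \<in> borel_measurable M" for n
        by measurable
    qed
    moreover have "(\<integral>\<^sup>+ y. (of_nat (y j))\<^sup>2 \<partial>empty_law (real n)) = (\<integral>\<^sup>+ \<omega>. (of_nat (coupled (real n) \<omega> j))\<^sup>2 \<partial>M)" for n :: nat
    proof -
      have "(\<lambda>y. (of_nat (y j))\<^sup>2 :: ennreal) \<in> borel_measurable (distr M config_space (coupled (real n)))"
        unfolding measurable_distr_eq1 by measurable
      from nn_integral_distr[OF coupled_measurable[of "real n"] this] show ?thesis by (simp add: coupled_law)
    qed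
    ultimately show ?thesis by simp
  qed
  have "(\<integral>\<^sup>+ y. (of_nat (y i))\<^sup>2 \<partial>empty_law (real n)) = (\<integral>\<^sup>+ y. (of_nat (y 0))\<^sup>2 \<partial>empty_law (real n))" for n :: nat
  proof -
    have sh: "(\<lambda>y j. y (j - i)) \<in> empty_law (real n) \<rightarrow>\<^sub>M config_space"
      unfolding measurable_config_iff empty_law_def by simp
    have "(\<integral>\<^sup>+ y. (of_nat (y i))\<^sup>2 \<partial>empty_law (real n)) =
        (\<integral>\<^sup>+ y. (of_nat (y i))\<^sup>2 \<partial>distr (empty_law (real n)) config_space (\<lambda>y j. y (j - i)))"
      using empty_law_translation_invariant[of "real n"] unfolding translation_invariant_def by simp
    also have "\<dots> = (\<integral>\<^sup>+ y. (of_nat (y (i - i)))\<^sup>2 \<partial>empty_law (real n))"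
      by (rule nn_integral_distr[OF sh]) (unfold measurable_distr_eq1, measurable)
    finally show ?thesis by simp
  qed
  then show ?thesis unfolding eq by simp
qed

lemma moment_sup_finite:
  assumes "(\<integral>\<^sup>+ \<omega>. (ennreal_of_enat (x_inf a A D 0 \<omega> 0))\<^sup>2 \<partial>completion M) < \<infinity>"
  shows "(\<integral>\<^sup>+ \<omega>. moment_sup i \<omega> \<partial>M) < \<infinity>" "AE \<omega> in M. \<forall>i. bounded_at i \<omega>"
proof -
  have "(\<integral>\<^sup>+ \<omega>. moment_sup 0 \<omega> \<partial>M) \<le> (\<integral>\<^sup>+ \<omega>. (ennreal_of_enat (x_inf a A D 0 \<omega> 0))\<^sup>2 \<partial>M)"
  proof (rule nn_integral_mono_AE)
    show "AE \<omega> in M. moment_sup 0 \<omega> \<le> (ennreal_of_enat (x_inf a A D 0 \<omega> 0))\<^sup>2"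
      using AE_good
    proof eventually_elim
      case (elim \<omega>)
      show ?case unfolding moment_sup_def
      proof (rule SUP_least)
        fix n :: nat
        have "enat (coupled (real n) \<omega> 0) \<le> x_inf a A D 0 \<omega> 0"
          unfolding x_inf_SUP[OF elim] by (rule SUP_upper) simp
        then have "ennreal_of_enat (enat (coupled (real n) \<omega> 0)) \<le> ennreal_of_enat (x_inf a A D 0 \<omega> 0)"
          by (simp only: ennreal_of_enat_le_iff)
        then show "(of_nat (coupled (real n) \<omega> 0))\<^sup>2 \<le> (ennreal_of_enat (x_inf a A D 0 \<omega> 0))\<^sup>2"
          by (intro power_mono) simp_all
      qed
    qed
  qed
  then have fin: "(\<integral>\<^sup>+ \<omega>. moment_sup i \<omega> \<partial>M) < \<infinity>" for i
    using assms unfolding nn_integral_completion moment_sup_integral[of i] by (rule order.strict_trans1)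
  then show "(\<integral>\<^sup>+ \<omega>. moment_sup i \<omega> \<partial>M) < \<infinity>" .
  have "AE \<omega> in M. bounded_at i \<omega>" for i
  proof -
    have "moment_sup i \<in> borel_measurable M" unfolding moment_sup_def[abs_def] by measurable
    from nn_integral_PInf_AE[OF this] fin[of i]
    have "AE \<omega> in M. moment_sup i \<omega> \<noteq> \<infinity>" by simp
    then show ?thesis
    proof eventually_elim
      case (elim \<omega>)
      then have "moment_sup i \<omega> < top" by (simp add: less_top[symmetric])
      then obtain k where k: "moment_sup i \<omega> < of_nat k" using ennreal_Ex_less_of_nat by blast
      have "coupled (real n) \<omega> i \<le> k" for n
      proof -
        let ?b = "coupled (real n) \<omega> i"
        have "of_nat (?b\<^sup>2) \<le> moment_sup i \<omega>"
          unfolding moment_sup_def by (rule SUP_upper2[of n]) simp_all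
        also note k
        finally have "?b\<^sup>2 < k"
          by (simp only: ennreal_of_nat_eq_real_of_nat ennreal_less_iff of_nat_0_le_iff of_nat_less_iff)
        \<comment> \<open>A natural number is at most its square, so a bound on the squares bounds
          the queue itself.\<close>
        moreover have "?b \<le> ?b\<^sup>2" by (simp add: power2_eq_square)
        ultimately show ?thesis by simp
      qed
      then show ?case unfolding bounded_at_def by blast
    qed
  qed
  then show "AE \<omega> in M. \<forall>i. bounded_at i \<omega>" unfolding AE_all_countable by blast
qed

end

section \<open>Existence and uniqueness under the second moment condition\<close>

locale stable_network = network a M lam A D
  for a :: "int ^ 'd \<Rightarrow> real" and M :: "'w measure" and lam A D +
  assumes second_moment: "(\<integral>\<^sup>+ \<omega>. (ennreal_of_enat (x_inf a A D 0 \<omega> 0))\<^sup>2 \<partial>completion M) < \<infinity>"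
begin

definition limit_law :: "(int ^ 'd \<Rightarrow> nat) measure" where
  "limit_law = distr M config_space limit_config"

lemmas AE_bounded = moment_sup_finite(2)[OF second_moment]

lemma limit_law_config_prob: "config_prob limit_law"
  unfolding limit_law_def by (rule config_prob_distr[OF prob_space_axioms limit_config_measurable])

lemma AE_x_inf: "AE \<omega> in M. \<forall>i. x_inf a A D 0 \<omega> i = enat (limit_config \<omega> i)"
  using AE_good AE_bounded by eventually_elim (simp add: limit_config_props(3))

lemma minimal_law_eq: "minimal_law M a A D = limit_law"
  unfolding minimal_law_def limit_law_def
proof (rule distr_completion_AE[OF limit_config_measurable])
  show "AE \<omega> in M. (\<lambda>i. the_enat (x_inf a A D 0 \<omega> i)) = limit_config \<omega>"
    using AE_x_inf by eventually_elim simp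
qed simp

lemma AE_coupled_converges:
  assumes "filterlim \<tau> at_top sequentially"
  shows "AE \<omega> in M. \<forall>i. \<forall>\<^sub>F n in sequentially. coupled (\<tau> n) \<omega> i = limit_config \<omega> i"
  using AE_good AE_bounded
proof eventually_elim
  case (elim \<omega>)
  show ?case
  proof
    fix i
    show "\<forall>\<^sub>F n in sequentially. coupled (\<tau> n) \<omega> i = limit_config \<omega> i"
      using eventually_compose_filterlim[OF limit_config_props(2) assms] elim by blast
  qed
qed

lemma filterlim_real_add: "filterlim (\<lambda>n. real n + t) at_top sequentially"
  using filterlim_tendsto_add_at_top[OF tendsto_const[of t] filterlim_real_sequentially]
  by (simp add: add.commute)

lemma empty_law_converges:
  assumes "finite F" "0 \<le> t"
  shows "(\<lambda>n. measure (empty_law (real n + t)) (cylinder F B)) \<longlonglongrightarrow> measure limit_law (cylinder F B)"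
proof -
  have "(\<lambda>n. measure (distr M config_space (coupled (real n + t))) (cylinder F B)) \<longlonglongrightarrow>
      measure (distr M config_space limit_config) (cylinder F B)"
    using assms
    by (intro cylinder_convergence[OF prob_space_axioms coupled_measurable limit_config_measurable
        AE_coupled_converges[OF filterlim_real_add]]) auto
  then show ?thesis using assms unfolding limit_law_def by (simp add: coupled_law)
qed

lemma limit_law_translation_invariant: "translation_invariant limit_law"
  unfolding translation_invariant_def
proof
  fix v :: "int ^ 'd"
  let ?\<tau> = "\<lambda>y i. y (i - v)"
  have sh: "?\<tau> \<in> config_space \<rightarrow>\<^sub>M config_space" unfolding measurable_config_iff by simp
  have dist: "distr (distr M config_space X) config_space ?\<tau> = distr M config_space (\<lambda>\<omega>. ?\<tau> (X \<omega>))"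
    if "X \<in> M \<rightarrow>\<^sub>M config_space" for X
    using distr_distr[OF sh that] by (simp add: comp_def)
  show "distr limit_law config_space ?\<tau> = limit_law"
  proof (rule config_prob_eqI[OF _ limit_law_config_prob])
    show "config_prob (distr limit_law config_space ?\<tau>)"
      using limit_law_config_prob sh unfolding limit_law_def dist[OF limit_config_measurable]
      by (intro config_prob_distr prob_space_axioms measurable_compose[OF limit_config_measurable])
    fix F B assume F: "finite (F :: (int ^ 'd) set)"
    have "(\<lambda>n. measure (distr M config_space (\<lambda>\<omega>. ?\<tau> (coupled (real n) \<omega>))) (cylinder F B)) \<longlonglongrightarrow>
        measure (distr M config_space (\<lambda>\<omega>. ?\<tau> (limit_config \<omega>))) (cylinder F B)"
    proof (rule cylinder_convergence[OF prob_space_axioms _ _ _ F])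
      show "AE \<omega> in M. \<forall>i. \<forall>\<^sub>F n in sequentially. coupled (real n) \<omega> (i - v) = limit_config \<omega> (i - v)"
        using AE_coupled_converges[OF filterlim_real_sequentially] by eventually_elim simp
    qed (intro measurable_compose[OF _ sh] coupled_measurable limit_config_measurable; simp)+
    moreover have "distr M config_space (\<lambda>\<omega>. ?\<tau> (coupled (real n) \<omega>)) = empty_law (real n)" for n
      using dist[OF coupled_measurable[of "real n"]] empty_law_translation_invariant[of "real n"]
      unfolding translation_invariant_def by (simp add: coupled_law)
    ultimately have "(\<lambda>n. measure (empty_law (real n)) (cylinder F B)) \<longlonglongrightarrow>
        measure (distr limit_law config_space ?\<tau>) (cylinder F B)"
      unfolding limit_law_def dist[OF limit_config_measurable] by simp
    then show "measure (distr limit_law config_space ?\<tau>) (cylinder F B) = measure limit_law (cylinder F B)"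
      using LIMSEQ_unique empty_law_converges[OF F order_refl, of B] by simp
  qed
qed

text \<open>Evolving \<open>empty_law n\<close> for time \<open>t\<close> gives
  \<open>empty_law (n + t)\<close>, and both sequences tend to the limit law. The limit passes
  through the evolution by \<open>evolve_continuous\<close>, even though the coordinates converge at
  different speeds.\<close>

lemma limit_law_stationary: "flow_stationary limit_law"
  unfolding flow_stationary_def
proof (intro allI impI)
  fix t :: real assume t: "0 \<le> t"
  interpret MM: pair_prob_space M M ..
  let ?fl = "\<lambda>X (\<omega>, \<omega>'). flow 0 t (X \<omega>) (drive \<omega>')"
  note rs = random_initial_state[OF _ t]
  show "distr (limit_law \<Otimes>\<^sub>M M) config_space (\<lambda>(\<xi>, \<omega>). flow 0 t \<xi> (drive \<omega>)) = limit_law"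
    unfolding limit_law_def rs(2)[OF limit_config_measurable] unfolding limit_law_def[symmetric]
  proof (rule config_prob_eqI[OF _ limit_law_config_prob])
    show "config_prob (distr (M \<Otimes>\<^sub>M M) config_space (?fl limit_config))"
      by (rule config_prob_distr[OF MM.prob_space_axioms rs(1)[OF limit_config_measurable]])
    fix F B assume F: "finite (F :: (int ^ 'd) set)"
    have "(\<lambda>n. measure (distr (M \<Otimes>\<^sub>M M) config_space (?fl (coupled (real n)))) (cylinder F B)) \<longlonglongrightarrow>
        measure (distr (M \<Otimes>\<^sub>M M) config_space (?fl limit_config)) (cylinder F B)"
    proof (rule cylinder_convergence[OF MM.prob_space_axioms rs(1)[OF coupled_measurable] rs(1)[OF limit_config_measurable] _ F])
      have "AE \<omega> in M. \<forall>i. \<forall>\<^sub>F n in sequentially. coupled (real n) \<omega> i = limit_config \<omega> i"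
        by (rule AE_coupled_converges[OF filterlim_real_sequentially])
      then have "AE \<omega> in distr (M \<Otimes>\<^sub>M M) M fst. \<forall>i. \<forall>\<^sub>F n in sequentially. coupled (real n) \<omega> i = limit_config \<omega> i"
        unfolding distr_pair_fst .
      then have "AE x in M \<Otimes>\<^sub>M M. \<forall>i. \<forall>\<^sub>F n in sequentially. coupled (real n) (fst x) i = limit_config (fst x) i"
        by (rule AE_distrD[OF measurable_fst])
      then show "AE x in M \<Otimes>\<^sub>M M. \<forall>i. \<forall>\<^sub>F n in sequentially. ?fl (coupled (real n)) x i = ?fl limit_config x i"
        using AE_good_pair[OF prob_space_axioms]
      proof eventually_elim
        case (elim x)
        then show ?case
          using driven.evolve_continuous[OF good_driven[OF elim(2)], where F = sequentially
              and \<Xi> = "\<lambda>n. coupled (real n) (fst x)" and \<xi> = "limit_config (fst x)" and s = 0 and t = t] t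
          unfolding flow_def by (simp add: split_beta)
      qed
    qed simp
    moreover have "distr (M \<Otimes>\<^sub>M M) config_space (?fl (coupled (real n))) = empty_law (real n + t)" for n
      using rs(2)[OF coupled_measurable[of "real n"]] empty_law_semigroup[of "real n" t] t by (simp add: coupled_law)
    ultimately have "(\<lambda>n. measure (empty_law (real n + t)) (cylinder F B)) \<longlonglongrightarrow>
        measure (distr (M \<Otimes>\<^sub>M M) config_space (?fl limit_config)) (cylinder F B)" by simp
    then show "measure (distr (M \<Otimes>\<^sub>M M) config_space (?fl limit_config)) (cylinder F B) = measure limit_law (cylinder F B)"
      by (rule LIMSEQ_unique[OF _ empty_law_converges[OF F t]])
  qed
qed

lemma limit_law_second_moment: "finite_second_moment limit_law"
  unfolding finite_second_moment_def
proof
  fix i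
  have "(\<integral>\<^sup>+ y. (of_nat (y i))\<^sup>2 \<partial>limit_law) = (\<integral>\<^sup>+ \<omega>. (of_nat (limit_config \<omega> i))\<^sup>2 \<partial>M)"
    unfolding limit_law_def
    by (rule nn_integral_distr[OF limit_config_measurable]) (unfold measurable_distr_eq1, measurable)
  also have "\<dots> \<le> (\<integral>\<^sup>+ \<omega>. moment_sup i \<omega> \<partial>M)"
  proof (rule nn_integral_mono_AE)
    show "AE \<omega> in M. (of_nat (limit_config \<omega> i))\<^sup>2 \<le> moment_sup i \<omega>"
      using AE_good AE_bounded
    proof eventually_elim
      case (elim \<omega>)
      then obtain n where n: "coupled (real n) \<omega> i = limit_config \<omega> i" using limit_config_props(4) by blast
      show ?case unfolding moment_sup_def n[symmetric] by (rule SUP_upper) simp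
    qed
  qed
  also have "\<dots> < \<infinity>" by (rule moment_sup_finite(1)[OF second_moment])
  finally show "(\<integral>\<^sup>+ y. (of_nat (y i))\<^sup>2 \<partial>limit_law) < \<infinity>" .
qed

text \<open>The coupled states are dominated by \<open>limit_config\<close>, whose mean is finite by
  its second moment.\<close>

lemma empty_law_mean_converges:
  "(\<lambda>n. \<integral>y. real (y i) \<partial>empty_law (real n)) \<longlonglongrightarrow> (\<integral>y. real (y i) \<partial>limit_law)"
proof -
  have meas: "(\<lambda>y. real (y i)) \<in> borel_measurable config_space" by measurable
  have val: "(\<integral>y. real (y i) \<partial>distr M config_space X) = (\<integral>\<omega>. real (X \<omega> i) \<partial>M)" if "X \<in> M \<rightarrow>\<^sub>M config_space" for X
    by (rule integral_distr[OF that meas])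
  have "integrable limit_law (\<lambda>y. real (y i))"
    by (rule pair_moments(2)[OF limit_law_config_prob limit_law_second_moment])
  then have int: "integrable M (\<lambda>\<omega>. real (limit_config \<omega> i))"
    unfolding limit_law_def by (subst (asm) integrable_distr_eq[OF limit_config_measurable meas])
  have "(\<lambda>n. \<integral>\<omega>. real (coupled (real n) \<omega> i) \<partial>M) \<longlonglongrightarrow> (\<integral>\<omega>. real (limit_config \<omega> i) \<partial>M)"
  proof (rule integral_dominated_convergence[OF _ _ int])
    show "AE \<omega> in M. (\<lambda>n. real (coupled (real n) \<omega> i)) \<longlonglongrightarrow> real (limit_config \<omega> i)"
      using AE_coupled_converges[OF filterlim_real_sequentially]
    proof eventually_elim
      case (elim \<omega>)
      then have "\<forall>\<^sub>F n in sequentially. real (coupled (real n) \<omega> i) = real (limit_config \<omega> i)"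
        by (auto elim: eventually_mono)
      then show ?case by (rule tendsto_eventually)
    qed
    show "AE \<omega> in M. norm (real (coupled (real n) \<omega> i)) \<le> real (limit_config \<omega> i)" for n
      using AE_good AE_bounded by eventually_elim (simp add: limit_config_props(1))
  qed (use int in auto)
  then show ?thesis
    unfolding limit_law_def val[OF limit_config_measurable] by (simp add: coupled_law[symmetric] val coupled_measurable)
qed

text \<open>
  In the coupling with the system started empty, both solutions have the same mean in the limit, and
  one dominates the other.
\<close>
theorem limit_law_unique:
  assumes \<pi>: "config_prob \<pi>" and ti: "translation_invariant \<pi>" and stat: "flow_stationary \<pi>"
    and fin: "finite_second_moment \<pi>"
  shows "\<pi> = limit_law"
proof (rule config_prob_eqI[OF \<pi> limit_law_config_prob])
  have prob_\<pi>: "prob_space \<pi>" and sets_\<pi>: "sets \<pi> = sets config_space"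
    using \<pi> unfolding config_prob_def by auto
  interpret \<pi>: prob_space \<pi> by (rule prob_\<pi>)
  interpret P: pair_prob_space \<pi> M ..
  let ?N = "\<pi> \<Otimes>\<^sub>M M"
  define m where "m = (\<integral>y. real (y 0) \<partial>limit_law)"
  have "m * (1 - lam * (\<Sum>j | 0 < a j. a j)) = lam * a 0"
    "(\<integral>y. real (y 0) \<partial>\<pi>) * (1 - lam * (\<Sum>j | 0 < a j. a j)) = lam * a 0"
    unfolding m_def
    using stationary_mean[OF limit_law_config_prob limit_law_translation_invariant limit_law_stationary limit_law_second_moment]
      stationary_mean[OF \<pi> ti stat fin] by auto
  moreover have "lam * a 0 \<noteq> 0" using lam_pos a_zero by simp
  \<comment> \<open>Both means solve the same linear equation. Its right-hand side is nonzero, so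
    the common factor is nonzero and cancels.\<close>
  ultimately have "(\<integral>y. real (y 0) \<partial>\<pi>) = m" by (metis mult_cancel_right mult_zero_right)
  then have mean_\<pi>: "(\<integral>y. real (y i) \<partial>\<pi>) = m" for i
    using translation_invariant_integral[OF \<pi> ti, of "\<lambda>y. real (y i)" i] by simp
  have mean_l: "(\<integral>y. real (y i) \<partial>limit_law) = m" for i
    using translation_invariant_integral[OF limit_law_config_prob limit_law_translation_invariant, of "\<lambda>y. real (y i)" i]
    unfolding m_def by simp
  fix F B assume F: "finite (F :: (int ^ 'd) set)"
  let ?C = "cylinder F B"
  \<comment> \<open>One pattern drives both systems from time 0. \<open>U n\<close> has law \<pi>
    for every \<open>n\<close>, while \<open>V n\<close> has law \<open>empty_law n\<close> and
    approaches the minimal law.\<close>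
  define U where "U = (\<lambda>n::nat. \<lambda>(\<xi>, \<omega>). flow 0 (real n) \<xi> (drive \<omega>))"
  define V where "V = (\<lambda>(n::nat) (x :: (int ^ 'd \<Rightarrow> nat) \<times> 'w). flow 0 (real n) (\<lambda>_. 0) (drive (snd x)))"
  have U: "U n \<in> ?N \<rightarrow>\<^sub>M config_space" for n
    unfolding U_def by (rule flow_drive_measurable[OF _ sets_\<pi>]) simp
  have V: "V n \<in> ?N \<rightarrow>\<^sub>M config_space" for n
    unfolding V_def by (rule measurable_compose[OF measurable_snd flow_drive_measurable1]) simp
  have law_U: "distr ?N config_space (U n) = \<pi>" for n
    using stat unfolding flow_stationary_def U_def by simp
  have law_V: "distr ?N config_space (V n) = empty_law (real n)" for n
  proof -
    have "distr ?N config_space (V n) = distr (distr ?N M snd) config_space (\<lambda>\<omega>. flow 0 (real n) (\<lambda>_. 0) (drive \<omega>))"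
      unfolding V_def
      by (subst distr_distr[OF flow_drive_measurable1 measurable_snd]) (simp_all add: comp_def)
    then show ?thesis unfolding distr_pair_second[OF prob_\<pi> prob_space_axioms] empty_law_def .
  qed
  have VU: "AE x in ?N. V n x \<le> U n x" for n
    using AE_good_pair[OF prob_\<pi>]
  proof eventually_elim
    case (elim x)
    show ?case
      using driven.evolve_mono[OF good_driven[OF elim], of "\<lambda>_. 0" "fst x" 0 "real n"] elim
      unfolding U_def V_def flow_def by (simp add: split_beta le_fun_def)
  qed
  have meas: "(\<lambda>y. real (y i)) \<in> borel_measurable config_space" for i :: "int ^ 'd" by measurable
  have int_U: "integrable ?N (\<lambda>x. real (U n x i))" and mean_U: "(\<integral>x. real (U n x i) \<partial>?N) = m" for n i
  proof -
    show "integrable ?N (\<lambda>x. real (U n x i))"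
      using pair_moments(2)[OF \<pi> fin, of i] integrable_distr_eq[OF U[of n] meas[of i]] unfolding law_U by simp
    show "(\<integral>x. real (U n x i) \<partial>?N) = m"
      using integral_distr[OF U[of n] meas[of i]] mean_\<pi>[of i] unfolding law_U by simp
  qed
  have meas_UV: "(\<lambda>x. U n x i) \<in> ?N \<rightarrow>\<^sub>M count_space UNIV" "(\<lambda>x. V n x i) \<in> ?N \<rightarrow>\<^sub>M count_space UNIV" for n i
    using U[of n] V[of n] unfolding measurable_config_iff by auto
  note [measurable] = meas_UV
  have int_V: "integrable ?N (\<lambda>x. real (V n x i))" for n i
    by (rule Bochner_Integration.integrable_bound[OF int_U[of n i]])
      (measurable, use VU[of n] in \<open>auto simp: le_fun_def elim!: eventually_mono\<close>)
  have mean_V: "(\<integral>x. real (V n x i) \<partial>?N) = (\<integral>y. real (y i) \<partial>empty_law (real n))" for n i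
    using integral_distr[OF V[of n] meas[of i]] unfolding law_V by simp
  let ?ne = "\<lambda>n i. {x \<in> space ?N. U n x i \<noteq> V n x i}"
  have ne_sets: "?ne n i \<in> sets ?N" for n i
  proof -
    have "{x \<in> space ?N. real (U n x i) \<noteq> real (V n x i)} \<in> sets ?N"
      by (rule borel_measurable_neq) (rule borel_measurable_integrable[OF int_U] borel_measurable_integrable[OF int_V])+
    then show ?thesis by simp
  qed
  \<comment> \<open>Markov's inequality for integers: where the ordered values differ, they differ
    by at least 1.\<close>
  have ne: "P.prob (?ne n i) \<le> m - (\<integral>y. real (y i) \<partial>empty_law (real n))" for n i
  proof -
    have "P.prob (?ne n i) = (\<integral>x. indicator (?ne n i) x \<partial>?N)" using ne_sets by simp
    also have "\<dots> \<le> (\<integral>x. real (U n x i) - real (V n x i) \<partial>?N)"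
    proof (rule integral_mono_AE)
      show "integrable ?N (\<lambda>x. indicator (?ne n i) x :: real)"
        using ne_sets by (intro integrable_real_indicator) (auto simp: P.emeasure_eq_measure)
      show "integrable ?N (\<lambda>x. real (U n x i) - real (V n x i))" using int_U int_V by simp
      show "AE x in ?N. indicator (?ne n i) x \<le> real (U n x i) - real (V n x i)"
        using VU[of n]
      proof eventually_elim
        case (elim x)
        then have "V n x i \<le> U n x i" by (simp add: le_fun_def)
        then show ?case by (auto simp: indicator_def)
      qed
    qed
    also have "\<dots> = m - (\<integral>y. real (y i) \<partial>empty_law (real n))"
      using int_U int_V by (simp add: mean_U mean_V)
    finally show ?thesis .
  qed
  have close: "\<bar>measure \<pi> ?C - measure (empty_law (real n)) ?C\<bar> \<le> (\<Sum>i\<in>F. m - (\<integral>y. real (y i) \<partial>empty_law (real n)))" for n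
  proof -
    let ?W = "\<Union>i\<in>F. ?ne n i"
    let ?CU = "U n -` ?C \<inter> space ?N" and ?CV = "V n -` ?C \<inter> space ?N"
    have s: "?CU \<in> sets ?N" "?CV \<in> sets ?N" "?W \<in> sets ?N"
      using measurable_sets[OF U cylinder_sets[OF F]] measurable_sets[OF V cylinder_sets[OF F]] F ne_sets by auto
    have v: "measure \<pi> ?C = P.prob ?CU" "measure (empty_law (real n)) ?C = P.prob ?CV"
      using measure_distr[OF U cylinder_sets[OF F], of n B] measure_distr[OF V cylinder_sets[OF F], of n B]
      unfolding law_U law_V by auto
    \<comment> \<open>The two systems can disagree about a cylinder only by differing at one of its
      finitely many coordinates.\<close>
    have "?CU \<subseteq> ?CV \<union> ?W" "?CV \<subseteq> ?CU \<union> ?W" unfolding cylinder_def by auto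
    then have "P.prob ?CU \<le> P.prob ?CV + P.prob ?W" "P.prob ?CV \<le> P.prob ?CU + P.prob ?W"
      using s P.finite_measure_mono[of ?CU "?CV \<union> ?W"] P.finite_measure_mono[of ?CV "?CU \<union> ?W"]
        measure_Un_le[of ?CV ?N ?W] measure_Un_le[of ?CU ?N ?W] by auto
    moreover have "P.prob ?W \<le> (\<Sum>i\<in>F. P.prob (?ne n i))"
      using ne_sets by (intro P.finite_measure_subadditive_finite[OF F]) auto
    moreover have "\<dots> \<le> (\<Sum>i\<in>F. m - (\<integral>y. real (y i) \<partial>empty_law (real n)))" by (intro sum_mono ne)
    ultimately show ?thesis unfolding v by linarith
  qed
  have "(\<lambda>n. \<Sum>i\<in>F. m - (\<integral>y. real (y i) \<partial>empty_law (real n))) \<longlonglongrightarrow> (\<Sum>i\<in>F. m - m)"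
    using empty_law_mean_converges unfolding mean_l by (intro tendsto_intros)
  then have "(\<lambda>n. \<Sum>i\<in>F. m - (\<integral>y. real (y i) \<partial>empty_law (real n))) \<longlonglongrightarrow> 0" by simp
  then have "(\<lambda>n. measure \<pi> ?C - measure (empty_law (real n)) ?C) \<longlonglongrightarrow> 0"
    by (rule Lim_null_comparison[rotated]) (use close in simp)
  moreover have "(\<lambda>n. measure \<pi> ?C - measure (empty_law (real n)) ?C) \<longlonglongrightarrow> measure \<pi> ?C - measure limit_law ?C"
    using empty_law_converges[OF F order_refl, of B] by (intro tendsto_intros) simp
  ultimately show "measure \<pi> ?C = measure limit_law ?C" using LIMSEQ_unique by fastforce
qed

end

theorem proposition1p2:
  fixes M :: "'w measure"
    and lam :: real
    and a :: "int ^ 'd \<Rightarrow> real"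
    and A :: "int ^ 'd \<Rightarrow> 'w \<Rightarrow> real set"
    and D :: "int ^ 'd \<Rightarrow> 'w \<Rightarrow> (real \<times> real) set"
  assumes "prob_space M"
    and "0 < lam"
    and "interference_sequence a"
    and "driving_processes M lam a A D"
    and "(\<integral>\<^sup>+ \<omega>. (ennreal_of_enat (x_inf a A D 0 \<omega> 0))\<^sup>2 \<partial>completion M) < \<infinity>"
  shows "(AE \<omega> in M. \<forall>i. x_inf a A D 0 \<omega> i \<noteq> \<infinity>) \<and>
    (config_prob (minimal_law M a A D) \<and>
     translation_invariant (minimal_law M a A D) \<and>
     stationary M a A D (minimal_law M a A D) \<and>
     finite_second_moment (minimal_law M a A D)) \<and>
    (\<forall>\<pi>. config_prob \<pi> \<and> translation_invariant \<pi> \<and> stationary M a A D \<pi> \<and>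
         finite_second_moment \<pi> \<longrightarrow> \<pi> = minimal_law M a A D)"
proof -
  interpret stable_network a M lam A D
    using assms
    by (simp add: stable_network_def stable_network_axioms_def network_def network_axioms_def interference_def)
  have "AE \<omega> in M. \<forall>i. x_inf a A D 0 \<omega> i \<noteq> \<infinity>"
    using AE_x_inf by eventually_elim simp
  then show ?thesis
    unfolding minimal_law_eq
    using limit_law_config_prob limit_law_translation_invariant limit_law_stationary limit_law_second_moment
      limit_law_unique stationary_iff by blast
qed

end
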